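(* Let $(X,\mathsf d,\mathfrak m)$ be a metric measure space, $\mathscr M$ an $L^p(\mathfrak m)$-normed $L^\infty(\mathfrak m)$-module and $\mathcal V\subseteq\mathscr M$ the normed $C_b(X)$-module made of the elements of $\mathscr M$ with pointwise norm in $L^\infty(\mathfrak m)$, normed by $\|v\|:=\||v|\|_{L^\infty(\mathfrak m)}$. Let $\mathcal W\subseteq\mathcal V$ be a subspace that, with the inherited structure, is a normed $\mathcal R$-module for some subring $\mathcal R\subseteq C_b(X)$ that approximates open sets. Assume that $$\frac1{1\vee|v|}\,v\in\mathcal W\quad\text{for every }v\in\mathcal W$$ and that $\mathcal W$ generates $\mathscr M$ in the sense of modules. Let $\mathsf N$ be a local vector measure defined on $\mathcal W$ with $|\mathsf N|\ll\mathfrak m$, and let $\mathsf N=L_{\mathsf N}|\mathsf N|$ be its polar decomposition. Then the following are equivalent: (i) $\mathsf N$ is strongly local on $\mathcal W$, i.e. for every $v\in\mathcal W$ and every Borel $B\subseteq X$, $\mathsf N(B)(v)=0$ whenever $|v|=0$ $|\mathsf N|$-a.e. on $B$; (ii) there exists $M_{\mathsf N}\in\mathscr M^*$ (the dual in the sense of modules) such that $|M_{\mathsf N}|=1$ $|\mathsf N|$-a.e. and for every $v\in\mathcal W$ $$L_{\mathsf N}(x)(v)=M_{\mathsf N}(v)(x)\quad\text{for }|\mathsf N|\text{-a.e. }x\in X.$$ Moreover, if these hold, the formula $$\hat{\mathsf N}(B)(v):=\int_BM_{\mathsf N}(v)\,\mathrm d|\mathsf N|,\qquad B\subseteq X\text{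 Borel},\ v\in\mathcal V,$$ provides the unique extension of $\mathsf N$ to a strongly local vector measure defined on $\mathcal V$.
   Context: A metric measure space is a triple $(X,\mathsf d,\mathfrak m)$ with $(X,\mathsf d)$ complete separable and $\mathfrak m$ a nonnegative Borel measure finite on balls (with full support). **$L^p$-normed modules** (Gigli). An $L^p(\mathfrak m)$-normed $L^\infty(\mathfrak m)$-module, $p\in[1,\infty]$, is a Banach space $\mathscr M$ that is a module over $L^\infty(\mathfrak m)$ with a pointwise norm $|\cdot|:\mathscr M\to L^p(\mathfrak m)^+$ such that $\|v\|=\||v|\|_{L^p}$, $|fv|=|f||v|$ $\mathfrak m$-a.e. (and with the usual locality and gluing properties). $\mathcal W$ generates $\mathscr M$ in the sense of modules if the following set is dense in $\mathscr M$: all $v\in\mathscr M$ for which there is a countable Borel partition $\{B_k\}$ of $X$ such that each $\chi_{B_k}v$ is a finite $L^\infty(\mathfrak m)$-linear combination of elements of $\mathcal W$. The dual in the sense of modules $\mathscr M^*$ is the set of $L^\infty(\mathfrak m)$-linear continuous maps $M:\mathscr M\to L^1(\mathfrak m)$, with pointwise norm $|M|:=\operatorname{ess\,sup}\{|M(v)|:v\in\mathscr M,\ |v|\le1\ \mathfrak m\text{-a.e.}\}$, which belongs to $L^q(\mathfrak m)$, $\frac1p+\frac1q=1$. **Local vector measures.** A subring $\mathcal R\subseteq C_b(X)$ (bounded continuous functions; $\mathcal R$ contains the unity) approximates open sets if it is a lattice, closed under multiplication by constants, and for every open $A$ there is $\{f_k\}_k\subseteq\mathcal R$ with $f_k\nearrow\chi_A$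 pointwise. A normed $\mathcal R$-module is a normed space $(\mathcal U,\|\cdot\|)$ that is algebraically a module over $\mathcal R$ with $\|\sum_if_iv_i\|\le\max_i\|f_i\|_\infty\max_i\|v_i\|$ for finitely many $v_i\in\mathcal U$ and $f_i\in\mathcal R$ with pairwise disjoint supports; a normed $C_b(X)$-module is the case $\mathcal R=C_b(X)$. For $A$ open and $v\in\mathcal U$, $\|v\|_{|A}:=\sup\{\|fv\|:f\in\mathcal R,\operatorname{supp}f\subseteq A,\|f\|_\infty\le1\}$. A local vector measure on $\mathcal U$ is a map $\mathsf N$ from the Borel sets of $X$ to the normed dual $(\mathcal U',\|\cdot\|')$, $\sigma$-additive with respect to norm convergence, with $\mathsf N(A)(v)=0$ whenever $A$ is open and $\|v\|_{|A}=0$. Its total variation is $|\mathsf N|(E):=\sup_\pi\sum_{A\in\pi}\|\mathsf N(A)\|'$, over finite Borel partitions $\pi$ of $E$ (a finite measure). Every local vector measure has a polar decomposition $\mathsf N=L_{\mathsf N}|\mathsf N|$: a map $L_{\mathsf N}:X\to\mathcal U'$ such that for every $v\in\mathcal U$ the function $L_{\mathsf N}(v):x\mapsto L_{\mathsf N}(x)(v)$ is in $L^1(|\mathsf N|)$, $\mathsf N(A)(v)=\int_AL_{\mathsf N}(v)\,\mathrm d|\mathsf N|$ for all Borel $A$, and $|L_{\mathsf N}(x)(v)|\le\inf\{\|v\|_{|A}:A\text{ open},x\in A\}$ for all $x$ and $v$; for each $v$, $L_{\mathsf N}(v)$ is unique up to $|\mathsf N|$-a.e. equality. A local vector measure $\mathsf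 N$ on $\mathcal V$ is strongly local if $\mathsf N(B)(v)=0$ for every Borel $B$ and $v\in\mathcal V$ with $|v|=0$ $\mathfrak m$-a.e. on $B$.
   Formalization: As stated, (i)⇒(ii) can fail for p>1 and infinite m. Proved: (i)⇔(ii) with M_N only locally in M* (χ_B M_N ∈ M* for bounded Borel B); with M_N in M* itself if p=1 or |N| is concentrated on a set of finite m-measure. The extension claim holds for every such M_N. *)

theory Defs
  imports "HOL-Analysis.Analysis" "HOL-Probability.Essential_Supremum"
begin

text \<open>
  Elements of \<open>L\<^sup>p(m)\<close> are given throughout by representatives \<open>'a \<Rightarrow> real\<close>; identities between
  them are stated \<open>m\<close>-a.e.
\<close>

section \<open>Metric measure spaces and Lebesgue spaces\<close>

locale metric_measure_space =
  fixes m :: "'a::polish_space measure"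
  assumes sets_eq_borel: "sets m = sets borel"
    and emeasure_ball_finite: "\<And>x r. emeasure m (ball x r) < \<infinity>"
    and full_support: "\<And>U. open U \<Longrightarrow> U \<noteq> {} \<Longrightarrow> emeasure m U > 0"

definition Lp_space :: "'a measure \<Rightarrow> ennreal \<Rightarrow> ('a \<Rightarrow> real) set" where
  "Lp_space m p = {f \<in> borel_measurable m.
     if p = \<infinity> then esssup m (\<lambda>x. ereal \<bar>f x\<bar>) < \<infinity>
     else integrable m (\<lambda>x. \<bar>f x\<bar> powr enn2real p)}"

definition Lp_norm :: "'a measure \<Rightarrow> ennreal \<Rightarrow> ('a \<Rightarrow> real) \<Rightarrow> real" where
  "Lp_norm m p f =
     (if p = \<infinity> then real_of_ereal (esssup m (\<lambda>x. ereal \<bar>f x\<bar>))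
      else (\<integral>x. \<bar>f x\<bar> powr enn2real p \<partial>m) powr (1 / enn2real p))"

text \<open>The essential supremum of a (possibly uncountable) family of functions. It exists and is
  unique up to a.e. equality whenever \<open>m\<close> is sigma-finite, in particular on a metric measure space.\<close>

definition is_ess_Sup :: "'a measure \<Rightarrow> ('a \<Rightarrow> ennreal) set \<Rightarrow> ('a \<Rightarrow> ennreal) \<Rightarrow> bool" where
  "is_ess_Sup m F g \<longleftrightarrow>
     g \<in> borel_measurable m \<and> (\<forall>f\<in>F. AE x in m. f x \<le> g x) \<and>
     (\<forall>h\<in>borel_measurable m. (\<forall>f\<in>F. AE x in m. f x \<le> h x) \<longrightarrow> (AE x in m. g x \<le> h x))"

definition ess_Sup :: "'a measure \<Rightarrow> ('a \<Rightarrow> ennreal) set \<Rightarrow> 'a \<Rightarrow> ennreal" where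
  "ess_Sup m F = (SOME g. is_ess_Sup m F g)"

section \<open>Normed modules over \<open>L\<^sup>\<infinity>(m)\<close>\<close>

text \<open>\<open>act f v\<close> is the product \<open>f v\<close> and is only constrained for \<open>f \<in> L\<^sup>\<infinity>(m)\<close>;
  \<open>pn v\<close> is (a representative of) the pointwise norm \<open>|v|\<close>.\<close>

locale Lp_normed_module = metric_measure_space m
  for m :: "'a::polish_space measure" +
  fixes p :: ennreal
    and act :: "('a \<Rightarrow> real) \<Rightarrow> 'm::banach \<Rightarrow> 'm"
    and pn :: "'m \<Rightarrow> 'a \<Rightarrow> real"
  assumes p_ge_1: "1 \<le> p"
    and act_cong: "\<And>f g v. f \<in> Lp_space m \<infinity> \<Longrightarrow> g \<in> Lp_space m \<infinity> \<Longrightarrow>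
          (AE x in m. f x = g x) \<Longrightarrow> act f v = act g v"
    and act_add_right: "\<And>f v w. f \<in> Lp_space m \<infinity> \<Longrightarrow> act f (v + w) = act f v + act f w"
    and act_add_left: "\<And>f g v. f \<in> Lp_space m \<infinity> \<Longrightarrow> g \<in> Lp_space m \<infinity> \<Longrightarrow>
          act (\<lambda>x. f x + g x) v = act f v + act g v"
    and act_act: "\<And>f g v. f \<in> Lp_space m \<infinity> \<Longrightarrow> g \<in> Lp_space m \<infinity> \<Longrightarrow>
          act f (act g v) = act (\<lambda>x. f x * g x) v"
    and act_const: "\<And>c v. act (\<lambda>x. c) v = c *\<^sub>R v"
    and pn_Lp: "\<And>v. pn v \<in> Lp_space m p"
    and pn_nonneg: "\<And>v. AE x in m. 0 \<le> pn v x"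
    and norm_eq: "\<And>v. norm v = Lp_norm m p (pn v)"
    and pn_act: "\<And>f v. f \<in> Lp_space m \<infinity> \<Longrightarrow> AE x in m. pn (act f v) x = \<bar>f x\<bar> * pn v x"
    and locality: "\<And>A v. (\<And>n::nat. A n \<in> sets borel) \<Longrightarrow>
          (\<And>n. act (indicat_real (A n)) v = 0) \<Longrightarrow> act (indicat_real (\<Union>n. A n)) v = 0"
    and gluing: "\<And>A v. (\<And>n::nat. A n \<in> sets borel) \<Longrightarrow>
          (\<And>i j. act (indicat_real (A i \<inter> A j)) (v i) = act (indicat_real (A i \<inter> A j)) (v j)) \<Longrightarrow>
          Bseq (\<lambda>n. \<Sum>i<n. act (indicat_real (A i)) (v i)) \<Longrightarrow>
          \<exists>w. (\<forall>i. act (indicat_real (A i)) w = act (indicat_real (A i)) (v i)) \<and>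
              ereal (norm w) \<le> liminf (\<lambda>n. ereal (norm (\<Sum>i<n. act (indicat_real (A i)) (v i))))"

definition generates ::
  "'a::topological_space measure \<Rightarrow> (('a \<Rightarrow> real) \<Rightarrow> 'm::real_normed_vector \<Rightarrow> 'm) \<Rightarrow> 'm set \<Rightarrow> bool" where
  "generates m act W \<longleftrightarrow>
     closure {v. \<exists>B :: nat \<Rightarrow> 'a set.
       (\<forall>k. B k \<in> sets borel) \<and> disjoint_family B \<and> (\<Union>k. B k) = UNIV \<and>
       (\<forall>k. \<exists>(n::nat) f w. (\<forall>i<n. f i \<in> Lp_space m \<infinity> \<and> w i \<in> W) \<and>
          act (indicat_real (B k)) v = (\<Sum>i<n. act (f i) (w i)))} = UNIV"

definition module_dual ::
  "'a measure \<Rightarrow> (('a \<Rightarrow> real) \<Rightarrow> 'm::real_normed_vector \<Rightarrow> 'm) \<Rightarrow> ('m \<Rightarrow> 'a \<Rightarrow> real) set" where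
  "module_dual m act = {M.
     (\<forall>v. integrable m (M v)) \<and>
     (\<forall>v w. AE x in m. M (v + w) x = M v x + M w x) \<and>
     (\<forall>f\<in>Lp_space m \<infinity>. \<forall>v. AE x in m. M (act f v) x = f x * M v x) \<and>
     (\<forall>u v. u \<longlonglongrightarrow> v \<longrightarrow> (\<lambda>n::nat. \<integral>x. \<bar>M (u n) x - M v x\<bar> \<partial>m) \<longlonglongrightarrow> 0)}"

text \<open>The local version of the dual: \<open>M\<close> takes values in the functions that are integrable on
  bounded sets, i.e.\ \<open>\<chi>\<^sub>B M\<close> is in the dual for every bounded Borel set \<open>B\<close>. For \<open>p > 1\<close> the dual
  has pointwise norms in \<open>L\<^sup>q(m)\<close> with \<open>q < \<infinity>\<close>, so if \<open>m\<close> is infinite it has no element with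
  \<open>|M| = 1\<close> a.e.; the local dual does not have this restriction.\<close>

definition local_module_dual ::
  "'a::metric_space measure \<Rightarrow> (('a \<Rightarrow> real) \<Rightarrow> 'm::real_normed_vector \<Rightarrow> 'm) \<Rightarrow> ('m \<Rightarrow> 'a \<Rightarrow> real) set" where
  "local_module_dual m act = {M.
     \<forall>B\<in>sets borel. bounded B \<longrightarrow> (\<lambda>v x. indicator B x * M v x) \<in> module_dual m act}"

lemma module_dual_subset_local:
  fixes m :: "'a::metric_space measure"
    and act :: "('a \<Rightarrow> real) \<Rightarrow> 'm::real_normed_vector \<Rightarrow> 'm"
  assumes "sets m = sets borel"
  shows "module_dual m act \<subseteq> local_module_dual m act"
proof
  fix M assume M: "M \<in> module_dual m act"
  have int: "integrable m (\<lambda>x. indicator B x * M v x)" if "B \<in> sets borel" for B v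
    using integrable_mult_indicator[of B m "M v"] that M assms by (auto simp: module_dual_def)
  have int_diff: "integrable m (\<lambda>x. \<bar>M v x - M w x\<bar>)" for v w
    using M by (auto simp: module_dual_def)
  have lim: "(\<lambda>n. \<integral>x. \<bar>indicator B x * M (u n) x - indicator B x * M v x\<bar> \<partial>m) \<longlonglongrightarrow> 0"
    if B: "B \<in> sets borel" and u: "u \<longlonglongrightarrow> v" for B and u :: "nat \<Rightarrow> _" and v
  proof (rule tendsto_sandwich[where f = "\<lambda>_. 0" and h = "\<lambda>n. \<integral>x. \<bar>M (u n) x - M v x\<bar> \<partial>m"])
    show "(\<lambda>n. \<integral>x. \<bar>M (u n) x - M v x\<bar> \<partial>m) \<longlonglongrightarrow> 0"
      using M u by (simp add: module_dual_def)
    show "\<forall>\<^sub>F n in sequentially. (\<integral>x. \<bar>indicator B x * M (u n) x - indicator B x * M v x\<bar> \<partial>m)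
        \<le> (\<integral>x. \<bar>M (u n) x - M v x\<bar> \<partial>m)"
      by (intro always_eventually allI integral_mono integrable_abs Bochner_Integration.integrable_diff
            int[OF B] int_diff) (auto split: split_indicator)
  qed auto
  show "M \<in> local_module_dual m act"
    unfolding local_module_dual_def module_dual_def mem_Collect_eq
  proof (intro ballI allI impI conjI)
    fix B :: "'a set" and v w assume "B \<in> sets borel"
    have "AE x in m. M (v + w) x = M v x + M w x"
      using M by (simp add: module_dual_def)
    then show "AE x in m. indicator B x * M (v + w) x = indicator B x * M v x + indicator B x * M w x"
      by eventually_elim (simp add: algebra_simps)
  next
    fix B :: "'a set" and f v assume "f \<in> Lp_space m \<infinity>"
    then have "AE x in m. M (act f v) x = f x * M v x"
      using M by (simp add: module_dual_def)
    then show "AE x in m. indicator B x * M (act f v) x = f x * (indicator B x * M v x)"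
      by eventually_elim simp
  qed (use int lim in auto)
qed

definition dual_pn ::
  "'a measure \<Rightarrow> ('m \<Rightarrow> 'a \<Rightarrow> real) \<Rightarrow> ('m \<Rightarrow> 'a \<Rightarrow> real) \<Rightarrow> 'a \<Rightarrow> ennreal" where
  "dual_pn m pn M = ess_Sup m {\<lambda>x. ennreal \<bar>M v x\<bar> |v. AE x in m. pn v x \<le> 1}"

definition bounded_part :: "'a measure \<Rightarrow> ('m \<Rightarrow> 'a \<Rightarrow> real) \<Rightarrow> 'm set" where
  "bounded_part m pn = {v. pn v \<in> Lp_space m \<infinity>}"

definition sup_pn :: "'a measure \<Rightarrow> ('m \<Rightarrow> 'a \<Rightarrow> real) \<Rightarrow> 'm \<Rightarrow> real" where
  "sup_pn m pn v = Lp_norm m \<infinity> (pn v)"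

section \<open>Normed modules over rings of bounded continuous functions\<close>

text \<open>\<open>bcontfun\<close> is the set of bounded continuous functions; the ring operations are pointwise.\<close>

definition supp :: "('a::topological_space \<Rightarrow> real) \<Rightarrow> 'a set" where
  "supp f = closure {x. f x \<noteq> 0}"

definition sup_norm :: "('a \<Rightarrow> real) \<Rightarrow> real" where
  "sup_norm f = (SUP x. \<bar>f x\<bar>)"

definition approximating_subring :: "('a::topological_space \<Rightarrow> real) set \<Rightarrow> bool" where
  "approximating_subring R \<longleftrightarrow>
     R \<subseteq> bcontfun \<and> (\<lambda>x. 1) \<in> R \<and>
     (\<forall>f\<in>R. \<forall>g\<in>R. (\<lambda>x. f x - g x) \<in> R \<and> (\<lambda>x. f x * g x) \<in> R) \<and>
     (\<forall>f\<in>R. \<forall>g\<in>R. (\<lambda>x. max (f x) (g x)) \<in> R \<and> (\<lambda>x. min (f x) (g x)) \<in> R) \<and>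
     (\<forall>c. \<forall>f\<in>R. (\<lambda>x. c * f x) \<in> R) \<and>
     (\<forall>A. open A \<longrightarrow> (\<exists>f :: nat \<Rightarrow> 'a \<Rightarrow> real.
        (\<forall>k. f k \<in> R) \<and> (\<forall>x. incseq (\<lambda>k. f k x)) \<and> (\<forall>x. (\<lambda>k. f k x) \<longlonglongrightarrow> indicator A x)))"

text \<open>The normed space is a subspace \<open>U\<close> of the ambient vector space with its own norm \<open>nrm\<close>,
  in general not the one of the type.\<close>

definition normed_space_on :: "'u::real_vector set \<Rightarrow> ('u \<Rightarrow> real) \<Rightarrow> bool" where
  "normed_space_on U nrm \<longleftrightarrow> subspace U \<and>
     (\<forall>v\<in>U. 0 \<le> nrm v \<and> (nrm v = 0 \<longleftrightarrow> v = 0)) \<and>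
     (\<forall>v\<in>U. \<forall>c. nrm (c *\<^sub>R v) = \<bar>c\<bar> * nrm v) \<and>
     (\<forall>v\<in>U. \<forall>w\<in>U. nrm (v + w) \<le> nrm v + nrm w)"

definition normed_module_over ::
  "('a::topological_space \<Rightarrow> real) set \<Rightarrow> 'u::real_vector set \<Rightarrow> ('u \<Rightarrow> real) \<Rightarrow>
   (('a \<Rightarrow> real) \<Rightarrow> 'u \<Rightarrow> 'u) \<Rightarrow> bool" where
  "normed_module_over R U nrm act \<longleftrightarrow>
     normed_space_on U nrm \<and>
     (\<forall>f\<in>R. \<forall>v\<in>U. act f v \<in> U) \<and>
     (\<forall>v\<in>U. act (\<lambda>x. 1) v = v) \<and>
     (\<forall>f\<in>R. \<forall>v\<in>U. \<forall>w\<in>U. act f (v + w) = act f v + act f w) \<and>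
     (\<forall>f\<in>R. \<forall>g\<in>R. \<forall>v\<in>U. act (\<lambda>x. f x + g x) v = act f v + act g v) \<and>
     (\<forall>f\<in>R. \<forall>g\<in>R. \<forall>v\<in>U. act (\<lambda>x. f x * g x) v = act f (act g v)) \<and>
     (\<forall>n>0. \<forall>f v. (\<forall>i<n. f i \<in> R \<and> v i \<in> U) \<longrightarrow>
        (\<forall>i<n. \<forall>j<n. i \<noteq> j \<longrightarrow> supp (f i) \<inter> supp (f j) = {}) \<longrightarrow>
        nrm (\<Sum>i<n. act (f i) (v i)) \<le>
          Max ((\<lambda>i. sup_norm (f i)) ` {..<n}) * Max ((\<lambda>i. nrm (v i)) ` {..<(n::nat)}))"

definition local_seminorm ::
  "('a::topological_space \<Rightarrow> real) set \<Rightarrow> ('u \<Rightarrow> real) \<Rightarrow> (('a \<Rightarrow> real) \<Rightarrow> 'u \<Rightarrow> 'u) \<Rightarrow>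
   'a set \<Rightarrow> 'u \<Rightarrow> real" where
  "local_seminorm R nrm act A v = Sup {nrm (act f v) |f. f \<in> R \<and> supp f \<subseteq> A \<and> sup_norm f \<le> 1}"

text \<open>Functionals on \<open>U\<close> are functions on the ambient type; their values off \<open>U\<close> are irrelevant.\<close>

definition dual_space :: "'u::real_vector set \<Rightarrow> ('u \<Rightarrow> real) \<Rightarrow> ('u \<Rightarrow> real) set" where
  "dual_space U nrm = {\<phi>.
     (\<forall>v\<in>U. \<forall>w\<in>U. \<phi> (v + w) = \<phi> v + \<phi> w) \<and>
     (\<forall>c. \<forall>v\<in>U. \<phi> (c *\<^sub>R v) = c * \<phi> v) \<and>
     (\<exists>C. \<forall>v\<in>U. \<bar>\<phi> v\<bar> \<le> C * nrm v)}"

definition dual_norm :: "'u set \<Rightarrow> ('u \<Rightarrow> real) \<Rightarrow> ('u \<Rightarrow> real) \<Rightarrow> real" where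
  "dual_norm U nrm \<phi> = Sup {\<bar>\<phi> v\<bar> |v. v \<in> U \<and> nrm v \<le> 1}"

section \<open>Local vector measures\<close>

definition local_vector_measure ::
  "('a::topological_space \<Rightarrow> real) set \<Rightarrow> 'u::real_vector set \<Rightarrow> ('u \<Rightarrow> real) \<Rightarrow>
   (('a \<Rightarrow> real) \<Rightarrow> 'u \<Rightarrow> 'u) \<Rightarrow> ('a set \<Rightarrow> 'u \<Rightarrow> real) \<Rightarrow> bool" where
  "local_vector_measure R U nrm act N \<longleftrightarrow>
     (\<forall>A\<in>sets borel. N A \<in> dual_space U nrm) \<and>
     (\<forall>A :: nat \<Rightarrow> 'a set. range A \<subseteq> sets borel \<longrightarrow> disjoint_family A \<longrightarrow>
        (\<lambda>n. dual_norm U nrm (\<lambda>v. N (\<Union>i. A i) v - (\<Sum>i<n. N (A i) v))) \<longlonglongrightarrow> 0) \<and>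
     (\<forall>A v. open A \<longrightarrow> v \<in> U \<longrightarrow> local_seminorm R nrm act A v = 0 \<longrightarrow> N A v = 0)"

definition total_variation ::
  "'u set \<Rightarrow> ('u \<Rightarrow> real) \<Rightarrow> ('a::topological_space set \<Rightarrow> 'u \<Rightarrow> real) \<Rightarrow> 'a set \<Rightarrow> ennreal" where
  "total_variation U nrm N E =
     (SUP \<pi> \<in> {\<pi>. finite \<pi> \<and> partition_on E \<pi> \<and> \<pi> \<subseteq> sets borel}.
        \<Sum>A\<in>\<pi>. ennreal (dual_norm U nrm (N A)))"

text \<open>\<open>measure_of\<close> returns the zero measure if its last argument is not countably additive; for a
  local vector measure the total variation always is.\<close>

definition tv_measure ::
  "'u set \<Rightarrow> ('u \<Rightarrow> real) \<Rightarrow> ('a::topological_space set \<Rightarrow> 'u \<Rightarrow> real) \<Rightarrow> 'a measure" where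
  "tv_measure U nrm N = measure_of UNIV (sets borel) (total_variation U nrm N)"

definition polar_decomposition ::
  "('a::topological_space \<Rightarrow> real) set \<Rightarrow> 'u::real_vector set \<Rightarrow> ('u \<Rightarrow> real) \<Rightarrow>
   (('a \<Rightarrow> real) \<Rightarrow> 'u \<Rightarrow> 'u) \<Rightarrow> ('a set \<Rightarrow> 'u \<Rightarrow> real) \<Rightarrow> ('a \<Rightarrow> 'u \<Rightarrow> real) \<Rightarrow> bool" where
  "polar_decomposition R U nrm act N L \<longleftrightarrow>
     (\<forall>x. L x \<in> dual_space U nrm) \<and>
     (\<forall>v\<in>U. integrable (tv_measure U nrm N) (\<lambda>x. L x v)) \<and>
     (\<forall>v\<in>U. \<forall>A\<in>sets borel. N A v = (LINT x:A|tv_measure U nrm N. L x v)) \<and>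
     (\<forall>x. \<forall>v\<in>U. \<bar>L x v\<bar> \<le> Inf {local_seminorm R nrm act A v |A. open A \<and> x \<in> A})"

definition strongly_local ::
  "'a::topological_space measure \<Rightarrow> ('u \<Rightarrow> 'a \<Rightarrow> real) \<Rightarrow> 'u set \<Rightarrow> ('a set \<Rightarrow> 'u \<Rightarrow> real) \<Rightarrow> bool" where
  "strongly_local \<mu> pn U N \<longleftrightarrow>
     (\<forall>v\<in>U. \<forall>B\<in>sets borel. (AE x in \<mu>. x \<in> B \<longrightarrow> pn v x = 0) \<longrightarrow> N B v = 0)"

definition strongly_local_extension ::
  "'a::topological_space measure \<Rightarrow> (('a \<Rightarrow> real) \<Rightarrow> 'u::real_vector \<Rightarrow> 'u) \<Rightarrow> ('u \<Rightarrow> 'a \<Rightarrow> real) \<Rightarrow>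
   'u set \<Rightarrow> ('a set \<Rightarrow> 'u \<Rightarrow> real) \<Rightarrow> ('a set \<Rightarrow> 'u \<Rightarrow> real) \<Rightarrow> bool" where
  "strongly_local_extension m act pn W N K \<longleftrightarrow>
     local_vector_measure bcontfun (bounded_part m pn) (sup_pn m pn) act K \<and>
     strongly_local m pn (bounded_part m pn) K \<and>
     (\<forall>B\<in>sets borel. \<forall>v\<in>W. K B v = N B v)"

text \<open>\<open>|M| = 1\<close> and \<open>M(v) = L(v)\<close> for all \<open>v \<in> W\<close>, \<open>\<nu>\<close>-a.e.\<close>

definition represents ::
  "'a measure \<Rightarrow> ('m \<Rightarrow> 'a \<Rightarrow> real) \<Rightarrow> 'm set \<Rightarrow> 'a measure \<Rightarrow> ('a \<Rightarrow> 'm \<Rightarrow> real) \<Rightarrow>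
   ('m \<Rightarrow> 'a \<Rightarrow> real) \<Rightarrow> bool" where
  "represents m pn W \<nu> L M \<longleftrightarrow>
     (AE x in \<nu>. dual_pn m pn M x = 1) \<and> (\<forall>v\<in>W. AE x in \<nu>. L x v = M v x)"

end

theory Submission
  imports Defs
begin

text \<open>
  Strong locality, applied to the truncation of \<open>c v\<close> at level \<open>1\<close>, turns the bound of \<open>L(v)\<close> by the
  supremum norm into the pointwise bound \<open>|L(v)| \<le> |v|\<close>. Since \<open>W\<close> generates, it is dense for the
  pointwise norm: for every \<open>v\<close> there is a countable subset of \<open>W\<close> in which, for almost every \<open>x\<close>,
  some \<open>w\<close> makes \<open>|v - w|(x)\<close> arbitrarily small. Hence there is, up to null sets, exactly one \<open>M(v)\<close>
  with \<open>|M(v) - L(w)| \<le> |v - w|\<close> for all \<open>w\<close> in \<open>W\<close>, and linearity over \<open>L\<^sup>\<infinity>\<close> follows from this characterization. If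
  \<open>|M| \<le> c < 1\<close> on a set, then the total variation of that set is at most \<open>c\<close> times itself, so it is
  null. Conversely \<open>|M(v)| \<le> |v|\<close> makes the integral formula strongly local, and the density of \<open>W\<close>
  forces uniqueness of the extension.
\<close>

text \<open>Everything known about \<open>L\<close> holds \<open>\<nu>\<close>-a.e., whereas the
  identities defining the dual hold \<open>m\<close>-a.e. So \<open>M\<close> is set to zero off a
  set \<open>P\<close> inside which \<open>m\<close> and \<open>\<nu>\<close> have the same null
  sets. Moreover each a.e. statement comes with an exceptional set depending on the vectors in it,
  so every argument at a point first passes to a countable part of \<open>W\<close> and to rational
  levels. The bound of \<open>M(v)\<close> by \<open>|v|\<close> makes \<open>M(v)\<close>
  integrable only where \<open>|v|\<close> is: on sets of finite measure, or everywhere if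
  \<open>p = 1\<close>. This is where the local dual and the dual part ways. The norm of the module
  is only an L^p norm. Pointwise facts about \<open>pn\<close> are extracted from it by testing on
  sets of positive finite measure, where a constant pointwise bound becomes a norm bound up to a
  common factor. Finally, concluding that a set is null from its variation being at most
  \<open>c < 1\<close> times itself requires \<open>\<nu>\<close> to be finite, which has to be
  derived from the module inequality for disjoint supports.\<close>

section \<open>Essential suprema\<close>

text \<open>Exhaustion: for a finite measure with the same null sets as \<open>m\<close>, some
  countable subfamily maximizes the measure of its union; adjoining a further \<open>A i\<close>
  cannot enlarge the maximum, so only a null part of \<open>A i\<close> is missed.\<close>

lemma essential_union:
  fixes A :: "'i \<Rightarrow> 'a set"
  assumes "sigma_finite_measure m" and A: "\<And>i. i \<in> I \<Longrightarrow> A i \<in> sets m"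
  obtains C where "countable C" "C \<subseteq> I" "\<And>i. i \<in> I \<Longrightarrow> A i - (\<Union>j\<in>C. A j) \<in> null_sets m"
proof -
  interpret sigma_finite_measure m by fact
  obtain h where h: "h \<in> borel_measurable m" "integral\<^sup>N m h \<noteq> \<infinity>" "\<And>x. x \<in> space m \<Longrightarrow> 0 < h x"
    using Ex_finite_integrable_function by auto
  define \<mu> where "\<mu> = density m h"
  have sets_\<mu>: "sets \<mu> = sets m" by (simp add: \<mu>_def)
  interpret \<mu>: finite_measure \<mu>
    using h by (intro finite_measureI) (simp add: \<mu>_def emeasure_density cong: nn_integral_cong)
  have null: "S \<in> null_sets m" if "S \<in> null_sets \<mu>" for S
  proof -
    have "S \<in> sets m" using that sets_\<mu> by auto
    moreover have "AE x in m. x \<notin> S"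
      using AE_not_in[OF that] h(3) AE_space[of m] unfolding \<mu>_def AE_density[OF h(1)]
      by (auto elim!: eventually_elim2)
    ultimately show ?thesis by (simp add: AE_iff_null_sets)
  qed
  define \<C> where "\<C> = {C. countable C \<and> C \<subseteq> I}"
  define F where "F C = emeasure \<mu> (\<Union>j\<in>C. A j)" for C
  have "\<C> \<noteq> {}" by (auto simp: \<C>_def)
  then have "\<exists>f. range f \<subseteq> F ` \<C> \<and> Sup (F ` \<C>) = (SUP n::nat. f n)"
    using ennreal_Sup_countable_SUP[of "F ` \<C>"] by auto
  then obtain f where f: "range f \<subseteq> F ` \<C>" "Sup (F ` \<C>) = (SUP n::nat. f n)" by auto
  then have "\<forall>n. \<exists>C\<in>\<C>. f n = F C" by auto
  then obtain C where C: "\<And>n. C n \<in> \<C>" "\<And>n. f n = F (C n)" by metis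
  \<comment> \<open>A countable union of countable index sets is admissible, so the supremum is
    attained at \<open>D\<close>.\<close>
  define D where "D = (\<Union>n. C n)"
  have D: "D \<in> \<C>" using C(1) by (auto simp: D_def \<C>_def)
  have meas: "(\<Union>j\<in>E. A j) \<in> sets m" if "E \<in> \<C>" for E
    using that A by (intro sets.countable_UN') (auto simp: \<C>_def)
  have max: "F E \<le> F D" if "E \<in> \<C>" for E
  proof -
    have "F E \<le> (SUP n. f n)" using that f(2) by (metis SUP_upper)
    also have "\<dots> \<le> F D"
      unfolding C(2) F_def using meas[OF D] sets_\<mu>
      by (intro SUP_least emeasure_mono) (auto simp: D_def)
    finally show ?thesis .
  qed
  show thesis
  proof (rule that[of D])
    show "countable D" "D \<subseteq> I" using D by (auto simp: \<C>_def)
  next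
    fix i assume i: "i \<in> I"
    show "A i - (\<Union>j\<in>D. A j) \<in> null_sets m"
    proof (rule null)
      let ?U = "\<Union>j\<in>D. A j"
      have "insert i D \<in> \<C>" using D i by (auto simp: \<C>_def)
      then have "emeasure \<mu> (A i \<union> ?U) \<le> emeasure \<mu> ?U" using max[of "insert i D"] by (simp add: F_def)
      moreover have "emeasure \<mu> (A i \<union> ?U) = emeasure \<mu> ?U + emeasure \<mu> (A i - ?U)"
        using meas[OF D] A[OF i] sets_\<mu> by (subst plus_emeasure) (auto intro!: arg_cong[where f = "emeasure \<mu>"])
      ultimately have "emeasure \<mu> (A i - ?U) = 0"
        using \<mu>.emeasure_finite[of ?U] by (cases "emeasure \<mu> ?U"; cases "emeasure \<mu> (A i - ?U)")
          (auto simp flip: ennreal_plus)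
      then show "A i - ?U \<in> null_sets \<mu>" using meas[OF D] A[OF i] sets_\<mu> by auto
    qed
  qed
qed

text \<open>The pointwise supremum of an uncountable family need not be measurable, so one countable
  subfamily has to serve all. It is collected level by level: \<open>g x < f x\<close> is witnessed
  by some \<open>q\<close> in a countable dense set, and for each \<open>q\<close> countably many
  superlevel sets absorb the others up to null sets.\<close>

lemma is_ess_Sup_ess_Sup:
  fixes F :: "('a \<Rightarrow> ennreal) set"
  assumes "sigma_finite_measure m" and F: "F \<subseteq> borel_measurable m"
  shows "is_ess_Sup m F (ess_Sup m F)"
proof -
  obtain Q :: "ennreal set" where Q: "countable Q" "\<And>x y. x < y \<Longrightarrow> \<exists>d\<in>Q. x < d \<and> d < y"
    by (rule exE[OF countable_separating_set_dense_linorder[where ?'a = ennreal]]) iprover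
  have "\<exists>C. countable C \<and> C \<subseteq> F \<and>
      (\<forall>f\<in>F. {x \<in> space m. q < f x} - (\<Union>g\<in>C. {x \<in> space m. q < g x}) \<in> null_sets m)" for q
  proof -
    have "{x \<in> space m. q < f x} \<in> sets m" if "f \<in> F" for f
      using that F by (intro borel_measurable_less) auto
    then obtain C where "countable C" "C \<subseteq> F"
      "\<And>f. f \<in> F \<Longrightarrow> {x \<in> space m. q < f x} - (\<Union>g\<in>C. {x \<in> space m. q < g x}) \<in> null_sets m"
      using essential_union[OF assms(1), of F "\<lambda>f. {x \<in> space m. q < f x}"] by blast
    then show ?thesis by blast
  qed
  then have "\<exists>C. \<forall>q. countable (C q) \<and> C q \<subseteq> F \<and>
      (\<forall>f\<in>F. {x \<in> space m. q < f x} - (\<Union>g\<in>C q. {x \<in> space m. q < g x}) \<in> null_sets m)"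
    by (intro choice allI)
  then obtain C where C': "\<forall>q. countable (C q) \<and> C q \<subseteq> F \<and>
      (\<forall>f\<in>F. {x \<in> space m. q < f x} - (\<Union>g\<in>C q. {x \<in> space m. q < g x}) \<in> null_sets m)" ..
  have Ca: "countable (C q)" and Cb: "C q \<subseteq> F" for q
    using conjunct1[OF C'[rule_format, of q]] conjunct1[OF conjunct2[OF C'[rule_format, of q]]]
    by this
  have C3: "{x \<in> space m. q < f x} - (\<Union>g\<in>C q. {x \<in> space m. q < g x}) \<in> null_sets m"
    if "f \<in> F" for q f
    using C'[rule_format, of q] that by (elim conjE) (erule bspec)
  define G where "G = (\<Union>q\<in>Q. C q)"
  have G: "countable G" "G \<subseteq> F" using Ca Cb Q by (auto simp: G_def)
  define g where "g x = (SUP f\<in>G. f x)" for x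
  have "g \<in> borel_measurable m"
    unfolding g_def using G F by (intro borel_measurable_SUP) auto
  moreover have "AE x in m. f x \<le> g x" if "f \<in> F" for f
  proof -
    have "AE x in m. \<forall>q\<in>Q. x \<notin> {x \<in> space m. q < f x} - (\<Union>g\<in>C q. {x \<in> space m. q < g x})"
      using AE_not_in[OF C3[OF that]] Q(1) by (subst AE_ball_countable) auto
    with AE_space[of m] show ?thesis
    proof eventually_elim
      case (elim x)
      show ?case
      proof (rule ccontr)
        assume "\<not> f x \<le> g x"
        then obtain q where q: "q \<in> Q" "g x < q" "q < f x" using Q(2)[of "g x" "f x"] not_le by blast
        then obtain g' where "g' \<in> C q" "q < g' x" using elim by auto
        moreover have "g' x \<le> g x"
          unfolding g_def using q \<open>g' \<in> C q\<close> by (intro SUP_upper) (auto simp: G_def)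
        ultimately show False using q by auto
      qed
    qed
  qed
  moreover have "AE x in m. g x \<le> h x" if "\<forall>f\<in>F. AE x in m. f x \<le> h x" for h
  proof -
    have "AE x in m. \<forall>f\<in>G. f x \<le> h x" using that G by (subst AE_ball_countable) auto
    then show ?thesis by eventually_elim (auto simp: g_def intro: SUP_least)
  qed
  ultimately have "is_ess_Sup m F g" by (simp add: is_ess_Sup_def)
  then show ?thesis unfolding ess_Sup_def by (rule someI[of "is_ess_Sup m F"])
qed

lemma is_ess_Sup_AE_unique:
  assumes "is_ess_Sup m F g" "is_ess_Sup m F h"
  shows "AE x in m. g x = h x"
proof -
  have "AE x in m. g x \<le> h x" "AE x in m. h x \<le> g x" using assms by (auto simp: is_ess_Sup_def)
  then show ?thesis by eventually_elim (rule antisym)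
qed

section \<open>Pointwise norms\<close>

text \<open>This rule would rewrite \<open>Lp_space m \<infinity>\<close> to \<open>Lp_space m top\<close>, which no other rule matches.\<close>
declare infinity_ennreal_def [simp del]

section \<open>Null sets and Lebesgue norms on a metric measure space\<close>

context metric_measure_space
begin

lemma sets_m [measurable_cong, simp]: "sets m = sets borel"
  by (rule sets_eq_borel)

lemma space_m [simp]: "space m = UNIV"
  using sets_eq_imp_space_eq[OF sets_eq_borel] by simp

lemma emeasure_bounded_finite:
  assumes "bounded B" shows "emeasure m B < \<infinity>"
proof -
  obtain r where "B \<subseteq> ball undefined r"
    using bounded_subset_ballD[OF assms] by blast
  then have "emeasure m B \<le> emeasure m (ball undefined r)" by (intro emeasure_mono) auto
  then show ?thesis using emeasure_ball_finite by (rule le_less_trans)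
qed

lemma UN_balls: "(\<Union>n::nat. ball x (real n)) = UNIV"
proof -
  have "\<exists>n::nat. dist x y < real n" for y using reals_Archimedean2 by blast
  then show ?thesis by auto
qed

lemma sigma_finite: "sigma_finite_measure m"
proof
  show "\<exists>A. countable A \<and> A \<subseteq> sets m \<and> \<Union> A = space m \<and> (\<forall>a\<in>A. emeasure m a \<noteq> \<infinity>)"
    using less_imp_neq[OF emeasure_ball_finite[of undefined]] UN_balls[of undefined]
    by (intro exI[of _ "range (\<lambda>n::nat. ball undefined (real n))"]) auto
qed

text \<open>Full support makes \<open>m\<close> nonzero, so what holds a.e. holds at some point.
  Pointwise estimates thus yield facts that mention no point, such as
  \<open>0 \<le> c\<close>.\<close>

lemma AE_imp_pos:
  assumes "\<And>x. P x \<Longrightarrow> Q" "AE x in m. P x" shows Q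
proof (rule ccontr)
  assume "\<not> Q"
  have "AE x in m. x \<notin> UNIV" using assms(2) by eventually_elim (use assms(1) \<open>\<not> Q\<close> in auto)
  then have "emeasure m UNIV = 0" by (subst (asm) AE_iff_null_sets[symmetric]) auto
  then show False using full_support[of UNIV] by auto
qed

text \<open>Balls have finite measure, so to show that a Borel set is null only its subsets of
  positive finite measure need to be excluded; their indicators have positive finite norm.\<close>

lemma AE_notin_balls:
  fixes S :: "'a set"
  assumes S: "S \<in> sets borel"
    and *: "\<And>E. E \<in> sets borel \<Longrightarrow> E \<subseteq> S \<Longrightarrow> 0 < emeasure m E \<Longrightarrow> emeasure m E < \<infinity> \<Longrightarrow> False"
  shows "AE x in m. x \<notin> S"
proof -
  have "AE x in m. x \<notin> S \<inter> ball undefined (real n)" for n :: nat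
  proof (rule AE_not_in)
    have "emeasure m (S \<inter> ball undefined (real n)) < \<infinity>"
      by (intro emeasure_bounded_finite bounded_Int) auto
    then have "emeasure m (S \<inter> ball undefined (real n)) = 0"
      using *[of "S \<inter> ball undefined (real n)"] S by (auto simp: zero_less_iff_neq_zero)
    then show "S \<inter> ball undefined (real n) \<in> null_sets m" using S by auto
  qed
  then have "AE x in m. \<forall>n::nat. x \<notin> S \<inter> ball undefined (real n)" by (subst AE_all_countable) (rule allI)
  then show ?thesis
  proof eventually_elim
    case (elim x)
    moreover have "x \<in> (\<Union>n::nat. ball undefined (real n))" by (simp only: UN_balls UNIV_I)
    ultimately show ?case by blast
  qed
qed

lemma Linf_iff: "f \<in> Lp_space m \<infinity> \<longleftrightarrow> f \<in> borel_measurable m \<and> (\<exists>c. AE x in m. \<bar>f x\<bar> \<le> c)"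
proof
  assume "f \<in> Lp_space m \<infinity>"
  then have f: "f \<in> borel_measurable m" and e: "esssup m (\<lambda>x. ereal \<bar>f x\<bar>) < \<infinity>"
    by (auto simp: Lp_space_def)
  have "AE x in m. \<bar>f x\<bar> \<le> real_of_ereal (esssup m (\<lambda>x. ereal \<bar>f x\<bar>))"
    using esssup_AE[where M = m and f = "\<lambda>x. ereal \<bar>f x\<bar>"]
    by eventually_elim (use e in \<open>cases "esssup m (\<lambda>x. ereal \<bar>f x\<bar>)"; auto\<close>)
  with f show "f \<in> borel_measurable m \<and> (\<exists>c. AE x in m. \<bar>f x\<bar> \<le> c)" by auto
next
  assume "f \<in> borel_measurable m \<and> (\<exists>c. AE x in m. \<bar>f x\<bar> \<le> c)"
  then obtain c where f [measurable]: "f \<in> borel_measurable m" and c: "AE x in m. \<bar>f x\<bar> \<le> c" by auto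
  have "esssup m (\<lambda>x. ereal \<bar>f x\<bar>) \<le> ereal c"
    using c by (intro esssup_I) auto
  then show "f \<in> Lp_space m \<infinity>" using f by (auto simp: Lp_space_def)
qed

lemma Linf_norm_AE:
  assumes "f \<in> Lp_space m \<infinity>" shows "AE x in m. \<bar>f x\<bar> \<le> Lp_norm m \<infinity> f"
proof -
  have e: "esssup m (\<lambda>x. ereal \<bar>f x\<bar>) < \<infinity>" using assms by (auto simp: Lp_space_def)
  show ?thesis
    using esssup_AE[where M = m and f = "\<lambda>x. ereal \<bar>f x\<bar>"]
    by eventually_elim (use e in \<open>cases "esssup m (\<lambda>x. ereal \<bar>f x\<bar>)"; auto simp: Lp_norm_def\<close>)
qed

lemma Linf_norm_nonneg:
  assumes "f \<in> Lp_space m \<infinity>" shows "0 \<le> Lp_norm m \<infinity> f"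
  by (rule AE_imp_pos[OF order_trans[OF abs_ge_zero] Linf_norm_AE[OF assms]])

lemma Linf_norm_le:
  assumes f: "f \<in> borel_measurable m" and c: "AE x in m. \<bar>f x\<bar> \<le> c"
  shows "Lp_norm m \<infinity> f \<le> c"
proof -
  have L: "f \<in> Lp_space m \<infinity>" using assms Linf_iff by auto
  have "esssup m (\<lambda>x. ereal \<bar>f x\<bar>) \<le> ereal c" using f c by (intro esssup_I) auto
  moreover have "0 \<le> c" by (rule AE_imp_pos[OF order_trans[OF abs_ge_zero] c])
  ultimately show ?thesis
    by (cases "esssup m (\<lambda>x. ereal \<bar>f x\<bar>)") (auto simp: Lp_norm_def)
qed

lemma Lp_norm_mono:
  assumes p: "1 \<le> p" and f: "f \<in> Lp_space m p" and g: "g \<in> Lp_space m p"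
    and le: "AE x in m. \<bar>f x\<bar> \<le> \<bar>g x\<bar>"
  shows "Lp_norm m p f \<le> Lp_norm m p g"
proof (cases "p = \<infinity>")
  case True
  have "AE x in m. \<bar>f x\<bar> \<le> Lp_norm m \<infinity> g"
    using Linf_norm_AE[OF g[unfolded True]] le by eventually_elim auto
  then show ?thesis using Linf_norm_le[of f] f True by (auto simp: Lp_space_def)
next
  case False
  have "(\<integral>x. \<bar>f x\<bar> powr enn2real p \<partial>m) \<le> (\<integral>x. \<bar>g x\<bar> powr enn2real p \<partial>m)"
  proof (rule integral_mono_AE)
    show "AE x in m. \<bar>f x\<bar> powr enn2real p \<le> \<bar>g x\<bar> powr enn2real p"
      using le by eventually_elim (auto intro: powr_mono2)
  qed (use f g False in \<open>auto simp: Lp_space_def\<close>)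
  then show ?thesis using False
    by (auto simp: Lp_norm_def intro!: powr_mono2 integral_nonneg_AE)
qed

text \<open>The factor \<kappa> is 1 for \<open>p = \<infinity>\<close> and m(E)^(1/p) otherwise.
  Only its positivity is kept, which frees the comparison of norms over \<open>E\<close> from a case
  distinction on \<open>p\<close>.\<close>

lemma Lp_norm_indicator:
  assumes p: "1 \<le> p" and E: "E \<in> sets borel" "0 < emeasure m E" "emeasure m E < \<infinity>"
  obtains \<kappa> where "\<kappa> > 0"
    "\<And>c. 0 \<le> c \<Longrightarrow> (\<lambda>x. c * indicat_real E x) \<in> Lp_space m p \<and> Lp_norm m p (\<lambda>x. c * indicat_real E x) = c * \<kappa>"
proof (cases "p = \<infinity>")
  case True
  show ?thesis
  proof (rule that[of 1])
    fix c :: real assume c: "0 \<le> c"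
    have meas: "(\<lambda>x. c * indicat_real E x) \<in> borel_measurable m" using E by measurable
    have le: "AE x in m. \<bar>c * indicat_real E x\<bar> \<le> c" using c by (auto simp: indicator_def)
    have L: "(\<lambda>x. c * indicat_real E x) \<in> Lp_space m \<infinity>" using meas le Linf_iff by blast
    \<comment> \<open>\<open>E\<close> is not null, so no bound below \<open>c\<close> can hold a.e.
      on it.\<close>
    have "\<not> (AE x in m. x \<notin> E)" using E by (subst AE_iff_null_sets[symmetric]) auto
    moreover have "AE x in m. x \<notin> E" if "Lp_norm m \<infinity> (\<lambda>x. c * indicat_real E x) < c"
      using Linf_norm_AE[OF L] that by (auto simp: indicator_def elim!: eventually_mono)
    ultimately show "(\<lambda>x. c * indicat_real E x) \<in> Lp_space m p \<and> Lp_norm m p (\<lambda>x. c * indicat_real E x) = c * 1"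
      using L Linf_norm_le[OF meas le] True by force
  qed simp
next
  case False
  define r where "r = enn2real p"
  have r: "1 \<le> r" using p False unfolding r_def
    by (cases p) (auto simp: enn2real_ennreal infinity_ennreal_def)
  have mE: "0 < measure m E" using E by (auto simp: measure_def enn2real_positive_iff infinity_ennreal_def)
  show ?thesis
  proof (rule that[of "measure m E powr (1 / r)"])
    show "0 < measure m E powr (1 / r)" using mE by simp
    fix c :: real assume c: "0 \<le> c"
    have eq: "\<bar>c * indicat_real E x\<bar> powr r = c powr r * indicat_real E x" for x
      using c r by (auto simp: indicator_def)
    have int: "integrable m (\<lambda>x. c powr r * indicat_real E x)"
      using E by (intro integrable_mult_right integrable_real_indicator) auto
    have "(c powr r * measure m E) powr (1 / r) = c * measure m E powr (1 / r)"
      using c r mE by (simp add: powr_mult powr_powr)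
    then show "(\<lambda>x. c * indicat_real E x) \<in> Lp_space m p \<and>
        Lp_norm m p (\<lambda>x. c * indicat_real E x) = c * measure m E powr (1 / r)"
      using False int E by (simp add: Lp_space_def Lp_norm_def r_def[symmetric] eq)
  qed
qed

end

section \<open>Module arithmetic and pointwise estimates\<close>

context Lp_normed_module
begin

lemma pn_meas [measurable]: "pn v \<in> borel_measurable m"
  using pn_Lp by (auto simp: Lp_space_def)

lemma indicator_Linf [simp, intro]: "E \<in> sets borel \<Longrightarrow> indicat_real E \<in> Lp_space m \<infinity>"
  unfolding Linf_iff by (auto intro!: exI[of _ 1] simp: indicator_def)

lemma const_Linf [simp, intro]: "(\<lambda>x. c) \<in> Lp_space m \<infinity>"
  unfolding Linf_iff by auto

lemma Linf_meas: "f \<in> Lp_space m \<infinity> \<Longrightarrow> f \<in> borel_measurable m"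
  by (simp add: Lp_space_def)

lemma Linf_add [simp, intro]:
  assumes "f \<in> Lp_space m \<infinity>" "g \<in> Lp_space m \<infinity>" shows "(\<lambda>x. f x + g x) \<in> Lp_space m \<infinity>"
proof -
  obtain a b where ab: "AE x in m. \<bar>f x\<bar> \<le> a" "AE x in m. \<bar>g x\<bar> \<le> b"
    and [measurable]: "f \<in> borel_measurable m" "g \<in> borel_measurable m"
    using assms unfolding Linf_iff by auto
  have "AE x in m. \<bar>f x + g x\<bar> \<le> a + b" using ab by eventually_elim auto
  then show ?thesis unfolding Linf_iff by auto
qed

lemma Linf_mult [simp, intro]:
  assumes "f \<in> Lp_space m \<infinity>" "g \<in> Lp_space m \<infinity>" shows "(\<lambda>x. f x * g x) \<in> Lp_space m \<infinity>"
proof -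
  obtain a b where ab: "AE x in m. \<bar>f x\<bar> \<le> a" "AE x in m. \<bar>g x\<bar> \<le> b"
    and [measurable]: "f \<in> borel_measurable m" "g \<in> borel_measurable m"
    using assms unfolding Linf_iff by auto
  have "AE x in m. \<bar>f x * g x\<bar> \<le> \<bar>a\<bar> * \<bar>b\<bar>"
    using ab by eventually_elim (auto simp: abs_mult intro!: mult_mono)
  then show ?thesis unfolding Linf_iff by auto
qed

lemma Linf_diff [simp, intro]:
  assumes "f \<in> Lp_space m \<infinity>" "g \<in> Lp_space m \<infinity>" shows "(\<lambda>x. f x - g x) \<in> Lp_space m \<infinity>"
  using Linf_add[OF assms(1) Linf_mult[OF const_Linf assms(2), of "-1"]] by simp

lemma act_one [simp]: "act (\<lambda>x. 1) v = v"
  by (simp add: act_const)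

lemma act_diff_left:
  assumes "f \<in> Lp_space m \<infinity>" "g \<in> Lp_space m \<infinity>"
  shows "act (\<lambda>x. f x - g x) v = act f v - act g v"
  using act_add_left[OF Linf_diff[OF assms] assms(2), of v] by simp

lemma act_zero_right: "f \<in> Lp_space m \<infinity> \<Longrightarrow> act f 0 = 0"
  using act_add_right[of f 0 0] by simp

lemma act_minus_right: "f \<in> Lp_space m \<infinity> \<Longrightarrow> act f (- v) = - act f v"
  using act_add_right[of f v "- v"] by (simp add: act_zero_right eq_neg_iff_add_eq_0 add.commute)

lemma act_diff_right: "f \<in> Lp_space m \<infinity> \<Longrightarrow> act f (v - w) = act f v - act f w"
  using act_add_right[of f v "- w"] by (simp add: act_minus_right)

lemma pn_scale: "AE x in m. pn (c *\<^sub>R v) x = \<bar>c\<bar> * pn v x"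
  using pn_act[of "\<lambda>x. c" v] by (simp add: act_const)

lemma pn_minus: "AE x in m. pn (- v) x = pn v x"
  using pn_scale[of "-1" v] by simp

lemma pn_minus_commute: "AE x in m. pn (v - w) x = pn (w - v) x"
  using pn_minus[of "v - w"] by eventually_elim auto

lemma pn_zero: "AE x in m. pn 0 x = 0"
  using pn_scale[of 0 0] by simp

lemma norm_mono:
  assumes "AE x in m. pn u x \<le> pn v x" shows "norm u \<le> norm v"
  unfolding norm_eq
proof (intro Lp_norm_mono p_ge_1 pn_Lp)
  show "AE x in m. \<bar>pn u x\<bar> \<le> \<bar>pn v x\<bar>"
    using assms pn_nonneg[of u] by eventually_elim auto
qed

lemma pn_eq_0_imp:
  assumes "AE x in m. pn u x = 0" shows "u = 0"
proof -
  have "AE x in m. pn u x \<le> pn 0 x" using assms pn_zero by eventually_elim simp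
  from norm_mono[OF this] show ?thesis by simp
qed

text \<open>Bridge from the norm to the pointwise norm: constant bounds over \<open>E\<close> become
  norm bounds with one common factor, which cancels when two of them are compared.\<close>

lemma norm_compare:
  assumes E: "E \<in> sets borel" "0 < emeasure m E" "emeasure m E < \<infinity>"
  obtains \<kappa> where "\<kappa> > 0"
    "\<And>c u. 0 \<le> c \<Longrightarrow> (AE x in m. pn u x \<le> c * indicat_real E x) \<Longrightarrow> norm u \<le> c * \<kappa>"
    "\<And>c u. 0 \<le> c \<Longrightarrow> (AE x in m. c * indicat_real E x \<le> pn u x) \<Longrightarrow> c * \<kappa> \<le> norm u"
proof -
  obtain \<kappa> where k: "\<kappa> > 0"
    "\<And>c. 0 \<le> c \<Longrightarrow> (\<lambda>x. c * indicat_real E x) \<in> Lp_space m p \<and> Lp_norm m p (\<lambda>x. c * indicat_real E x) = c * \<kappa>"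
    using Lp_norm_indicator[OF p_ge_1 E] by metis
  show thesis
  proof (rule that[OF k(1)])
    fix c :: real and u assume c: "0 \<le> c"
    assume "AE x in m. pn u x \<le> c * indicat_real E x"
    then have "AE x in m. \<bar>pn u x\<bar> \<le> \<bar>c * indicat_real E x\<bar>"
      using pn_nonneg[of u] by eventually_elim (use c in auto)
    then show "norm u \<le> c * \<kappa>"
      unfolding norm_eq using Lp_norm_mono[OF p_ge_1 pn_Lp[of u], of "\<lambda>x. c * indicat_real E x"] k(2)[OF c] by simp
  next
    fix c :: real and u assume c: "0 \<le> c"
    assume "AE x in m. c * indicat_real E x \<le> pn u x"
    then have "AE x in m. \<bar>c * indicat_real E x\<bar> \<le> \<bar>pn u x\<bar>" by eventually_elim (use c in auto)
    then show "c * \<kappa> \<le> norm u"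
      unfolding norm_eq using Lp_norm_mono[OF p_ge_1 _ pn_Lp[of u], of "\<lambda>x. c * indicat_real E x"] k(2)[OF c] by simp
  qed
qed

text \<open>The triangle inequality for the pointwise norm is not an axiom: it follows from the one for
  the norm, applied on sets where the three pointwise norms are nearly constant.\<close>

lemma pn_add_le: "AE x in m. pn (v + w) x \<le> pn v x + pn w x"
proof -
  define S where "S a b c = {x. pn v x \<le> a \<and> pn w x \<le> b \<and> c \<le> pn (v + w) x}" for a b c
  have null: "AE x in m. x \<notin> S a b c" if abc: "0 \<le> a" "0 \<le> b" "a + b < c" for a b c
  proof (rule AE_notin_balls)
    have "{x \<in> space m. pn v x \<le> a \<and> pn w x \<le> b \<and> c \<le> pn (v + w) x} \<in> sets m" by measurable
    then show "S a b c \<in> sets borel" by (simp add: S_def)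
    fix E assume E: "E \<in> sets borel" "E \<subseteq> S a b c" "0 < emeasure m E" "emeasure m E < \<infinity>"
    obtain \<kappa> where k: "\<kappa> > 0"
      "\<And>c u. 0 \<le> c \<Longrightarrow> (AE x in m. pn u x \<le> c * indicat_real E x) \<Longrightarrow> norm u \<le> c * \<kappa>"
      "\<And>c u. 0 \<le> c \<Longrightarrow> (AE x in m. c * indicat_real E x \<le> pn u x) \<Longrightarrow> c * \<kappa> \<le> norm u"
      by (rule norm_compare[OF E(1,3,4)]) blast
    let ?e = "indicat_real E"
    have "c * \<kappa> \<le> norm (act ?e (v + w))"
      using pn_act[OF indicator_Linf[OF E(1)], of "v + w"] E(2) abc
      by (intro k(3)) (auto simp: S_def indicator_def elim!: eventually_mono)
    also have "\<dots> \<le> norm (act ?e v) + norm (act ?e w)"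
      using E(1) by (simp add: act_add_right norm_triangle_ineq)
    also have "\<dots> \<le> a * \<kappa> + b * \<kappa>"
    proof (intro add_mono k(2) abc)
      show "AE x in m. pn (act ?e v) x \<le> a * ?e x"
        using pn_act[OF indicator_Linf[OF E(1)], of v]
        by eventually_elim (use E(2) in \<open>auto simp: S_def indicator_def\<close>)
      show "AE x in m. pn (act ?e w) x \<le> b * ?e x"
        using pn_act[OF indicator_Linf[OF E(1)], of w]
        by eventually_elim (use E(2) in \<open>auto simp: S_def indicator_def\<close>)
    qed
    also have "\<dots> < c * \<kappa>" using k(1) abc by (simp flip: distrib_right)
    finally show False by simp
  qed
  \<comment> \<open>Up to a null set, every point violating the inequality lies in one of countably
    many sets \<open>S a b c\<close> with rational parameters.\<close>
  have "AE x in m. \<forall>(a,b,c)\<in>{(a,b,c). a \<in> \<rat> \<and> b \<in> \<rat> \<and> c \<in> \<rat> \<and> 0 \<le> a \<and> 0 \<le> b \<and> a + b < c}. x \<notin> S a b c"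
  proof (subst AE_ball_countable)
    have "countable ((\<rat> :: real set) \<times> (\<rat> :: real set) \<times> (\<rat> :: real set))" by (intro countable_SIGMA countable_rat)
    then show "countable {(a,b,c). a \<in> (\<rat>::real set) \<and> b \<in> \<rat> \<and> c \<in> \<rat> \<and> 0 \<le> a \<and> 0 \<le> b \<and> a + b < c}"
      by (rule countable_subset[rotated]) auto
  qed (use null in auto)
  then show ?thesis using pn_nonneg[of v] pn_nonneg[of w]
  proof eventually_elim
    case (elim x)
    show ?case
    proof (rule ccontr)
      assume "\<not> ?thesis"
      then have d: "0 < (pn (v + w) x - (pn v x + pn w x)) / 3" (is "0 < ?d") by simp
      obtain a where a: "a \<in> \<rat>" "pn v x < a" "a < pn v x + ?d" using Rats_dense_in_real[of "pn v x" "pn v x + ?d"] d by auto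
      obtain b where b: "b \<in> \<rat>" "pn w x < b" "b < pn w x + ?d" using Rats_dense_in_real[of "pn w x" "pn w x + ?d"] d by auto
      have "a + b < pn (v + w) x" using a b d by (simp add: field_simps)
      then obtain c where c: "c \<in> \<rat>" "a + b < c" "c < pn (v + w) x" using Rats_dense_in_real by blast
      have "x \<notin> S a b c" using elim(1) a b c elim(2,3) by force
      then show False using a b c by (auto simp: S_def)
    qed
  qed
qed

lemma pn_triangle: "AE x in m. pn (u - w) x \<le> pn (u - v) x + pn (v - w) x"
  using pn_add_le[of "u - v" "v - w"] by simp

lemma pn_sum_le: "finite I \<Longrightarrow> AE x in m. pn (\<Sum>i\<in>I. v i) x \<le> (\<Sum>i\<in>I. pn (v i) x)"
proof (induction I rule: finite_induct)
  case empty
  then show ?case using pn_zero by eventually_elim auto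
next
  case (insert i I)
  show ?case using insert(3) pn_add_le[of "v i" "sum v I"]
    by eventually_elim (use insert(1,2) in auto)
qed

text \<open>On a set of positive finite measure where all \<open>u n\<close> stay at pointwise
  distance \<epsilon> from \<open>v\<close>, the norms \<open>norm (v - u n)\<close> would be
  bounded below. This gives approximation at almost every point without extracting a
  subsequence.\<close>

lemma tendsto_imp_pn_approx:
  assumes "u \<longlonglongrightarrow> v"
  shows "AE x in m. \<forall>\<epsilon>>0. \<exists>n::nat. pn (v - u n) x < \<epsilon>"
proof -
  define S where "S \<epsilon> = {x. \<forall>n. \<epsilon> \<le> pn (v - u n) x}" for \<epsilon>
  have null: "AE x in m. x \<notin> S \<epsilon>" if e: "0 < \<epsilon>" for \<epsilon>
  proof (rule AE_notin_balls)
    have "{x \<in> space m. \<forall>n. \<epsilon> \<le> pn (v - u n) x} \<in> sets m" by measurable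
    then show "S \<epsilon> \<in> sets borel" by (simp add: S_def)
    fix E assume E: "E \<in> sets borel" "E \<subseteq> S \<epsilon>" "0 < emeasure m E" "emeasure m E < \<infinity>"
    obtain \<kappa> where k: "\<kappa> > 0"
      "\<And>c u. 0 \<le> c \<Longrightarrow> (AE x in m. pn u x \<le> c * indicat_real E x) \<Longrightarrow> norm u \<le> c * \<kappa>"
      "\<And>c u. 0 \<le> c \<Longrightarrow> (AE x in m. c * indicat_real E x \<le> pn u x) \<Longrightarrow> c * \<kappa> \<le> norm u"
      by (rule norm_compare[OF E(1,3,4)]) blast
    have "\<epsilon> * \<kappa> \<le> norm (v - u n)" for n
      using pn_nonneg[of "v - u n"] E(2) e by (intro k(3)) (auto simp: S_def indicator_def)
    moreover have "(\<lambda>n. norm (v - u n)) \<longlonglongrightarrow> 0"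
      using assms by (auto intro!: tendsto_eq_intros)
    ultimately have "\<epsilon> * \<kappa> \<le> 0" by (intro LIMSEQ_le_const[of "\<lambda>n. norm (v - u n)"]) auto
    then show False using e k(1) by (simp add: mult_le_0_iff)
  qed
  have "AE x in m. \<forall>j::nat. x \<notin> S (1 / Suc j)"
    using null by (subst AE_all_countable) auto
  then show ?thesis
  proof eventually_elim
    case (elim x)
    show ?case
    proof (intro allI impI)
      fix \<epsilon> :: real assume "0 < \<epsilon>"
      then obtain j where "1 / Suc j < \<epsilon>" using nat_approx_posE by blast
      moreover obtain n where "pn (v - u n) x < 1 / Suc j" using elim by (auto simp: S_def not_le)
      ultimately show "\<exists>n. pn (v - u n) x < \<epsilon>" by (intro exI[of _ n]) auto
    qed
  qed
qed

end

section \<open>Dual norms and bounded elements\<close>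

lemma dual_space_boundE:
  assumes "\<phi> \<in> dual_space U nrm"
  obtains C where "\<And>v. v \<in> U \<Longrightarrow> \<bar>\<phi> v\<bar> \<le> C * nrm v"
proof -
  have "\<exists>C. \<forall>v\<in>U. \<bar>\<phi> v\<bar> \<le> C * nrm v" using assms by (simp add: dual_space_def)
  then show thesis using that by blast
qed

text \<open>\<open>dual_norm\<close> is a supremum of reals and informative only over bounded sets;
  estimates of values by it go back to this bound.\<close>

lemma dual_norm_bdd_above:
  assumes "\<phi> \<in> dual_space U nrm" and nn: "\<And>v. v \<in> U \<Longrightarrow> 0 \<le> nrm v"
  shows "bdd_above {\<bar>\<phi> v\<bar> |v. v \<in> U \<and> nrm v \<le> 1}"
proof -
  obtain C where C: "\<And>v. v \<in> U \<Longrightarrow> \<bar>\<phi> v\<bar> \<le> C * nrm v"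
    using dual_space_boundE[OF assms(1)] by blast
  have "\<bar>\<phi> v\<bar> \<le> \<bar>C\<bar>" if "v \<in> U" "nrm v \<le> 1" for v
  proof -
    have "C * nrm v \<le> \<bar>C\<bar> * 1" using nn[OF that(1)] that(2) by (intro mult_mono) auto
    then show ?thesis using C[OF that(1)] by simp
  qed
  then show ?thesis by (intro bdd_aboveI[of _ "\<bar>C\<bar>"]) auto
qed

lemma normed_space_onD:
  assumes "normed_space_on U nrm"
  shows "subspace U" "\<And>v. v \<in> U \<Longrightarrow> 0 \<le> nrm v" "\<And>v. v \<in> U \<Longrightarrow> nrm v = 0 \<longleftrightarrow> v = 0"
    "\<And>v c. v \<in> U \<Longrightarrow> nrm (c *\<^sub>R v) = \<bar>c\<bar> * nrm v" "nrm 0 = 0" "0 \<in> U"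
  using assms by (auto simp: normed_space_on_def subspace_0)

lemma dual_norm_bound:
  assumes \<phi>: "\<phi> \<in> dual_space U nrm" and U: "normed_space_on U nrm" and v: "v \<in> U"
  shows "\<bar>\<phi> v\<bar> \<le> dual_norm U nrm \<phi> * nrm v"
proof (cases "nrm v = 0")
  case True
  then show ?thesis using \<phi> v by (auto simp: dual_space_def)
next
  case False
  note D = normed_space_onD[OF U]
  have pos: "0 < nrm v" using False D(2)[OF v] by simp
  let ?w = "(1 / nrm v) *\<^sub>R v"
  have "?w \<in> U" "nrm ?w \<le> 1" using D(1,4) v pos by (auto simp: subspace_scale)
  then have "\<bar>\<phi> ?w\<bar> \<le> dual_norm U nrm \<phi>"
    unfolding dual_norm_def by (intro cSup_upper dual_norm_bdd_above[OF \<phi> D(2)]) auto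
  moreover have "\<phi> ?w = (1 / nrm v) * \<phi> v" using \<phi> v by (auto simp: dual_space_def)
  ultimately show ?thesis using pos by (simp add: abs_mult field_simps)
qed

lemma dual_norm_le:
  assumes "normed_space_on U nrm" and "\<And>v. v \<in> U \<Longrightarrow> nrm v \<le> 1 \<Longrightarrow> \<bar>\<phi> v\<bar> \<le> c"
  shows "dual_norm U nrm \<phi> \<le> c"
  unfolding dual_norm_def
proof (rule cSup_least)
  have "\<bar>\<phi> 0\<bar> \<in> {\<bar>\<phi> v\<bar> |v. v \<in> U \<and> nrm v \<le> 1}"
    using normed_space_onD(5,6)[OF assms(1)] by force
  then show "{\<bar>\<phi> v\<bar> |v. v \<in> U \<and> nrm v \<le> 1} \<noteq> {}" by blast
qed (use assms(2) in auto)

lemma dual_norm_nonneg: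
  assumes "\<phi> \<in> dual_space U nrm" "normed_space_on U nrm"
  shows "0 \<le> dual_norm U nrm \<phi>"
proof -
  have "\<bar>\<phi> 0\<bar> \<le> dual_norm U nrm \<phi>"
    unfolding dual_norm_def using normed_space_onD(5,6)[OF assms(2)]
    by (intro cSup_upper dual_norm_bdd_above[OF assms(1)] normed_space_onD(2)[OF assms(2)])
      (auto intro!: exI[of _ 0])
  then show ?thesis by linarith
qed

lemma dual_space_diff:
  assumes "\<phi> \<in> dual_space U nrm" "\<psi> \<in> dual_space U nrm"
  shows "(\<lambda>v. \<phi> v - \<psi> v) \<in> dual_space U nrm"
proof -
  obtain C D where "\<And>v. v \<in> U \<Longrightarrow> \<bar>\<phi> v\<bar> \<le> C * nrm v" "\<And>v. v \<in> U \<Longrightarrow> \<bar>\<psi> v\<bar> \<le> D * nrm v"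
    using dual_space_boundE[OF assms(1)] dual_space_boundE[OF assms(2)] by metis
  then have "\<bar>\<phi> v - \<psi> v\<bar> \<le> (C + D) * nrm v" if "v \<in> U" for v
    using that by (force simp: distrib_right)
  then have "\<exists>C. \<forall>v\<in>U. \<bar>\<phi> v - \<psi> v\<bar> \<le> C * nrm v" by blast
  then show ?thesis using assms by (simp add: dual_space_def algebra_simps)
qed

lemma dual_space_sum:
  assumes "\<And>i. i \<in> I \<Longrightarrow> \<phi> i \<in> dual_space U nrm" "\<And>v. v \<in> U \<Longrightarrow> 0 \<le> nrm v"
  shows "(\<lambda>v. \<Sum>i\<in>I. \<phi> i v) \<in> dual_space U nrm"
proof -
  have "\<exists>C. \<forall>i\<in>I. \<forall>v\<in>U. \<bar>\<phi> i v\<bar> \<le> C i * nrm v"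
    using assms(1) by (intro bchoice[unfolded Bex_def]) (auto simp: dual_space_def)
  then obtain C where C: "\<And>i v. i \<in> I \<Longrightarrow> v \<in> U \<Longrightarrow> \<bar>\<phi> i v\<bar> \<le> C i * nrm v" by blast
  have "\<bar>\<Sum>i\<in>I. \<phi> i v\<bar> \<le> (\<Sum>i\<in>I. C i) * nrm v" if "v \<in> U" for v
    unfolding sum_distrib_right using C that by (intro order_trans[OF sum_abs] sum_mono) auto
  then show ?thesis using assms(1)
    by (auto simp: dual_space_def sum.distrib sum_distrib_left intro!: sum.cong)
qed

lemma dual_norm_diff_le:
  assumes "\<phi> \<in> dual_space U nrm" "\<psi> \<in> dual_space U nrm" and U: "normed_space_on U nrm"
  shows "dual_norm U nrm (\<lambda>v. \<phi> v - \<psi> v) \<le> dual_norm U nrm \<phi> + dual_norm U nrm \<psi>"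
proof (rule dual_norm_le[OF U])
  fix v assume v: "v \<in> U" "nrm v \<le> 1"
  have "\<bar>\<phi> v\<bar> \<le> dual_norm U nrm \<phi> * 1" "\<bar>\<psi> v\<bar> \<le> dual_norm U nrm \<psi> * 1"
    using dual_norm_bound[OF assms(1) U v(1)] dual_norm_bound[OF assms(2) U v(1)]
      mult_left_mono[OF v(2) dual_norm_nonneg[OF assms(1) U]]
      mult_left_mono[OF v(2) dual_norm_nonneg[OF assms(2) U]] by auto
  then show "\<bar>\<phi> v - \<psi> v\<bar> \<le> dual_norm U nrm \<phi> + dual_norm U nrm \<psi>" by simp
qed

section \<open>The space of bounded elements and integrability of pointwise norms\<close>

context Lp_normed_module
begin

abbreviation "V \<equiv> bounded_part m pn"
abbreviation "nrm \<equiv> sup_pn m pn"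

lemma V_I: "(AE x in m. pn v x \<le> c) \<Longrightarrow> v \<in> V"
  using pn_nonneg[of v] unfolding bounded_part_def mem_Collect_eq Linf_iff
  by (auto intro!: exI[of _ c] elim: eventually_elim2)

lemma sup_pn_AE: "v \<in> V \<Longrightarrow> AE x in m. pn v x \<le> nrm v"
  using Linf_norm_AE[of "pn v"] by (auto simp: bounded_part_def sup_pn_def elim: eventually_mono)

lemma sup_pn_nonneg: "v \<in> V \<Longrightarrow> 0 \<le> nrm v"
  using Linf_norm_nonneg[of "pn v"] by (auto simp: bounded_part_def sup_pn_def)

lemma sup_pn_le:
  assumes "AE x in m. pn v x \<le> c" shows "nrm v \<le> c"
  unfolding sup_pn_def
proof (rule Linf_norm_le[OF pn_meas])
  show "AE x in m. \<bar>pn v x\<bar> \<le> c" using assms pn_nonneg[of v] by eventually_elim simp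
qed

lemma V_act:
  assumes f: "f \<in> Lp_space m \<infinity>" and v: "v \<in> V" shows "act f v \<in> V"
proof -
  obtain c where c: "AE x in m. \<bar>f x\<bar> \<le> c" using f Linf_iff by auto
  show ?thesis
  proof (rule V_I)
    show "AE x in m. pn (act f v) x \<le> c * nrm v"
      using pn_act[OF f, of v] c sup_pn_AE[OF v] pn_nonneg[of v]
      by eventually_elim (auto intro!: mult_mono)
  qed
qed

lemma sup_pn_act_le:
  assumes f: "f \<in> Lp_space m \<infinity>" and v: "v \<in> V" and c: "AE x in m. \<bar>f x\<bar> \<le> c"
  shows "nrm (act f v) \<le> c * nrm v"
proof (rule sup_pn_le)
  show "AE x in m. pn (act f v) x \<le> c * nrm v"
    using pn_act[OF f, of v] c sup_pn_AE[OF v] pn_nonneg[of v]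
    by eventually_elim (auto intro!: mult_mono)
qed

lemma V_add:
  assumes "v \<in> V" "w \<in> V" shows "v + w \<in> V" "nrm (v + w) \<le> nrm v + nrm w"
proof -
  have "AE x in m. pn (v + w) x \<le> nrm v + nrm w"
    using pn_add_le[of v w] sup_pn_AE[OF assms(1)] sup_pn_AE[OF assms(2)] by eventually_elim auto
  then show "v + w \<in> V" "nrm (v + w) \<le> nrm v + nrm w" by (auto intro: V_I sup_pn_le)
qed

lemma V_scale: "v \<in> V \<Longrightarrow> c *\<^sub>R v \<in> V"
  using V_act[OF const_Linf[of c]] by (simp add: act_const)

lemma V_0: "0 \<in> V" "nrm 0 = 0"
proof -
  have "AE x in m. pn 0 x \<le> 0" using pn_zero by eventually_elim simp
  then show "0 \<in> V" "nrm 0 = 0" using sup_pn_le[of 0 0] V_I[of 0 0] sup_pn_nonneg[of 0] by auto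
qed

lemma subspace_V: "subspace V"
  using V_0 V_add V_scale by (auto simp: subspace_def)

lemma sup_pn_eq_0:
  assumes "v \<in> V" "nrm v \<le> 0" shows "v = 0"
proof (rule pn_eq_0_imp)
  show "AE x in m. pn v x = 0"
    using sup_pn_AE[OF assms(1)] pn_nonneg[of v] by eventually_elim (use assms(2) in auto)
qed

lemma sup_pn_scale:
  assumes "v \<in> V" shows "nrm (c *\<^sub>R v) = \<bar>c\<bar> * nrm v"
proof (rule antisym)
  have le: "nrm (c *\<^sub>R v) \<le> \<bar>c\<bar> * nrm v" if "v \<in> V" for c v
    using sup_pn_act_le[OF const_Linf[of c] that, of "\<bar>c\<bar>"] by (simp add: act_const)
  show "nrm (c *\<^sub>R v) \<le> \<bar>c\<bar> * nrm v" by (rule le[OF assms])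
  show "\<bar>c\<bar> * nrm v \<le> nrm (c *\<^sub>R v)"
  proof (cases "c = 0")
    case False
    then have "nrm v \<le> \<bar>1 / c\<bar> * nrm (c *\<^sub>R v)"
      using le[OF V_scale[OF assms], of "1 / c" c] by simp
    then show ?thesis using False by (simp add: field_simps)
  qed (use V_0 in simp)
qed

lemma normed_space_V: "normed_space_on V nrm"
  unfolding normed_space_on_def
  using subspace_V sup_pn_nonneg sup_pn_eq_0 V_0 sup_pn_scale V_add by (auto intro: antisym)

text \<open>A substitute for Hoelder's inequality without the conjugate exponent: for finite
  \<open>p\<close>, with \<open>s = norm u > 0\<close> and \<open>r\<close> the real value of
  \<open>p\<close>, one has \<open>t \<le> s + s * (t / s) powr r\<close>. The first summand
  integrates over \<open>E\<close> to \<open>s * measure m E\<close>, the second over the whole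
  space to \<open>s\<close>.\<close>

lemma pn_integrable_finite:
  assumes E: "E \<in> sets borel" "emeasure m E < \<infinity>"
  shows "integrable m (\<lambda>x. indicator E x * pn u x)"
    and "(\<integral>x. indicator E x * pn u x \<partial>m) \<le> (measure m E + 1) * norm u"
proof -
  have intE: "integrable m (indicat_real E)"
    using E by (intro integrable_real_indicator) (auto simp: infinity_ennreal_def)
  have "integrable m (\<lambda>x. indicator E x * pn u x) \<and>
    (\<integral>x. indicator E x * pn u x \<partial>m) \<le> (measure m E + 1) * norm u"
  proof (cases "p = \<infinity>")
    case True
    have u: "pn u \<in> Lp_space m \<infinity>" using pn_Lp[of u] True by simp
    have le: "AE x in m. \<bar>indicator E x * pn u x\<bar> \<le> norm u * indicat_real E x"
      using Linf_norm_AE[OF u] True by (auto simp: norm_eq indicator_def elim: eventually_mono)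
    have i: "integrable m (\<lambda>x. indicator E x * pn u x)"
      by (rule Bochner_Integration.integrable_bound[OF integrable_mult_right[OF intE, of "norm u"]])
        (use le E in auto)
    have "(\<integral>x. indicator E x * pn u x \<partial>m) \<le> (\<integral>x. norm u * indicat_real E x \<partial>m)"
      using le by (intro integral_mono_AE i integrable_mult_right intE) (auto elim: eventually_mono)
    also have "\<dots> \<le> (measure m E + 1) * norm u" using E by (simp add: algebra_simps)
    finally show ?thesis using i by simp
  next
    case False
    define r where "r = enn2real p"
    have r: "1 \<le> r" using p_ge_1 False unfolding r_def
      by (cases p) (auto simp: enn2real_ennreal infinity_ennreal_def)
    have ip: "integrable m (\<lambda>x. \<bar>pn u x\<bar> powr r)"
      using pn_Lp[of u] False by (simp add: Lp_space_def r_def)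
    let ?I = "\<integral>x. \<bar>pn u x\<bar> powr r \<partial>m"
    have nu: "norm u = ?I powr (1 / r)" using False by (simp add: norm_eq Lp_norm_def r_def)
    show ?thesis
    proof (cases "u = 0")
      \<comment> \<open>Kept apart because the general case divides by
        \<open>s powr r\<close>.\<close>
      case True
      have eq: "AE x in m. indicator E x * pn u x = 0" using pn_zero True by (auto elim: eventually_mono)
      have "integrable m (\<lambda>x. indicator E x * pn u x) \<longleftrightarrow> integrable m (\<lambda>x. 0::real)"
        "(\<integral>x. indicator E x * pn u x \<partial>m) = (\<integral>x. 0 \<partial>m)"
        using E eq by (intro integrable_cong_AE integral_cong_AE; simp)+
      then show ?thesis using True by simp
    next
      case False
      define s where "s = norm u"
      have s: "0 < s" using False by (simp add: s_def)
      have "0 \<le> ?I" by (intro integral_nonneg_AE) auto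
      then have I: "?I = s powr r" using r unfolding s_def nu by (simp add: powr_powr)
      have young: "t \<le> s + s / s powr r * t powr r" if "0 \<le> t" for t
      proof (cases "t \<le> s")
        case True
        have "0 \<le> s / s powr r * t powr r" using s by simp
        with True show ?thesis by linarith
      next
        case False
        then have "(t / s) powr 1 \<le> (t / s) powr r" using s r by (intro powr_mono) auto
        then have "t \<le> s * (t / s) powr r" using s that by (simp add: field_simps)
        also have "(t / s) powr r = t powr r / s powr r" using s that by (simp add: powr_divide)
        finally show ?thesis using s by simp
      qed
      let ?g = "\<lambda>x. s * indicat_real E x + s / s powr r * \<bar>pn u x\<bar> powr r"
      have ig: "integrable m ?g" using intE ip by auto
      have le: "AE x in m. \<bar>indicator E x * pn u x\<bar> \<le> ?g x"
        using pn_nonneg[of u]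
      proof eventually_elim
        case (elim x)
        have "0 \<le> s / s powr r * \<bar>pn u x\<bar> powr r" using s by simp
        then show ?case using young[OF elim] elim s by (auto simp: indicator_def)
      qed
      have i: "integrable m (\<lambda>x. indicator E x * pn u x)"
        by (rule Bochner_Integration.integrable_bound[OF ig]) (use le E in \<open>auto elim: eventually_mono\<close>)
      have "(\<integral>x. indicator E x * pn u x \<partial>m) \<le> (\<integral>x. ?g x \<partial>m)"
        using le by (intro integral_mono_AE i ig) (auto elim: eventually_mono)
      also have "\<dots> = s * measure m E + s / s powr r * ?I" using intE ip E by simp
      also have "\<dots> = (measure m E + 1) * norm u" using I s by (simp add: s_def algebra_simps)
      finally show ?thesis using i by simp
    qed
  qed
  then show "integrable m (\<lambda>x. indicator E x * pn u x)"
    "(\<integral>x. indicator E x * pn u x \<partial>m) \<le> (measure m E + 1) * norm u" by auto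
qed

text \<open>For \<open>p = 1\<close> the pointwise norm is integrable over the whole space, which
  later places \<open>M\<close> in the dual itself. The factor \<open>1\<close> gives the bound the
  form it has on sets of finite measure.\<close>

lemma pn_integrable_L1:
  assumes E: "E \<in> sets borel" and p: "p = 1"
  shows "integrable m (\<lambda>x. indicator E x * pn u x)"
    and "(\<integral>x. indicator E x * pn u x \<partial>m) \<le> 1 * norm u"
proof -
  have ip: "integrable m (\<lambda>x. \<bar>pn u x\<bar>)"
    using pn_Lp[of u] p by (simp add: Lp_space_def infinity_ennreal_def powr_one)
  have nu: "norm u = (\<integral>x. \<bar>pn u x\<bar> \<partial>m)"
    using p by (simp add: norm_eq Lp_norm_def infinity_ennreal_def)
  show i: "integrable m (\<lambda>x. indicator E x * pn u x)"
    by (rule Bochner_Integration.integrable_bound[OF ip]) (use E in \<open>auto simp: indicator_def\<close>)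
  have "(\<integral>x. indicator E x * pn u x \<partial>m) \<le> (\<integral>x. \<bar>pn u x\<bar> \<partial>m)"
    by (intro integral_mono i ip) (auto simp: indicator_def)
  then show "(\<integral>x. indicator E x * pn u x \<partial>m) \<le> 1 * norm u" using nu by simp
qed

text \<open>The coefficients in \<open>L\<^sup>\<infinity>\<close> are approximated pointwise by rational constants, so that
  a generating subspace is pointwise dense.\<close>

lemma generates_imp_pn_dense:
  assumes gen: "generates m act W" and W: "subspace W"
  obtains C where "countable C" "C \<subseteq> W" "AE x in m. \<forall>\<epsilon>>0. \<exists>w\<in>C. pn (v - w) x < \<epsilon>"
proof -
  define G where "G = {v. \<exists>B :: nat \<Rightarrow> 'a set.
       (\<forall>k. B k \<in> sets borel) \<and> disjoint_family B \<and> (\<Union>k. B k) = UNIV \<and>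
       (\<forall>k. \<exists>(n::nat) f w. (\<forall>i<n. f i \<in> Lp_space m \<infinity> \<and> w i \<in> W) \<and>
          act (indicat_real (B k)) v = (\<Sum>i<n. act (f i) (w i)))}"
  have "v \<in> closure G" using gen by (simp add: generates_def G_def)
  then obtain u where u: "\<And>n::nat. u n \<in> G" "u \<longlonglongrightarrow> v" using closure_sequential by blast
  define Q where "Q n B \<longleftrightarrow> (\<forall>k. B k \<in> sets borel) \<and> (\<Union>k. B k) = UNIV \<and>
       (\<forall>k. \<exists>(n'::nat) f w. (\<forall>i<n'. f i \<in> Lp_space m \<infinity> \<and> w i \<in> W) \<and>
          act (indicat_real (B k)) (u n) = (\<Sum>i<n'. act (f i) (w i)))"
    for n and B :: "nat \<Rightarrow> 'a set"
  have "\<forall>n. \<exists>B. Q n B"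
  proof
    fix n
    obtain B :: "nat \<Rightarrow> 'a set" where "\<forall>k. B k \<in> sets borel" "(\<Union>k. B k) = UNIV"
       "\<forall>k. \<exists>(n'::nat) f w. (\<forall>i<n'. f i \<in> Lp_space m \<infinity> \<and> w i \<in> W) \<and>
          act (indicat_real (B k)) (u n) = (\<Sum>i<n'. act (f i) (w i))"
      using u(1)[of n] unfolding G_def mem_Collect_eq by iprover
    then show "\<exists>B. Q n B" unfolding Q_def by iprover
  qed
  then obtain B where QB: "\<And>n. Q n (B n)" by metis
  have B: "B n k \<in> sets borel" "(\<Union>k. B n k) = UNIV"
    and *: "\<exists>(n'::nat) f w. (\<forall>i<n'. f i \<in> Lp_space m \<infinity> \<and> w i \<in> W) \<and>
          act (indicat_real (B n k)) (u n) = (\<Sum>i<n'. act (f i) (w i))" for n k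
    using QB[of n, unfolded Q_def] by iprover+
  define P where "P n k t \<longleftrightarrow> (\<forall>i<fst t. fst (snd t) i \<in> Lp_space m \<infinity> \<and> snd (snd t) i \<in> W) \<and>
          act (indicat_real (B n k)) (u n) = (\<Sum>i<fst t. act (fst (snd t) i) (snd (snd t) i))"
    for n k and t :: "nat \<times> (nat \<Rightarrow> 'a \<Rightarrow> real) \<times> (nat \<Rightarrow> 'm)"
  have "\<exists>t. P n k t" for n k
    using *[of n k] unfolding P_def by (auto simp: split_paired_Ex)
  then obtain t where t: "\<And>n k. P n k (t n k)" by metis
  define N f w where "N n k = fst (t n k)" and "f n k = fst (snd (t n k))" and "w n k = snd (snd (t n k))" for n k
  have fw: "i < N n k \<Longrightarrow> f n k i \<in> Lp_space m \<infinity>" "i < N n k \<Longrightarrow> w n k i \<in> W"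
    "act (indicat_real (B n k)) (u n) = (\<Sum>i<N n k. act (f n k i) (w n k i))" for n k i
    using t[of n k] unfolding P_def N_def f_def w_def by auto
  \<comment> \<open>Lists of rationals keep the family countable. Entries beyond the length of
    \<open>q\<close> are unspecified rationals, so \<open>c n k q\<close> lies in \<open>W\<close>
    for every list.\<close>
  define c where "c n k q = (\<Sum>i<N n k. real_of_rat (q ! i) *\<^sub>R w n k i)" for n k and q :: "rat list"
  define C where "C = range (\<lambda>(n,k,q). c n k q)"
  have "C \<subseteq> W" using fw(2) by (auto simp: C_def c_def intro!: subspace_sum[OF W] subspace_scale[OF W])
  \<comment> \<open>On \<open>B n k\<close> the cut-off of \<open>u n\<close> agrees with
    \<open>u n\<close>, so only the error of replacing the coefficients by rationals
    remains.\<close>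
  have est: "AE x in m. x \<in> B n k \<longrightarrow>
      pn (u n - c n k q) x \<le> (\<Sum>i<N n k. \<bar>f n k i x - real_of_rat (q ! i)\<bar> * pn (w n k i) x)" for n k q
  proof -
    let ?e = "indicat_real (B n k)"
    let ?g = "\<lambda>i x. f n k i x - real_of_rat (q ! i)"
    have L: "?e \<in> Lp_space m \<infinity>" "(\<lambda>x. 1 - ?e x) \<in> Lp_space m \<infinity>" using B(1) by auto
    have "act ?e (u n) - c n k q = (\<Sum>i<N n k. act (?g i) (w n k i))"
      unfolding fw(3) c_def sum_subtractf[symmetric]
      using fw(1) by (intro sum.cong refl) (simp add: act_diff_left act_const)
    then have "AE x in m. pn (act ?e (u n) - c n k q) x \<le> (\<Sum>i<N n k. pn (act (?g i) (w n k i)) x)"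
      using pn_sum_le[of "{..<N n k}" "\<lambda>i. act (?g i) (w n k i)"] by simp
    moreover have "AE x in m. \<forall>i\<in>{..<N n k}. pn (act (?g i) (w n k i)) x = \<bar>?g i x\<bar> * pn (w n k i) x"
      by (subst AE_ball_countable) (use fw(1) in \<open>auto intro!: pn_act\<close>)
    moreover have "AE x in m. pn (act (\<lambda>x. 1 - ?e x) (u n)) x = \<bar>1 - ?e x\<bar> * pn (u n) x"
      by (rule pn_act[OF L(2)])
    moreover have "AE x in m. pn (u n - c n k q) x \<le> pn (u n - act ?e (u n)) x + pn (act ?e (u n) - c n k q) x"
      by (rule pn_triangle)
    moreover have "AE x in m. act (\<lambda>x. 1 - ?e x) (u n) = u n - act ?e (u n)"
      using act_diff_left[OF const_Linf[of 1] L(1)] by simp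
    ultimately show ?thesis
    proof eventually_elim
      case (elim x)
      show ?case
      proof
        assume x: "x \<in> B n k"
        have "pn (u n - act ?e (u n)) x = 0" using elim(3,5) x by simp
        moreover have "(\<Sum>i<N n k. pn (act (?g i) (w n k i)) x) = (\<Sum>i<N n k. \<bar>?g i x\<bar> * pn (w n k i) x)"
          using elim(2) by (intro sum.cong) auto
        ultimately show "pn (u n - c n k q) x \<le> (\<Sum>i<N n k. \<bar>?g i x\<bar> * pn (w n k i) x)"
          using elim(1,4) by linarith
      qed
    qed
  qed
  have "AE x in m. \<forall>n k q. x \<in> B n k \<longrightarrow>
      pn (u n - c n k q) x \<le> (\<Sum>i<N n k. \<bar>f n k i x - real_of_rat (q ! i)\<bar> * pn (w n k i) x)"
    unfolding AE_all_countable using est by blast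
  moreover have "AE x in m. \<forall>n k q. pn (v - c n k q) x \<le> pn (v - u n) x + pn (u n - c n k q) x"
    using pn_triangle by (simp add: AE_all_countable)
  moreover have "AE x in m. \<forall>n k i. 0 \<le> pn (w n k i) x"
    using pn_nonneg by (simp add: AE_all_countable)
  moreover note tendsto_imp_pn_approx[OF u(2)]
  ultimately have "AE x in m. \<forall>\<epsilon>>0. \<exists>w\<in>C. pn (v - w) x < \<epsilon>"
  proof eventually_elim
    case (elim x)
    show ?case
    proof (intro allI impI)
      fix \<epsilon> :: real assume e: "0 < \<epsilon>"
      obtain n where n: "pn (v - u n) x < \<epsilon> / 2" using elim(4) e half_gt_zero by blast
      obtain k where k: "x \<in> B n k" using B(2)[of n] by blast
      define S where "S = (\<Sum>i<N n k. pn (w n k i) x)"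
      have S: "0 \<le> S" unfolding S_def using elim(3) by (intro sum_nonneg) auto
      \<comment> \<open>The coefficient errors are weighted by the pointwise norms of the
        \<open>w n k i\<close>, whose sum is \<open>S\<close>; the \<open>+ 1\<close> covers
        \<open>S = 0\<close>.\<close>
      define \<delta> where "\<delta> = \<epsilon> / (2 * (S + 1))"
      have d: "0 < \<delta>" using e S by (simp add: \<delta>_def)
      have "\<exists>q. \<bar>f n k i x - real_of_rat q\<bar> \<le> \<delta>" for i
      proof -
        obtain q where "f n k i x < of_rat q" "of_rat q < f n k i x + \<delta>"
          using of_rat_dense[of "f n k i x" "f n k i x + \<delta>"] d by auto
        then show ?thesis by (intro exI[of _ q]) auto
      qed
      then obtain r where r: "\<And>i. \<bar>f n k i x - real_of_rat (r i)\<bar> \<le> \<delta>" by metis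
      define q where "q = map r [0..<N n k]"
      have "pn (u n - c n k q) x \<le> (\<Sum>i<N n k. \<bar>f n k i x - real_of_rat (q ! i)\<bar> * pn (w n k i) x)"
        using elim(1) k by blast
      also have "\<dots> \<le> (\<Sum>i<N n k. \<delta> * pn (w n k i) x)"
        using r elim(3) by (intro sum_mono mult_right_mono) (auto simp: q_def)
      also have "\<dots> = \<delta> * S" by (simp add: S_def sum_distrib_left)
      also have "\<dots> < \<epsilon> / 2" using e S by (simp add: \<delta>_def field_simps)
      finally have "pn (v - c n k q) x < \<epsilon>" using elim(2)[rule_format, of n k q] n by simp
      then show "\<exists>w\<in>C. pn (v - w) x < \<epsilon>" unfolding C_def by auto
    qed
  qed
  then show thesis using \<open>C \<subseteq> W\<close> by (intro that[of C]) (auto simp: C_def)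
qed

end

section \<open>Local vector measures with a polar decomposition\<close>

lemma compact_dist_pos:
  fixes K K' :: "'a::metric_space set"
  assumes "compact K" "compact K'" "K \<inter> K' = {}"
  shows "\<exists>r>0. \<forall>x\<in>K. \<forall>y\<in>K'. r \<le> dist x y"
proof (cases "K = {} \<or> K' = {}")
  case True
  then show ?thesis by (auto intro: exI[of _ 1])
next
  case False
  have "\<exists>z\<in>K \<times> K'. \<forall>y\<in>K \<times> K'. dist (fst z) (snd z) \<le> dist (fst y) (snd y)"
    using assms False by (intro continuous_attains_inf compact_Times continuous_intros) auto
  then obtain a b where ab: "a \<in> K" "b \<in> K'" "\<forall>x\<in>K. \<forall>y\<in>K'. dist a b \<le> dist x y" by auto
  then have "0 < dist a b" using assms(3) by auto
  with ab show ?thesis by blast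
qed

lemma finite_family_pos_bound:
  fixes P :: "'i \<Rightarrow> real \<Rightarrow> bool"
  assumes "finite I" "\<And>i. i \<in> I \<Longrightarrow> \<exists>r>0. P i r"
    and mono: "\<And>i r s. P i r \<Longrightarrow> 0 < s \<Longrightarrow> s \<le> r \<Longrightarrow> P i s"
  shows "\<exists>r>0. \<forall>i\<in>I. P i r"
  using assms(1,2)
proof (induction I rule: finite_induct)
  case empty
  show ?case by (auto intro: exI[of _ 1])
next
  case (insert i I)
  obtain r where r: "0 < r" "P i r" using insert.prems[of i] by auto
  moreover obtain s where "0 < s" "\<forall>j\<in>I. P j s" using insert.IH insert.prems by auto
  ultimately have "0 < min r s \<and> (\<forall>j\<in>insert i I. P j (min r s))"
    using mono[of _ r "min r s"] mono[of _ s "min r s"] by auto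
  then show ?case by blast
qed

lemma bcontfun_bounded:
  assumes "f \<in> bcontfun" obtains b where "\<And>x. \<bar>f x\<bar> \<le> (b::real)"
  using assms by (auto simp: bcontfun_def bounded_iff)

lemma abs_le_sup_norm:
  assumes "f \<in> bcontfun" shows "\<bar>f x\<bar> \<le> sup_norm f"
proof -
  obtain b where "\<And>x. \<bar>f x\<bar> \<le> b" using bcontfun_bounded[OF assms] by blast
  then show ?thesis unfolding sup_norm_def by (intro cSUP_upper) (auto intro!: bdd_aboveI2)
qed

lemma sup_norm_le: "(\<And>x. \<bar>f x\<bar> \<le> c) \<Longrightarrow> sup_norm f \<le> c"
  unfolding sup_norm_def by (intro cSUP_least) auto

lemma total_variation_trivial:
  assumes "\<And>A. A \<in> sets borel \<Longrightarrow> dual_norm U nrm (N A) = 0"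
  shows "total_variation U nrm N E = 0"
proof -
  have "(\<Sum>A\<in>\<pi>. ennreal (dual_norm U nrm (N A))) = 0" if "\<pi> \<subseteq> sets borel" for \<pi>
    using assms that by (intro sum.neutral) auto
  then have "total_variation U nrm N E \<le> 0" unfolding total_variation_def by (intro SUP_least) auto
  then show ?thesis by simp
qed

section \<open>Local seminorms\<close>

context Lp_normed_module
begin

lemma bcontfun_Linf:
  assumes "f \<in> bcontfun" shows "f \<in> Lp_space m \<infinity>"
proof -
  obtain b where "\<And>x. \<bar>f x\<bar> \<le> b" using bcontfun_bounded[OF assms] by blast
  moreover have "f \<in> borel_measurable borel"
    using assms by (intro borel_measurable_continuous_onI) (simp add: bcontfun_def)
  ultimately show ?thesis unfolding Linf_iff by auto
qed

text \<open>The supremum runs over a set that is bounded by \<open>nrm w\<close> and contains the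
  value at \<open>f = 0\<close>, so it obeys the rules for real suprema.\<close>

lemma local_seminorm_bounds:
  assumes R: "R \<subseteq> bcontfun" "(\<lambda>x. 0) \<in> R" and w: "w \<in> V"
  shows local_seminorm_nonneg: "0 \<le> local_seminorm R nrm act A w"
    and local_seminorm_upper:
      "\<And>f. f \<in> R \<Longrightarrow> supp f \<subseteq> A \<Longrightarrow> sup_norm f \<le> 1 \<Longrightarrow> nrm (act f w) \<le> local_seminorm R nrm act A w"
    and local_seminorm_le:
      "\<And>c. (\<And>f. f \<in> R \<Longrightarrow> supp f \<subseteq> A \<Longrightarrow> (\<And>x. \<bar>f x\<bar> \<le> 1) \<Longrightarrow> nrm (act f w) \<le> c) \<Longrightarrow>
        local_seminorm R nrm act A w \<le> c"
proof -
  let ?S = "{nrm (act f w) |f. f \<in> R \<and> supp f \<subseteq> A \<and> sup_norm f \<le> 1}"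
  have "nrm (act f w) \<le> 1 * nrm w" if "f \<in> R" "sup_norm f \<le> 1" for f
    using that R order_trans[OF abs_le_sup_norm that(2)]
    by (intro sup_pn_act_le[OF bcontfun_Linf w]) auto
  then have bdd: "bdd_above ?S" by (intro bdd_aboveI[of _ "nrm w"]) auto
  have z: "supp (\<lambda>x. 0) \<subseteq> A" "sup_norm (\<lambda>x. 0) \<le> 1"
    by (auto simp: supp_def intro: sup_norm_le)
  show upper: "nrm (act f w) \<le> local_seminorm R nrm act A w"
    if "f \<in> R" "supp f \<subseteq> A" "sup_norm f \<le> 1" for f
    unfolding local_seminorm_def using that by (intro cSup_upper bdd) auto
  show "0 \<le> local_seminorm R nrm act A w"
    using upper[OF R(2) z] by (rule order_trans[rotated]) (simp add: act_const V_0)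
  show "local_seminorm R nrm act A w \<le> c"
    if c: "\<And>f. f \<in> R \<Longrightarrow> supp f \<subseteq> A \<Longrightarrow> (\<And>x. \<bar>f x\<bar> \<le> 1) \<Longrightarrow> nrm (act f w) \<le> c" for c
    unfolding local_seminorm_def
  proof (rule cSup_least)
    show "?S \<noteq> {}" using R(2) z by blast
    fix t assume "t \<in> ?S"
    then obtain f where f: "t = nrm (act f w)" "f \<in> R" "supp f \<subseteq> A" "sup_norm f \<le> 1" by auto
    have "\<bar>f x\<bar> \<le> 1" for x using abs_le_sup_norm[of f x] f R by auto
    then show "t \<le> c" using c f by auto
  qed
qed

end

section \<open>Pointwise consequences of the polar decomposition\<close>

locale polar_local_vector_measure = Lp_normed_module m p act pn
  for m :: "'a::polish_space measure" and p and act :: "('a \<Rightarrow> real) \<Rightarrow> 'm::banach \<Rightarrow> 'm" and pn +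
  fixes R :: "('a \<Rightarrow> real) set" and W :: "'m set"
    and N :: "'a set \<Rightarrow> 'm \<Rightarrow> real" and L :: "'a \<Rightarrow> 'm \<Rightarrow> real"
  assumes approx: "approximating_subring R"
    and W_V: "W \<subseteq> bounded_part m pn"
    and modW: "normed_module_over R W (sup_pn m pn) act"
    and gen: "generates m act W"
    and lvm: "local_vector_measure R W (sup_pn m pn) act N"
    and ac: "absolutely_continuous m (tv_measure W (sup_pn m pn) N)"
    and polar: "polar_decomposition R W (sup_pn m pn) act N L"
begin

abbreviation "\<nu> \<equiv> tv_measure W nrm N"

lemma sets_\<nu> [measurable_cong, simp]: "sets \<nu> = sets borel"
  using sets.sets_measure_of_eq[of "borel :: 'a measure"] by (simp add: tv_measure_def)

lemma space_\<nu> [simp]: "space \<nu> = UNIV"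
  using sets_eq_imp_space_eq[OF sets_\<nu>] by simp

lemma AE_\<nu>: "AE x in m. P x \<Longrightarrow> AE x in \<nu>. P x"
  by (rule absolutely_continuous_AE[OF _ ac]) simp_all

lemma R_bcontfun: "R \<subseteq> bcontfun" and R_1: "(\<lambda>x. 1) \<in> R"
  and R_diff: "f \<in> R \<Longrightarrow> g \<in> R \<Longrightarrow> (\<lambda>x. f x - g x) \<in> R"
  and R_max: "f \<in> R \<Longrightarrow> g \<in> R \<Longrightarrow> (\<lambda>x. max (f x) (g x)) \<in> R"
  and R_scale: "f \<in> R \<Longrightarrow> (\<lambda>x. c * f x) \<in> R"
  and R_open: "open A \<Longrightarrow> \<exists>f :: nat \<Rightarrow> 'a \<Rightarrow> real.
        (\<forall>k. f k \<in> R) \<and> (\<forall>x. incseq (\<lambda>k. f k x)) \<and> (\<forall>x. (\<lambda>k. f k x) \<longlonglongrightarrow> indicator A x)"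
  using approx by (simp_all add: approximating_subring_def)

lemma R_const: "(\<lambda>x. c) \<in> R"
  using R_scale[OF R_1, of c] by simp

lemma normed_space_W: "normed_space_on W nrm"
  and W_act: "f \<in> R \<Longrightarrow> v \<in> W \<Longrightarrow> act f v \<in> W"
  using modW by (auto simp: normed_module_over_def)

lemmas subspace_W = normed_space_onD(1)[OF normed_space_W]

lemma N_dual: "A \<in> sets borel \<Longrightarrow> N A \<in> dual_space W nrm"
  using lvm by (auto simp: local_vector_measure_def)

lemma L_dual: "L x \<in> dual_space W nrm"
  and L_int: "v \<in> W \<Longrightarrow> integrable \<nu> (\<lambda>x. L x v)"
  and N_eq: "v \<in> W \<Longrightarrow> A \<in> sets borel \<Longrightarrow> N A v = (LINT x:A|\<nu>. L x v)"
  using polar by (auto simp: polar_decomposition_def)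

lemma L_meas [measurable]: "v \<in> W \<Longrightarrow> (\<lambda>x. L x v) \<in> borel_measurable borel"
  using borel_measurable_integrable[OF L_int] measurable_cong_sets[OF sets_\<nu> refl] by blast

lemma L_add: "v \<in> W \<Longrightarrow> w \<in> W \<Longrightarrow> L x (v + w) = L x v + L x w"
  and L_scale: "v \<in> W \<Longrightarrow> L x (c *\<^sub>R v) = c * L x v"
  using L_dual[of x] by (auto simp: dual_space_def)

lemma L_diff: "v \<in> W \<Longrightarrow> w \<in> W \<Longrightarrow> L x (v - w) = L x v - L x w"
  using L_add[of "v - w" w x] subspace_diff[OF subspace_W] by auto

lemma L_le_local:
  assumes "v \<in> W" "open A" "x \<in> A" shows "\<bar>L x v\<bar> \<le> local_seminorm R nrm act A v"
proof -
  have "\<bar>L x v\<bar> \<le> Inf {local_seminorm R nrm act A v |A. open A \<and> x \<in> A}"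
    using polar assms(1) by (auto simp: polar_decomposition_def)
  also have "\<dots> \<le> local_seminorm R nrm act A v"
    using assms W_V local_seminorm_nonneg[OF R_bcontfun R_const]
    by (intro cInf_lower bdd_belowI[of _ 0]) auto
  finally show ?thesis .
qed

lemma L_le: "v \<in> W \<Longrightarrow> \<bar>L x v\<bar> \<le> nrm v"
proof -
  assume v: "v \<in> W"
  have "local_seminorm R nrm act UNIV v \<le> 1 * nrm v"
    using R_bcontfun v W_V
    by (intro local_seminorm_le[OF R_bcontfun R_const] sup_pn_act_le bcontfun_Linf) auto
  then show ?thesis using L_le_local[OF v, of UNIV x] by simp
qed

text \<open>Near \<open>x\<close> the function \<open>f - f x\<close> is small, and
  \<open>L x\<close> is bounded by the seminorms over neighbourhoods of \<open>x\<close>; so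
  \<open>L x\<close> kills \<open>(f - f x) v\<close>. This holds at every \<open>x\<close>, not
  only a.e.\<close>

lemma L_act:
  assumes f: "f \<in> R" and v: "v \<in> W" shows "L x (act f v) = f x * L x v"
proof -
  let ?g = "\<lambda>y. f y - f x"
  have g: "?g \<in> R" using R_diff[OF f R_const] .
  have "\<bar>L x (act ?g v)\<bar> \<le> \<epsilon> * nrm v" if "0 < \<epsilon>" for \<epsilon>
  proof -
    let ?A = "{y. \<bar>?g y\<bar> < \<epsilon>}"
    have "continuous_on UNIV f" using f R_bcontfun by (auto simp: bcontfun_def)
    then have "open ?A" by (intro open_Collect_less continuous_intros)
    then have "\<bar>L x (act ?g v)\<bar> \<le> local_seminorm R nrm act ?A (act ?g v)"
      using that by (intro L_le_local W_act g v) auto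
    also have "\<dots> \<le> \<epsilon> * nrm v"
    proof (rule local_seminorm_le[OF R_bcontfun R_const])
      show "act ?g v \<in> V" using W_act[OF g v] W_V by auto
      fix h assume h: "h \<in> R" "supp h \<subseteq> ?A" "\<And>x. \<bar>h x\<bar> \<le> 1"
      have Li: "h \<in> Lp_space m \<infinity>" "?g \<in> Lp_space m \<infinity>" using h g R_bcontfun by (auto intro!: bcontfun_Linf)
      have "\<bar>h y * ?g y\<bar> \<le> \<epsilon>" for y
      proof (cases "h y = 0")
        case False
        then have "y \<in> ?A" using h(2) closure_subset[of "{x. h x \<noteq> 0}"] by (auto simp: supp_def)
        then show ?thesis using mult_mono[OF h(3)[of y], of "\<bar>?g y\<bar>" \<epsilon>] by (auto simp: abs_mult)
      qed (use that in auto)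
      then show "nrm (act h (act ?g v)) \<le> \<epsilon> * nrm v"
        unfolding act_act[OF Li] using v W_V by (intro sup_pn_act_le Linf_mult Li) auto
    qed
    finally show ?thesis .
  qed
  note * = this
  have "\<bar>L x (act ?g v)\<bar> \<le> 0 + \<epsilon>" if e: "0 < \<epsilon>" for \<epsilon>
  proof -
    have n: "0 \<le> nrm v" using v W_V sup_pn_nonneg by auto
    have "\<bar>L x (act ?g v)\<bar> \<le> \<epsilon> / (nrm v + 1) * nrm v" using e n by (intro *) simp
    also have "\<dots> \<le> \<epsilon>" using n e by (simp add: field_simps)
    finally show ?thesis by simp
  qed
  then have "\<bar>L x (act ?g v)\<bar> \<le> 0" by (rule field_le_epsilon)
  moreover have "act f v = act ?g v + f x *\<^sub>R v"
    using act_diff_left[of f "\<lambda>y. f x" v] bcontfun_Linf f R_bcontfun by (auto simp: act_const)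
  ultimately show ?thesis
    using L_add[OF W_act[OF g v] subspace_scale[OF subspace_W v]] L_scale[OF v] by simp
qed

text \<open>Countable additivity of the total variation is bypassed: if
  \<open>total_variation\<close> were not a measure, \<open>measure_of\<close> would return the zero
  measure, the polar decomposition would give \<open>N = 0\<close> on \<open>W\<close>, and the
  total variation would vanish too.\<close>

lemma emeasure_\<nu>: "E \<in> sets borel \<Longrightarrow> emeasure \<nu> E = total_variation W nrm N E"
proof -
  assume E: "E \<in> sets borel"
  have sig: "sigma_sets UNIV (sets borel) = (sets borel :: 'a set set)"
    using sets.sigma_sets_eq[of "borel :: 'a measure"] by simp
  have em: "emeasure \<nu> = (\<lambda>B. if B \<in> sets borel \<and> measure_space UNIV (sets borel) (total_variation W nrm N)
      then total_variation W nrm N B else 0)"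
    unfolding tv_measure_def emeasure_measure_of_conv sig ..
  show ?thesis
  proof (cases "measure_space UNIV (sets borel) (total_variation W nrm N)")
    case True
    then show ?thesis using E em by simp
  next
    case False
    then have z: "emeasure \<nu> A = 0" for A using em by simp
    have "N A v = 0" if "A \<in> sets borel" "v \<in> W" for A v
    proof -
      have "AE x in \<nu>. x \<notin> UNIV" using z by (intro AE_not_in) auto
      then have "(LINT x:A|\<nu>. L x v) = (LINT x|\<nu>. 0)"
        unfolding set_lebesgue_integral_def using that
        by (intro integral_cong_AE) (auto simp: measurable_cong_sets[OF sets_\<nu> refl])
      then show ?thesis using N_eq that by simp
    qed
    then have "dual_norm W nrm (N A) = 0" if "A \<in> sets borel" for A
      using that dual_norm_le[OF normed_space_W, of "N A" 0]
        dual_norm_nonneg[OF N_dual normed_space_W, of A] by force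
    then have "total_variation W nrm N E = 0" by (intro total_variation_trivial)
    then show ?thesis using z by simp
  qed
qed

text \<open>The measure with density \<open>\<bar>L x v\<bar>\<close> is finite on a Polish space,
  hence regular: \<open>K\<close> approximates \<open>A\<close> from inside, and an open set between
  \<open>K\<close> and \<open>U\<close> approximates \<open>K\<close> from outside. \<open>K\<close>
  is chosen before \<open>U\<close>, so the compact sets of several \<open>A\<close> can be
  separated before the functions are selected.\<close>

lemma inner_approximation:
  assumes v: "v \<in> W" and A: "A \<in> sets borel" and d: "0 < \<delta>"
  shows "\<exists>K. compact K \<and> K \<subseteq> A \<and> (\<forall>U. open U \<longrightarrow> K \<subseteq> U \<longrightarrow>
      (\<exists>f\<in>R. (\<forall>x. 0 \<le> f x \<and> f x \<le> 1) \<and> (\<forall>x. f x \<noteq> 0 \<longrightarrow> x \<in> U) \<and>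
        \<bar>N A v - (LINT x|\<nu>. f x * L x v)\<bar> \<le> \<delta>))"
proof -
  define \<mu> where "\<mu> = density \<nu> (\<lambda>x. ennreal \<bar>L x v\<bar>)"
  have Lm: "(\<lambda>x. L x v) \<in> borel_measurable \<nu>" using L_int[OF v] by auto
  have iabs: "integrable \<nu> (\<lambda>x. \<bar>L x v\<bar>)" using L_int[OF v] by auto
  have iind: "integrable \<nu> (\<lambda>x. indicator S x * \<bar>L x v\<bar>)" if "S \<in> sets borel" for S
    using integrable_mult_indicator[OF _ iabs, of S] that by simp
  have em: "emeasure \<mu> S = ennreal (\<integral>x. indicator S x * \<bar>L x v\<bar> \<partial>\<nu>)" if S: "S \<in> sets borel" for S
  proof -
    have "emeasure \<mu> S = (\<integral>\<^sup>+x. ennreal \<bar>L x v\<bar> * indicator S x \<partial>\<nu>)"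
      unfolding \<mu>_def using S Lm by (subst emeasure_density) auto
    also have "\<dots> = (\<integral>\<^sup>+x. ennreal (indicator S x * \<bar>L x v\<bar>) \<partial>\<nu>)"
      by (intro nn_integral_cong) (auto simp: indicator_def)
    also have "\<dots> = ennreal (\<integral>x. indicator S x * \<bar>L x v\<bar> \<partial>\<nu>)"
      by (intro nn_integral_eq_integral iind S) auto
    finally show ?thesis .
  qed
  have sm: "sets \<mu> = sets borel" "space \<mu> = UNIV" by (simp_all add: \<mu>_def)
  interpret \<mu>: finite_measure \<mu> using em[of UNIV] sm by (intro finite_measureI) (auto simp: infinity_ennreal_def)
  have meas: "measure \<mu> S = (\<integral>x. indicator S x * \<bar>L x v\<bar> \<partial>\<nu>)" if "S \<in> sets borel" for S
    using em[OF that] by (simp add: measure_def)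
  \<comment> \<open>Errors of a quarter each: from \<open>A\<close> to \<open>K\<close>, from
    \<open>K\<close> to the open set \<open>V\<close>, and from the indicator of \<open>V\<close> to
    \<open>g k\<close>.\<close>
  have d3: "0 < \<delta> / 4" using d by simp
  have fin: "emeasure \<mu> (space \<mu>) \<noteq> \<infinity>" by (simp add: infinity_ennreal_def)
  have "\<exists>K\<in>{K. K \<subseteq> A \<and> compact K}. emeasure \<mu> A < emeasure \<mu> K + ennreal (\<delta> / 4)"
    using d3 \<mu>.emeasure_finite[of A]
    by (intro SUP_approx_ennreal[OF _ _ inner_regular[OF sm(1) fin A]]) (auto simp: infinity_ennreal_def)
  then obtain K where K: "K \<subseteq> A" "compact K" "emeasure \<mu> A < emeasure \<mu> K + ennreal (\<delta> / 4)" by auto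
  have Kb: "K \<in> sets borel" using K by (simp add: borel_compact)
  have KA: "measure \<mu> A \<le> measure \<mu> K + \<delta> / 4"
  proof -
    have "ennreal (measure \<mu> A) \<le> ennreal (measure \<mu> K + \<delta> / 4)"
      using K(3) d by (simp add: \<mu>.emeasure_eq_measure)
    then show ?thesis using d by (subst (asm) ennreal_le_iff) (auto intro: add_nonneg_nonneg)
  qed
  have "\<exists>f\<in>R. (\<forall>x. 0 \<le> f x \<and> f x \<le> 1) \<and> (\<forall>x. f x \<noteq> 0 \<longrightarrow> x \<in> U) \<and>
        \<bar>N A v - (LINT x|\<nu>. f x * L x v)\<bar> \<le> \<delta>" if U: "open U" "K \<subseteq> U" for U
  proof -
    have "\<exists>V\<in>{V. K \<subseteq> V \<and> open V}. emeasure \<mu> V < emeasure \<mu> K + ennreal (\<delta> / 4)"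
      using d3 U \<mu>.emeasure_finite[of K]
      by (intro INF_approx_ennreal[OF _ outer_regular[OF sm(1) fin Kb]]) (auto simp: infinity_ennreal_def)
    then obtain V' where V': "K \<subseteq> V'" "open V'" "emeasure \<mu> V' < emeasure \<mu> K + ennreal (\<delta> / 4)" by auto
    define V where "V = U \<inter> V'"
    have V: "K \<subseteq> V" "open V" "V \<subseteq> U" using U V' by (auto simp: V_def)
    then have Vb: "V \<in> sets borel" by simp
    have "emeasure \<mu> V \<le> emeasure \<mu> V'" using V'(2) sm by (intro emeasure_mono) (auto simp: V_def)
    also note V'(3)
    finally have "ennreal (measure \<mu> V) \<le> ennreal (measure \<mu> K + \<delta> / 4)"
      using d by (simp add: \<mu>.emeasure_eq_measure)
    then have KV: "measure \<mu> V \<le> measure \<mu> K + \<delta> / 4"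
      using d by (subst (asm) ennreal_le_iff) (auto intro: add_nonneg_nonneg)
    obtain f :: "nat \<Rightarrow> 'a \<Rightarrow> real" where f: "\<And>k. f k \<in> R" "\<And>x. incseq (\<lambda>k. f k x)"
      "\<And>x. (\<lambda>k. f k x) \<longlonglongrightarrow> indicator V x" using R_open[OF V(2)] by blast
    \<comment> \<open>Increasing to the indicator, \<open>f k\<close> lies below it but may be
      negative; the lattice property keeps its positive part in \<open>R\<close>.\<close>
    define g where "g k x = max (f k x) 0" for k x
    have g: "g k \<in> R" for k unfolding g_def using R_max[OF f(1) R_const] .
    have f_le: "f k x \<le> indicator V x" for k x using incseq_le[OF f(2) f(3)] .
    have g01: "0 \<le> g k x" "g k x \<le> indicator V x" for k x
      using f_le[of k x] by (auto simp: g_def)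
    have gV: "g k x \<le> 1" "g k x \<noteq> 0 \<Longrightarrow> x \<in> U" for k x
      using g01[of k x] V(3) by (cases "x \<in> V"; auto)+
    have gm: "g k \<in> borel_measurable borel" for k
      using bcontfun_Linf[of "g k"] g R_bcontfun Linf_meas[of "g k"] by (auto simp: measurable_cong_sets[OF sets_m refl])
    have "(\<lambda>k. LINT x|\<nu>. g k x * L x v) \<longlonglongrightarrow> (LINT x|\<nu>. indicator V x * L x v)"
    proof (rule integral_dominated_convergence[where w = "\<lambda>x. \<bar>L x v\<bar>"])
      have "(\<lambda>k. g k x) \<longlonglongrightarrow> max (indicator V x) 0" for x unfolding g_def by (intro tendsto_max f tendsto_const)
      then have "(\<lambda>k. g k x) \<longlonglongrightarrow> indicator V x" for x by (simp add: max_absorb1)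
      then show "AE x in \<nu>. (\<lambda>k. g k x * L x v) \<longlonglongrightarrow> indicator V x * L x v"
        by (auto intro!: tendsto_mult)
      show "AE x in \<nu>. norm (g k x * L x v) \<le> \<bar>L x v\<bar>" for k
        using g01 gV by (auto simp: abs_mult intro!: mult_left_le_one_le)
    qed (use iabs gm Lm Vb in \<open>auto simp: measurable_cong_sets[OF sets_\<nu> refl]\<close>)
    from tendstoD[OF this, of "\<delta> / 4"] d obtain k where
      k: "\<bar>(LINT x|\<nu>. g k x * L x v) - (LINT x|\<nu>. indicator V x * L x v)\<bar> < \<delta> / 4"
      by (auto simp: eventually_sequentially dist_real_def)
    have iL: "integrable \<nu> (\<lambda>x. indicator S x * L x v)" if "S \<in> sets borel" for S
      using integrable_mult_indicator[OF _ L_int[OF v], of S] that by simp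
    have "\<bar>N A v - (LINT x|\<nu>. indicator V x * L x v)\<bar> = \<bar>LINT x|\<nu>. indicator A x * L x v - indicator V x * L x v\<bar>"
      using N_eq[OF v A] iL A Vb by (simp add: set_lebesgue_integral_def)
    also have "\<dots> \<le> (LINT x|\<nu>. \<bar>indicator A x * L x v - indicator V x * L x v\<bar>)"
      by (rule integral_abs_bound)
    \<comment> \<open>Both \<open>A\<close> and \<open>V\<close> contain \<open>K\<close>, so the
      difference of their indicators is controlled by the two excesses over
      \<open>K\<close>.\<close>
    also have "\<dots> \<le> (LINT x|\<nu>. (indicator A x * \<bar>L x v\<bar> - indicator K x * \<bar>L x v\<bar>) +
          (indicator V x * \<bar>L x v\<bar> - indicator K x * \<bar>L x v\<bar>))"
      using K(1) V(1) by (intro integral_mono integrable_abs Bochner_Integration.integrable_diff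
        Bochner_Integration.integrable_add iL iind A Vb Kb) (auto simp: indicator_def)
    also have "\<dots> = (measure \<mu> A - measure \<mu> K) + (measure \<mu> V - measure \<mu> K)"
      using iind A Vb Kb by (simp add: meas)
    also have "\<dots> \<le> \<delta> / 4 + \<delta> / 4" using KA KV by simp
    finally have "\<bar>N A v - (LINT x|\<nu>. g k x * L x v)\<bar> \<le> \<delta>" using k d by linarith
    then show ?thesis using g[of k] g01(1)[of k] gV[of k] by blast
  qed
  with K show ?thesis by blast
qed

end

section \<open>Finiteness of the total variation\<close>

context polar_local_vector_measure
begin

text \<open>Finiteness of the total variation comes from the module structure: nearly optimal test
  elements on the pieces of a partition are glued with functions of disjoint supports into a single
  element of norm at most \<open>1\<close>, on which \<open>N UNIV\<close> is bounded.\<close>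

lemma sum_dual_norm_le:
  assumes \<pi>: "finite \<pi>" "partition_on UNIV \<pi>" "\<pi> \<subseteq> sets borel"
  shows "(\<Sum>A\<in>\<pi>. dual_norm W nrm (N A)) \<le> dual_norm W nrm (N UNIV)"
proof (rule field_le_epsilon)
  fix e :: real assume e: "0 < e"
  note dN = N_dual[of UNIV, simplified]
  have ne: "\<pi> \<noteq> {}" using \<pi>(2) by (auto simp: partition_on_def)
  define n where "n = card \<pi>"
  have n: "0 < n" using ne \<pi>(1) by (simp add: n_def card_gt_0_iff)
  \<comment> \<open>Each of the \<open>n\<close> pieces loses \<delta> twice: through the nearly
    optimal \<open>v A\<close>, and through replacing the indicator of \<open>A\<close> by a
    function in \<open>R\<close>.\<close>
  define \<delta> where "\<delta> = e / (2 * real n)"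
  have d: "0 < \<delta>" using e n by (simp add: \<delta>_def)
  have "\<exists>v. v \<in> W \<and> nrm v \<le> 1 \<and> dual_norm W nrm (N A) \<le> N A v + \<delta>" if "A \<in> \<pi>" for A
  proof -
    have NA: "N A \<in> dual_space W nrm" using that \<pi>(3) N_dual by auto
    have "{\<bar>N A v\<bar> |v. v \<in> W \<and> nrm v \<le> 1} \<noteq> {}"
      using normed_space_onD(5,6)[OF normed_space_W] by (auto intro!: exI[of _ 0])
    then obtain v where v: "v \<in> W" "nrm v \<le> 1" "dual_norm W nrm (N A) - \<delta> < \<bar>N A v\<bar>"
      using less_cSupD[of "{\<bar>N A v\<bar> |v. v \<in> W \<and> nrm v \<le> 1}" "dual_norm W nrm (N A) - \<delta>"] d
      unfolding dual_norm_def by auto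
    have "N A ((-1) *\<^sub>R v) = -1 * N A v"
      using NA v(1) unfolding dual_space_def by blast
    moreover have "nrm ((-1) *\<^sub>R v) = nrm v"
      using normed_space_onD(4)[OF normed_space_W v(1), of "-1"] by simp
    moreover have "(-1) *\<^sub>R v \<in> W" by (rule subspace_scale[OF subspace_W v(1)])
    \<comment> \<open>A change of sign makes the value of \<open>N A\<close> nonnegative, so that
      the pieces add up without cancellation.\<close>
    ultimately have "if 0 \<le> N A v then v \<in> W \<and> nrm v \<le> 1 \<and> dual_norm W nrm (N A) \<le> N A v + \<delta>
        else (-1) *\<^sub>R v \<in> W \<and> nrm ((-1) *\<^sub>R v) \<le> 1 \<and> dual_norm W nrm (N A) \<le> N A ((-1) *\<^sub>R v) + \<delta>"
      using v by auto
    then show ?thesis by meson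
  qed
  then obtain v where v: "\<And>A. A \<in> \<pi> \<Longrightarrow> v A \<in> W" "\<And>A. A \<in> \<pi> \<Longrightarrow> nrm (v A) \<le> 1"
    "\<And>A. A \<in> \<pi> \<Longrightarrow> dual_norm W nrm (N A) \<le> N A (v A) + \<delta>" by metis
  define P where "P A K \<longleftrightarrow> compact K \<and> K \<subseteq> A \<and> (\<forall>U. open U \<longrightarrow> K \<subseteq> U \<longrightarrow>
      (\<exists>f\<in>R. (\<forall>x. 0 \<le> f x \<and> f x \<le> 1) \<and> (\<forall>x. f x \<noteq> 0 \<longrightarrow> x \<in> U) \<and>
        \<bar>N A (v A) - (LINT x|\<nu>. f x * L x (v A))\<bar> \<le> \<delta>))" for A K
  have "\<forall>A\<in>\<pi>. \<exists>K. P A K"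
    unfolding P_def using \<pi>(3) by (intro ballI inner_approximation[OF v(1) _ d]) auto
  then obtain K where K: "\<And>A. A \<in> \<pi> \<Longrightarrow> P A (K A)" by metis
  have KA: "compact (K A)" "K A \<subseteq> A" if "A \<in> \<pi>" for A
    using K[OF that] unfolding P_def by iprover+
  have disj: "K A \<inter> K B = {}" if "A \<in> \<pi>" "B \<in> \<pi>" "A \<noteq> B" for A B
  proof -
    have "K A \<subseteq> A" "K B \<subseteq> B" using KA that by blast+
    moreover have "A \<inter> B = {}" using disjointD[OF partition_onD2[OF \<pi>(2)] that] .
    ultimately show ?thesis by auto
  qed
  \<comment> \<open>\<open>U A\<close> will be the \<open>r\<close>-neighbourhood of
    \<open>K A\<close>; the closure in the definition of the support stays within
    \<open>2 * r\<close>, so distance \<open>4 * r\<close> separates two supports.\<close>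
  define Q where "Q t r \<longleftrightarrow> (\<forall>x\<in>K (fst t). \<forall>y\<in>K (snd t). 4 * r \<le> dist x y)" for t r
  have "\<exists>r>0. \<forall>t\<in>{t \<in> \<pi> \<times> \<pi>. fst t \<noteq> snd t}. Q t r"
  proof (rule finite_family_pos_bound)
    fix t assume t: "t \<in> {t \<in> \<pi> \<times> \<pi>. fst t \<noteq> snd t}"
    have "compact (K (fst t))" "compact (K (snd t))" "K (fst t) \<inter> K (snd t) = {}"
      using t KA(1) disj[of "fst t" "snd t"] by auto
    from compact_dist_pos[OF this] obtain r where "0 < r" "\<forall>x\<in>K (fst t). \<forall>y\<in>K (snd t). r \<le> dist x y"
      by iprover
    then show "\<exists>r>0. Q t r" unfolding Q_def by (intro exI[of _ "r / 4"]) simp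
  next
    fix t r s assume "Q t r" "s \<le> r"
    moreover have "4 * s \<le> 4 * r" using \<open>s \<le> r\<close> by simp
    ultimately show "Q t s" unfolding Q_def by (blast intro: order_trans)
  qed (use \<pi>(1) in simp)
  then obtain r where r0: "0 < r" "\<forall>t\<in>{t \<in> \<pi> \<times> \<pi>. fst t \<noteq> snd t}. Q t r" by iprover
  have r: "0 < r" "\<And>A B x y. A \<in> \<pi> \<Longrightarrow> B \<in> \<pi> \<Longrightarrow> A \<noteq> B \<Longrightarrow> x \<in> K A \<Longrightarrow> y \<in> K B \<Longrightarrow> 4 * r \<le> dist x y"
    using r0(1) bspec[OF r0(2), of "(_, _)"] by (simp_all add: Q_def)
  define U where "U A = (\<Union>y\<in>K A. ball y r)" for A
  have U: "open (U A)" "K A \<subseteq> U A" for A using r(1) by (auto simp: U_def)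
  define F where "F A f \<longleftrightarrow> f \<in> R \<and> (\<forall>x. 0 \<le> f x \<and> f x \<le> 1) \<and> (\<forall>x. f x \<noteq> 0 \<longrightarrow> x \<in> U A) \<and>
        \<bar>N A (v A) - (LINT x|\<nu>. f x * L x (v A))\<bar> \<le> \<delta>" for A f
  have "\<exists>f. F A f" if "A \<in> \<pi>" for A
    using K[OF that] U[of A] unfolding P_def F_def Bex_def by iprover
  then obtain f where f': "\<And>A. A \<in> \<pi> \<Longrightarrow> F A (f A)" by metis
  have f: "f A \<in> R" "0 \<le> f A x \<and> f A x \<le> 1" "f A x \<noteq> 0 \<Longrightarrow> x \<in> U A"
    "\<bar>N A (v A) - (LINT x|\<nu>. f A x * L x (v A))\<bar> \<le> \<delta>" if "A \<in> \<pi>" for A x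
    using f'[OF that] unfolding F_def by iprover+
  have supp: "\<exists>y\<in>K A. dist x y < 2 * r" if A: "A \<in> \<pi>" and x: "x \<in> supp (f A)" for A x
  proof -
    obtain z where z: "f A z \<noteq> 0" "dist z x < r"
      using x r(1) unfolding supp_def closure_approachable by auto
    then obtain y where "y \<in> K A" "dist y z < r" using f(3)[OF A] by (auto simp: U_def)
    then show ?thesis using z(2) dist_triangle[of x y z] by (intro bexI[of _ y]) (auto simp: dist_commute)
  qed
  have disj_supp: "supp (f A) \<inter> supp (f B) = {}" if AB: "A \<in> \<pi>" "B \<in> \<pi>" "A \<noteq> B" for A B
  proof (rule ccontr)
    assume "supp (f A) \<inter> supp (f B) \<noteq> {}"
    then obtain x where x: "x \<in> supp (f A)" "x \<in> supp (f B)" by auto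
    obtain y z where yz: "y \<in> K A" "dist x y < 2 * r" "z \<in> K B" "dist x z < 2 * r"
      using supp[OF AB(1) x(1)] supp[OF AB(2) x(2)] by auto
    then have "dist y z < 4 * r" using dist_triangle[of y z x] by (simp add: dist_commute)
    with r(2)[OF AB yz(1,3)] show False by simp
  qed
  obtain h where h: "bij_betw h {..<n} \<pi>"
    using ex_bij_betw_nat_finite[OF \<pi>(1)] by (auto simp: n_def lessThan_atLeast0)
  have hin: "h i \<in> \<pi>" if "i < n" for i using bij_betwE[OF h] that by auto
  have hinj: "h i \<noteq> h j" if "i < n" "j < n" "i \<noteq> j" for i j
    using bij_betw_imp_inj_on[OF h] that by (auto simp: inj_on_def)
  define w where "w = (\<Sum>i<n. act (f (h i)) (v (h i)))"
  \<comment> \<open>The module inequality for disjoint supports keeps the norm of the sum at most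
    \<open>1\<close>, where the triangle inequality would give \<open>n\<close>.\<close>
  have "nrm w \<le> Max ((\<lambda>i. sup_norm (f (h i))) ` {..<n}) * Max ((\<lambda>i. nrm (v (h i))) ` {..<n})"
  proof -
    have *: "\<forall>n>0. \<forall>f v. (\<forall>i<n. f i \<in> R \<and> v i \<in> W) \<longrightarrow>
        (\<forall>i<n. \<forall>j<n. i \<noteq> j \<longrightarrow> supp (f i) \<inter> supp (f j) = {}) \<longrightarrow>
        nrm (\<Sum>i<n. act (f i) (v i)) \<le>
          Max ((\<lambda>i. sup_norm (f i)) ` {..<n}) * Max ((\<lambda>i. nrm (v i)) ` {..<(n::nat)})"
      using modW unfolding normed_module_over_def by blast
    show ?thesis
      unfolding w_def
      using *[rule_format, OF n, of "\<lambda>i. f (h i)" "\<lambda>i. v (h i)"] f(1) v(1) hin hinj disj_supp by simp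
  qed
  also have "\<dots> \<le> 1 * 1"
  proof (rule mult_mono)
    show "Max ((\<lambda>i. sup_norm (f (h i))) ` {..<n}) \<le> 1"
      using n f(2) hin by (subst Max_le_iff) (auto intro!: sup_norm_le)
    show "Max ((\<lambda>i. nrm (v (h i))) ` {..<n}) \<le> 1"
      using n v(2) hin by (subst Max_le_iff) auto
    have "0 \<le> nrm (v (h 0))" using v(1) hin n W_V sup_pn_nonneg by auto
    also have "\<dots> \<le> Max ((\<lambda>i. nrm (v (h i))) ` {..<n})" using n by (intro Max_ge) auto
    finally show "0 \<le> Max ((\<lambda>i. nrm (v (h i))) ` {..<n})" .
  qed simp
  finally have nw: "nrm w \<le> 1" by simp
  have actW: "act (f A) (v A) \<in> W" if "A \<in> \<pi>" for A using that f(1) v(1) W_act by auto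
  then have wW: "w \<in> W" unfolding w_def using hin by (intro subspace_sum[OF subspace_W]) auto
  have weq: "w = (\<Sum>A\<in>\<pi>. act (f A) (v A))"
    unfolding w_def using sum.reindex_bij_betw[OF h, of "\<lambda>A. act (f A) (v A)"] .
  have Nsum: "N UNIV (\<Sum>A\<in>S. act (f A) (v A)) = (\<Sum>A\<in>S. N UNIV (act (f A) (v A)))"
    if "finite S" "S \<subseteq> \<pi>" for S
    using that
  proof (induction S rule: finite_induct)
    case empty
    have "N UNIV (0 *\<^sub>R 0) = 0 * N UNIV 0"
      using dN normed_space_onD(6)[OF normed_space_W] unfolding dual_space_def by blast
    then show ?case by simp
  next
    case (insert A S)
    have "(\<Sum>A\<in>S. act (f A) (v A)) \<in> W" using insert(4) actW by (intro subspace_sum[OF subspace_W]) auto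
    then have "N UNIV (act (f A) (v A) + (\<Sum>A\<in>S. act (f A) (v A))) =
        N UNIV (act (f A) (v A)) + N UNIV (\<Sum>A\<in>S. act (f A) (v A))"
      using dN actW[of A] insert(4) unfolding dual_space_def by blast
    then show ?case using insert by simp
  qed
  \<comment> \<open>Multiplicativity of \<open>L\<close> over \<open>R\<close> turns the value of
    \<open>N UNIV\<close> at a localized element into an integral close to
    \<open>N A (v A)\<close>.\<close>
  have N_act: "N UNIV (act (f A) (v A)) = (LINT x|\<nu>. f A x * L x (v A))" if "A \<in> \<pi>" for A
    using N_eq[OF actW[OF that], of UNIV] L_act[OF f(1) v(1), OF that that]
    by (simp add: set_lebesgue_integral_def)
  have "(\<Sum>A\<in>\<pi>. dual_norm W nrm (N A)) \<le> (\<Sum>A\<in>\<pi>. N UNIV (act (f A) (v A)) + 2 * \<delta>)"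
  proof (rule sum_mono)
    fix A assume A: "A \<in> \<pi>"
    show "dual_norm W nrm (N A) \<le> N UNIV (act (f A) (v A)) + 2 * \<delta>"
      using v(3)[OF A] f(4)[OF A] N_act[OF A] by linarith
  qed
  also have "\<dots> = N UNIV w + real n * (2 * \<delta>)"
    using Nsum[OF \<pi>(1) order_refl] by (simp add: weq sum.distrib n_def)
  also have "real n * (2 * \<delta>) = e" using n by (simp add: \<delta>_def)
  also have "N UNIV w \<le> dual_norm W nrm (N UNIV) * nrm w"
    using dual_norm_bound[OF dN normed_space_W wW] by simp
  also have "\<dots> \<le> dual_norm W nrm (N UNIV) * 1"
    by (intro mult_left_mono nw dual_norm_nonneg[OF dN normed_space_W])
  finally show "(\<Sum>A\<in>\<pi>. dual_norm W nrm (N A)) \<le> dual_norm W nrm (N UNIV) + e" by simp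
qed

lemma finite_measure_\<nu>: "finite_measure \<nu>"
proof (rule finite_measureI)
  have UNIV: "UNIV \<in> sets (borel :: 'a measure)" by simp
  have "emeasure \<nu> UNIV \<le> ennreal (dual_norm W nrm (N UNIV))"
    unfolding emeasure_\<nu>[of UNIV, OF UNIV] total_variation_def
  proof (rule SUP_least)
    fix \<pi> :: "'a set set" assume "\<pi> \<in> {\<pi>. finite \<pi> \<and> partition_on UNIV \<pi> \<and> \<pi> \<subseteq> sets borel}"
    then have \<pi>: "finite \<pi>" "partition_on UNIV \<pi>" "\<pi> \<subseteq> sets borel" by auto
    have "(\<Sum>A\<in>\<pi>. ennreal (dual_norm W nrm (N A))) = ennreal (\<Sum>A\<in>\<pi>. dual_norm W nrm (N A))"
      using \<pi>(3) dual_norm_nonneg[OF N_dual normed_space_W] by (intro sum_ennreal) auto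
    also have "\<dots> \<le> ennreal (dual_norm W nrm (N UNIV))"
      by (intro ennreal_leI sum_dual_norm_le \<pi>)
    finally show "(\<Sum>A\<in>\<pi>. ennreal (dual_norm W nrm (N A))) \<le> ennreal (dual_norm W nrm (N UNIV))" .
  qed
  then show "emeasure \<nu> (space \<nu>) \<noteq> \<infinity>" by (auto simp: infinity_ennreal_def top_unique)
qed

sublocale \<nu>: finite_measure \<nu>
  by (rule finite_measure_\<nu>)

text \<open>The exceptional set may depend on \<open>v\<close>: \<open>N A\<close> is estimated at
  one \<open>v\<close> at a time, and the supremum is taken afterwards. As \<open>\<nu>\<close> is
  finite, \<open>c < 1\<close> forces \<open>E\<close> to be null.\<close>

lemma measure_\<nu>_le_mult:
  assumes E: "E \<in> sets borel" and c: "0 \<le> c"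
    and le: "\<And>v. v \<in> W \<Longrightarrow> nrm v \<le> 1 \<Longrightarrow> AE x in \<nu>. x \<in> E \<longrightarrow> \<bar>L x v\<bar> \<le> c"
  shows "measure \<nu> E \<le> c * measure \<nu> E"
proof -
  have dn: "dual_norm W nrm (N A) \<le> c * measure \<nu> A" if A: "A \<in> sets borel" "A \<subseteq> E" for A
  proof (rule dual_norm_le[OF normed_space_W])
    fix v assume v: "v \<in> W" "nrm v \<le> 1"
    have iA: "integrable \<nu> (\<lambda>x. indicator A x * L x v)"
      using integrable_mult_indicator[OF _ L_int[OF v(1)], of A] A by simp
    have "\<bar>N A v\<bar> = \<bar>LINT x|\<nu>. indicator A x * L x v\<bar>"
      using N_eq[OF v(1) A(1)] by (simp add: set_lebesgue_integral_def)
    also have "\<dots> \<le> (LINT x|\<nu>. \<bar>indicator A x * L x v\<bar>)" by (rule integral_abs_bound)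
    also have "\<dots> \<le> (LINT x|\<nu>. c * indicator A x)"
    proof (rule integral_mono_AE)
      show "AE x in \<nu>. \<bar>indicator A x * L x v\<bar> \<le> c * indicator A x"
        using le[OF v] by eventually_elim (use A(2) in \<open>auto simp: indicator_def\<close>)
    qed (use iA A \<nu>.emeasure_finite[of A] in \<open>auto intro!: integrable_mult_right integrable_real_indicator simp: less_top[symmetric] infinity_ennreal_def\<close>)
    also have "\<dots> = c * measure \<nu> A" using A by simp
    finally show "\<bar>N A v\<bar> \<le> c * measure \<nu> A" .
  qed
  have "emeasure \<nu> E \<le> ennreal (c * measure \<nu> E)"
    unfolding emeasure_\<nu>[OF E] total_variation_def
  proof (rule SUP_least)
    fix \<pi> :: "'a set set" assume "\<pi> \<in> {\<pi>. finite \<pi> \<and> partition_on E \<pi> \<and> \<pi> \<subseteq> sets borel}"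
    then have \<pi>: "finite \<pi>" "partition_on E \<pi>" "\<pi> \<subseteq> sets borel" by auto
    have "(\<Sum>A\<in>\<pi>. ennreal (dual_norm W nrm (N A))) = ennreal (\<Sum>A\<in>\<pi>. dual_norm W nrm (N A))"
      using \<pi>(3) dual_norm_nonneg[OF N_dual normed_space_W] by (intro sum_ennreal) auto
    also have "\<dots> \<le> ennreal (\<Sum>A\<in>\<pi>. c * measure \<nu> A)"
      using \<pi> by (intro ennreal_leI sum_mono dn) (auto simp: partition_on_def)
    also have "(\<Sum>A\<in>\<pi>. c * measure \<nu> A) = c * measure \<nu> (\<Union>A\<in>\<pi>. A)"
      unfolding sum_distrib_left[symmetric] using \<pi>
      by (subst \<nu>.finite_measure_finite_Union)
        (auto simp: partition_on_def disjoint_def disjoint_family_on_def)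
    also have "(\<Union>A\<in>\<pi>. A) = E" using \<pi>(2) by (auto simp: partition_on_def)
    finally show "(\<Sum>A\<in>\<pi>. ennreal (dual_norm W nrm (N A))) \<le> ennreal (c * measure \<nu> E)" .
  qed
  then show ?thesis using c by (simp add: \<nu>.emeasure_eq_measure)
qed

end

section \<open>Construction of the module functional\<close>

context polar_local_vector_measure
begin

text \<open>Truncating at level \<open>1\<close> does not change \<open>v\<close> where \<open>c |v| \<le> 1\<close>, and the
  truncated element has norm at most \<open>1\<close>; strong locality transfers the bound to \<open>v\<close>.\<close>

lemma strongly_local_imp_L_le_pn:
  assumes sl: "strongly_local \<nu> pn W N"
    and trunc: "\<And>v. v \<in> W \<Longrightarrow> act (\<lambda>x. 1 / max 1 (pn v x)) v \<in> W"
    and v: "v \<in> W"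
  shows "AE x in \<nu>. \<bar>L x v\<bar> \<le> pn v x"
proof -
  \<comment> \<open>Rescaling \<open>v\<close> by \<open>c\<close> moves the truncation level to
    \<open>1 / c\<close>.\<close>
  have level: "AE x in \<nu>. c * pn v x \<le> 1 \<longrightarrow> c * \<bar>L x v\<bar> \<le> 1" if c: "0 < c" for c
  proof -
    let ?v = "c *\<^sub>R v"
    have vc: "?v \<in> W" by (rule subspace_scale[OF subspace_W v])
    define g where "g x = 1 / max 1 (pn ?v x)" for x
    have g01: "0 < g x" "g x \<le> 1" for x by (auto simp: g_def)
    have gL: "g \<in> Lp_space m \<infinity>"
      unfolding Linf_iff using g01 by (auto simp: g_def[abs_def] intro!: exI[of _ 1])
    define w where "w = act g ?v"
    have w: "w \<in> W" using trunc[OF vc] by (simp add: w_def g_def[abs_def])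
    have pw: "AE x in m. pn w x = g x * pn ?v x"
      unfolding w_def using pn_act[OF gL, of ?v] g01(1) by (auto simp: less_imp_le)
    have "nrm w \<le> 1"
    proof (rule sup_pn_le)
      show "AE x in m. pn w x \<le> 1"
        using pw by eventually_elim (simp add: g_def divide_le_eq)
    qed
    then have Lw: "\<bar>L x w\<bar> \<le> 1" for x using L_le[OF w, of x] by simp
    let ?u = "w - ?v"
    have u: "?u \<in> W" using subspace_diff[OF subspace_W w vc] .
    define B where "B = {x. pn ?v x \<le> 1}"
    have "{x \<in> space m. pn ?v x \<le> 1} \<in> sets m" by measurable
    then have B: "B \<in> sets borel" by (simp add: B_def)
    have "?u = act (\<lambda>x. g x - 1) ?v"
      using act_diff_left[OF gL const_Linf[of 1]] by (simp add: w_def)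
    then have "AE x in m. pn ?u x = \<bar>g x - 1\<bar> * pn ?v x"
      using pn_act[OF Linf_diff[OF gL const_Linf[of 1]], of ?v] by simp
    then have pu: "AE x in m. x \<in> B \<longrightarrow> pn ?u x = 0"
      by eventually_elim (auto simp: B_def g_def)
    \<comment> \<open>Strong locality is used on every Borel part of \<open>B\<close>: only then
      does the integrand \<open>L x ?u\<close> vanish a.e. on \<open>B\<close>.\<close>
    have N0: "N (A \<inter> B) ?u = 0" if "A \<in> sets borel" for A
    proof -
      have "AE x in \<nu>. x \<in> A \<inter> B \<longrightarrow> pn ?u x = 0"
        using AE_\<nu>[OF pu] by eventually_elim auto
      then show ?thesis using sl u that B by (auto simp: strongly_local_def)
    qed
    have "AE x in \<nu>. indicator B x * L x ?u = 0"
    proof (rule density_unique_real)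
      show "integrable \<nu> (\<lambda>x. indicator B x * L x ?u)"
        using integrable_mult_indicator[OF _ L_int[OF u], of B] B by simp
      fix A assume "A \<in> sets \<nu>"
      then have A: "A \<in> sets borel" by simp
      have "(LINT x:A|\<nu>. indicator B x * L x ?u) = N (A \<inter> B) ?u"
        using N_eq[OF u] A B
        by (simp add: set_lebesgue_integral_def indicator_inter_arith mult.assoc)
      then show "(LINT x:A|\<nu>. indicator B x * L x ?u) = (LINT x:A|\<nu>. 0)"
        using N0[OF A] by (simp add: set_lebesgue_integral_def)
    qed simp
    then show ?thesis using AE_\<nu>[OF pn_scale[of c v]]
    proof eventually_elim
      case (elim x)
      show ?case
      proof
        assume "c * pn v x \<le> 1"
        then have "x \<in> B" using elim(2) c by (simp add: B_def)
        then have "L x w = c * L x v" using elim(1) L_diff[OF w vc] L_scale[OF v] by simp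
        then show "c * \<bar>L x v\<bar> \<le> 1" using Lw[of x] c by (simp add: abs_mult)
      qed
    qed
  qed
  have "AE x in \<nu>. \<forall>c\<in>{c \<in> \<rat>. 0 < c}. c * pn v x \<le> 1 \<longrightarrow> c * \<bar>L x v\<bar> \<le> 1"
    using level by (subst AE_ball_countable[OF countable_Collect[OF countable_rat]]) auto
  with AE_\<nu>[OF pn_nonneg[of v]] show ?thesis
  proof eventually_elim
    case (elim x)
    show ?case
    proof (rule ccontr)
      assume "\<not> \<bar>L x v\<bar> \<le> pn v x"
      then have lt: "pn v x < \<bar>L x v\<bar>" by simp
      obtain a where a: "pn v x < a" "a < \<bar>L x v\<bar>" using dense[OF lt] by auto
      have pos: "0 < a" "0 < \<bar>L x v\<bar>" using a elim(1) by auto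
      \<comment> \<open>A rational \<open>c\<close> with \<open>1 / c\<close> strictly between
        \<open>pn v x\<close> and \<open>\<bar>L x v\<bar>\<close> contradicts the statement at that
        level.\<close>
      have "1 / \<bar>L x v\<bar> < 1 / a" using a pos by (simp add: field_simps)
      then obtain c where c: "c \<in> \<rat>" "1 / \<bar>L x v\<bar> < c" "c < 1 / a"
        using Rats_dense_in_real by blast
      have c0: "0 < c" using c(2) pos by (meson less_trans zero_less_divide_1_iff)
      have "c * pn v x \<le> c * a" using a c0 by simp
      also have "\<dots> \<le> 1" using c(3) pos by (simp add: field_simps)
      finally have "c * \<bar>L x v\<bar> \<le> 1" using elim(2) c(1) c0 by auto
      then show False using c(2) pos by (simp add: field_simps)
    qed
  qed
qed

lemma W_pn_dense:
  obtains C where "countable C" "C \<subseteq> W" "AE x in m. \<forall>\<epsilon>>0. \<exists>w\<in>C. pn (v - w) x < \<epsilon>"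
  using generates_imp_pn_dense[OF gen subspace_W] .

text \<open>The value at \<open>v\<close> of the extension is a McShane-type supremum over a pointwise dense
  sequence of \<open>W\<close>.\<close>

lemma extension_value:
  assumes le: "\<And>w. w \<in> W \<Longrightarrow> AE x in \<nu>. \<bar>L x w\<bar> \<le> pn w x"
  shows "\<exists>g\<in>borel_measurable borel. \<forall>w\<in>W. AE x in \<nu>. \<bar>g x - L x w\<bar> \<le> pn (v - w) x"
proof -
  obtain C where C: "countable C" "C \<subseteq> W" "AE x in m. \<forall>\<epsilon>>0. \<exists>w\<in>C. pn (v - w) x < \<epsilon>"
    by (rule W_pn_dense)
  \<comment> \<open>In \<open>ereal\<close> the supremum exists at every \<open>x\<close>; that it
    is finite is shown only a.e.\<close>
  define G where "G x = (SUP c\<in>C. ereal (L x c - pn (v - c) x))" for x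
  define g where "g x = real_of_ereal (G x)" for x
  have "pn u \<in> borel_measurable borel" for u
    using pn_meas[of u] measurable_cong_sets[OF sets_m refl] by blast
  then have "g \<in> borel_measurable borel"
    unfolding g_def[abs_def] G_def using C(1,2)
    by (intro borel_measurable_real_of_ereal borel_measurable_SUP borel_measurable_ereal
        borel_measurable_diff L_meas) auto
  moreover have "AE x in \<nu>. \<bar>g x - L x w\<bar> \<le> pn (v - w) x" if w: "w \<in> W" for w
  proof -
    have "AE x in \<nu>. \<forall>c\<in>C. \<bar>L x c - L x w\<bar> \<le> pn (c - w) x"
      using le C(1,2) L_diff[OF _ w] subspace_diff[OF subspace_W _ w]
      by (subst AE_ball_countable) (auto simp flip: L_diff[OF _ w])
    moreover have "AE x in \<nu>. \<forall>c\<in>C. pn (c - w) x \<le> pn (v - c) x + pn (v - w) x"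
    proof (subst AE_ball_countable[OF C(1)], intro ballI AE_\<nu>)
      fix c
      show "AE x in m. pn (c - w) x \<le> pn (v - c) x + pn (v - w) x"
        using pn_triangle[of c w v] pn_minus_commute[of c v] by eventually_elim simp
    qed
    moreover note AE_\<nu>[OF C(3)]
    ultimately show ?thesis
    proof eventually_elim
      case (elim x)
      have up: "L x c - pn (v - c) x \<le> L x w + pn (v - w) x" if "c \<in> C" for c
        using elim(1,2)[rule_format, OF that] by linarith
      have le: "G x \<le> ereal (L x w + pn (v - w) x)"
        unfolding G_def using up by (intro SUP_least) auto
      \<comment> \<open>An approximant \<open>c\<close> of \<open>v\<close> costs
        \<open>pn (v - c) x\<close> twice, once through \<open>L x c\<close> and once in the
        subtracted term.\<close>
      have low: "ereal (L x w - pn (v - w) x - 2 * \<epsilon>) \<le> G x" if e: "0 < \<epsilon>" for \<epsilon>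
      proof -
        obtain c where c: "c \<in> C" "pn (v - c) x < \<epsilon>" using elim(3) e by blast
        have "L x w - pn (v - w) x - 2 * \<epsilon> \<le> L x c - pn (v - c) x"
          using elim(1,2)[rule_format, OF c(1)] c(2) by linarith
        then show ?thesis unfolding G_def using c(1) by (intro SUP_upper2[of c]) auto
      qed
      obtain r where r: "G x = ereal r" using le low[of 1] by (cases "G x") auto
      have "L x w - pn (v - w) x \<le> r + \<epsilon>" if "0 < \<epsilon>" for \<epsilon>
        using low[of "\<epsilon> / 2"] that r by simp
      then have "L x w - pn (v - w) x \<le> r" by (rule field_le_epsilon)
      then show ?case using le r by (simp add: g_def abs_le_iff)
    qed
  qed
  ultimately show ?thesis by blast
qed

text \<open>\<open>P\<close> will be where the density of \<open>\<nu>\<close> is positive, intersected with a set of finite measure when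
  global integrability is needed.\<close>

lemma extension_exists:
  assumes le: "\<And>w. w \<in> W \<Longrightarrow> AE x in \<nu>. \<bar>L x w\<bar> \<le> pn w x"
    and P: "P \<in> sets borel" "AE x in \<nu>. x \<in> P"
    and transfer: "\<And>Q. AE x in \<nu>. Q x \<Longrightarrow> AE x in m. x \<in> P \<longrightarrow> Q x"
  obtains M where "\<And>v. M v \<in> borel_measurable borel" "\<And>v x. x \<notin> P \<Longrightarrow> M v x = 0"
    "\<And>v. AE x in m. \<bar>M v x\<bar> \<le> pn v x"
    "\<And>v w. AE x in m. M (v + w) x = M v x + M w x"
    "\<And>f v. f \<in> Lp_space m \<infinity> \<Longrightarrow> AE x in m. M (act f v) x = f x * M v x"
    "represents m pn W \<nu> L M"
proof -
  define G where "G v g \<longleftrightarrow> g \<in> borel_measurable borel \<and> (\<forall>w\<in>W. AE x in \<nu>. \<bar>g x - L x w\<bar> \<le> pn (v - w) x)"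
    for v g
  have "\<forall>v. \<exists>g. G v g"
    unfolding G_def using extension_value[OF le] by (simp add: Bex_def)
  from choice[OF this] obtain g where G: "\<forall>v. G v (g v)" ..
  have g: "g v \<in> borel_measurable borel" "w \<in> W \<Longrightarrow> AE x in \<nu>. \<bar>g v x - L x w\<bar> \<le> pn (v - w) x" for v w
    using G[rule_format, of v] by (simp_all add: G_def)
  have gL: "AE x in \<nu>. g w x = L x w" if "w \<in> W" for w
    using g(2)[OF that, of w] AE_\<nu>[OF pn_zero] by eventually_elim auto
  have g_le: "AE x in \<nu>. \<bar>g v x\<bar> \<le> pn v x" for v
  proof -
    have 0: "0 \<in> W" using subspace_0[OF subspace_W] .
    have "L x 0 = 0" for x using L_scale[OF 0, of x 0] by simp
    then show ?thesis using g(2)[OF 0, of v] by simp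
  qed
  \<comment> \<open>\<open>L x (c + d)\<close> is close to both sides once \<open>c\<close> and
    \<open>d\<close> approximate \<open>v\<close> and \<open>w\<close> at \<open>x\<close>.\<close>
  have g_add: "AE x in \<nu>. g (v + w) x = g v x + g w x" for v w
  proof -
    obtain C where C: "countable C" "C \<subseteq> W" "AE x in m. \<forall>\<epsilon>>0. \<exists>c\<in>C. pn (v - c) x < \<epsilon>"
      by (rule W_pn_dense)
    obtain D where D: "countable D" "D \<subseteq> W" "AE x in m. \<forall>\<epsilon>>0. \<exists>d\<in>D. pn (w - d) x < \<epsilon>"
      by (rule W_pn_dense)
    have "AE x in \<nu>. \<forall>c\<in>C. \<bar>g v x - L x c\<bar> \<le> pn (v - c) x"
      using g(2) C(2) by (subst AE_ball_countable[OF C(1)]) auto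
    moreover have "AE x in \<nu>. \<forall>d\<in>D. \<bar>g w x - L x d\<bar> \<le> pn (w - d) x"
      using g(2) D(2) by (subst AE_ball_countable[OF D(1)]) auto
    moreover have "AE x in \<nu>. \<forall>c\<in>C. \<forall>d\<in>D. \<bar>g (v + w) x - (L x c + L x d)\<bar> \<le> pn (v - c) x + pn (w - d) x"
    proof (subst AE_ball_countable[OF C(1)], intro ballI, subst AE_ball_countable[OF D(1)], intro ballI)
      fix c d assume cd: "c \<in> C" "d \<in> D"
      then have W: "c \<in> W" "d \<in> W" "c + d \<in> W" using C(2) D(2) subspace_add[OF subspace_W] by auto
      have "AE x in m. pn (v + w - (c + d)) x \<le> pn (v - c) x + pn (w - d) x"
        using pn_add_le[of "v - c" "w - d"] by (simp add: algebra_simps)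
      then show "AE x in \<nu>. \<bar>g (v + w) x - (L x c + L x d)\<bar> \<le> pn (v - c) x + pn (w - d) x"
        using g(2)[OF W(3), of "v + w"] L_add[OF W(1,2)]
        by (auto dest!: AE_\<nu> elim: eventually_elim2)
    qed
    moreover note AE_\<nu>[OF C(3)] AE_\<nu>[OF D(3)]
    ultimately show ?thesis
    proof eventually_elim
      case (elim x)
      have "\<bar>g (v + w) x - (g v x + g w x)\<bar> \<le> 0 + \<epsilon>" if e: "0 < \<epsilon>" for \<epsilon>
      proof -
        obtain c d where cd: "c \<in> C" "pn (v - c) x < \<epsilon> / 4" "d \<in> D" "pn (w - d) x < \<epsilon> / 4"
          using elim(4,5) e by (meson zero_less_divide_iff zero_less_numeral)
        show ?thesis using elim(1)[rule_format, OF cd(1)] elim(2)[rule_format, OF cd(3)]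
          elim(3)[rule_format, OF cd(1,3)] cd(2,4) by linarith
      qed
      then have "\<bar>g (v + w) x - (g v x + g w x)\<bar> \<le> 0" by (rule field_le_epsilon)
      then show ?case by simp
    qed
  qed
  have g_act: "AE x in \<nu>. g (act f v) x = f x * g v x" if f: "f \<in> Lp_space m \<infinity>" for f v
  proof -
    obtain C where C: "countable C" "C \<subseteq> W" "AE x in m. \<forall>\<epsilon>>0. \<exists>c\<in>C. pn (v - c) x < \<epsilon>"
      by (rule W_pn_dense)
    have "AE x in \<nu>. \<forall>c\<in>C. \<bar>g v x - L x c\<bar> \<le> pn (v - c) x"
      using g(2) C(2) by (subst AE_ball_countable[OF C(1)]) auto
    \<comment> \<open>\<open>W\<close> need not be stable under multiplication by \<open>f\<close>.
      So a rational constant \<open>q\<close> near \<open>f x\<close> takes its place, and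
      \<open>act f v\<close> is compared with \<open>q *\<^sub>R c\<close>.\<close>
    moreover have "AE x in \<nu>. \<forall>c\<in>C. \<forall>q\<in>\<rat>. \<bar>g (act f v) x - q * L x c\<bar> \<le> \<bar>f x - q\<bar> * pn v x + \<bar>q\<bar> * pn (v - c) x"
    proof (subst AE_ball_countable[OF C(1)], intro ballI, subst AE_ball_countable[OF countable_rat], intro ballI)
      fix c q assume c: "c \<in> C"
      then have W: "c \<in> W" "q *\<^sub>R c \<in> W" using C(2) subspace_scale[OF subspace_W] by auto
      have "act f v - q *\<^sub>R c = act (\<lambda>x. f x - q) v + q *\<^sub>R (v - c)"
        using act_diff_left[OF f const_Linf[of q], of v] by (simp add: act_const algebra_simps)
      then have "AE x in m. pn (act f v - q *\<^sub>R c) x \<le> pn (act (\<lambda>x. f x - q) v) x + pn (q *\<^sub>R (v - c)) x"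
        using pn_add_le[of "act (\<lambda>x. f x - q) v" "q *\<^sub>R (v - c)"] by simp
      then have "AE x in m. pn (act f v - q *\<^sub>R c) x \<le> \<bar>f x - q\<bar> * pn v x + \<bar>q\<bar> * pn (v - c) x"
        using pn_act[OF Linf_diff[OF f const_Linf[of q]], of v] pn_scale[of q "v - c"]
        by eventually_elim simp
      from AE_\<nu>[OF this]
      show "AE x in \<nu>. \<bar>g (act f v) x - q * L x c\<bar> \<le> \<bar>f x - q\<bar> * pn v x + \<bar>q\<bar> * pn (v - c) x"
        using g(2)[OF W(2), of "act f v"] by eventually_elim (use L_scale[OF W(1)] in simp)
    qed
    moreover note g_le[of v] AE_\<nu>[OF C(3)]
    ultimately show ?thesis
    proof eventually_elim
      case (elim x)
      have pv: "0 \<le> pn v x" using elim(3) by linarith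
      have "\<bar>g (act f v) x - f x * g v x\<bar> \<le> 0 + \<epsilon>" if e: "0 < \<epsilon>" for \<epsilon>
      proof -
        let ?d = "\<epsilon> / (4 * (pn v x + 1))"
        have d: "0 < ?d" using e pv by simp
        then obtain q where q: "q \<in> \<rat>" "f x < q" "q < f x + ?d"
          using Rats_dense_in_real[of "f x" "f x + ?d"] by auto
        have "0 < \<epsilon> / (4 * (\<bar>q\<bar> + 1))" using e by simp
        then obtain c where c: "c \<in> C" "pn (v - c) x < \<epsilon> / (4 * (\<bar>q\<bar> + 1))" using elim(4) by blast
        have 1: "\<bar>f x - q\<bar> * pn v x \<le> \<epsilon> / 4"
        proof -
          have "\<bar>f x - q\<bar> * pn v x \<le> ?d * (pn v x + 1)" using q pv by (intro mult_mono) auto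
          also have "\<dots> = \<epsilon> / 4" using pv by (simp add: field_simps)
          finally show ?thesis .
        qed
        have 2: "\<bar>q\<bar> * pn (v - c) x \<le> \<epsilon> / 4"
        proof -
          have "\<bar>q\<bar> * pn (v - c) x \<le> \<bar>q\<bar> * (\<epsilon> / (4 * (\<bar>q\<bar> + 1)))" using c by (intro mult_left_mono) auto
          also have "\<dots> \<le> \<epsilon> / 4" using e by (simp add: field_simps)
          finally show ?thesis .
        qed
        have 3: "\<bar>q * L x c - q * g v x\<bar> \<le> \<bar>q\<bar> * pn (v - c) x"
          using mult_left_mono[OF elim(1)[rule_format, OF c(1)] abs_ge_zero[of q]]
          by (simp add: abs_minus_commute flip: abs_mult right_diff_distrib)
        have 4: "\<bar>q * g v x - f x * g v x\<bar> \<le> \<bar>f x - q\<bar> * pn v x"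
          using mult_left_mono[OF elim(3) abs_ge_zero[of "f x - q"]]
          by (simp add: abs_minus_commute flip: abs_mult left_diff_distrib)
        show ?thesis using elim(2)[rule_format, OF c(1) q(1)] 1 2 3 4 by linarith
      qed
      then have "\<bar>g (act f v) x - f x * g v x\<bar> \<le> 0" by (rule field_le_epsilon)
      then show ?case by simp
    qed
  qed
  \<comment> \<open>Off \<open>P\<close> nothing is known about \<open>g v\<close>, as
    \<open>\<nu>\<close> does not charge that set; the cut-off turns relations holding
    \<open>\<nu>\<close>-a.e. into relations holding \<open>m\<close>-a.e.\<close>
  define M where "M v x = indicator P x * g v x" for v x
  have M_meas: "M v \<in> borel_measurable borel" for v
    unfolding M_def[abs_def] using P(1) g(1) by measurable
  have M_le: "AE x in m. \<bar>M v x\<bar> \<le> pn v x" for v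
    using transfer[OF g_le] pn_nonneg[of v] by eventually_elim (auto simp: M_def indicator_def)
  have L_M: "AE x in \<nu>. L x w = M w x" if "w \<in> W" for w
    using gL[OF that] P(2) by eventually_elim (simp add: M_def)
  \<comment> \<open>\<open>dual_pn\<close> is an arbitrarily chosen essential supremum, so it is
    reached by uniqueness: \<open>indicator P\<close> is shown to be another one.\<close>
  have "is_ess_Sup m {\<lambda>x. ennreal \<bar>M v x\<bar> |v. AE x in m. pn v x \<le> 1} (indicator P)"
    unfolding is_ess_Sup_def
  proof (intro conjI ballI impI)
    show "indicator P \<in> borel_measurable m" using P(1) by measurable
    fix f assume "f \<in> {\<lambda>x. ennreal \<bar>M v x\<bar> |v. AE x in m. pn v x \<le> 1}"
    then obtain v where v: "f = (\<lambda>x. ennreal \<bar>M v x\<bar>)" "AE x in m. pn v x \<le> 1" by auto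
    show "AE x in m. f x \<le> indicator P x"
      using M_le[of v] v(2) by eventually_elim (auto simp: v(1) M_def indicator_def)
  next
    fix h :: "'a \<Rightarrow> ennreal"
    assume h: "h \<in> borel_measurable m"
      and *: "\<forall>f\<in>{\<lambda>x. ennreal \<bar>M v x\<bar> |v. AE x in m. pn v x \<le> 1}. AE x in m. f x \<le> h x"
    have null: "AE x in \<nu>. \<not> h x \<le> ennreal c" if c: "0 \<le> c" "c < 1" for c
    proof -
      let ?E = "{x. h x \<le> ennreal c}"
      have "{x \<in> space m. h x \<le> ennreal c} \<in> sets m" using h by measurable
      then have E: "?E \<in> sets borel" by simp
      have "measure \<nu> ?E \<le> c * measure \<nu> ?E"
      proof (rule measure_\<nu>_le_mult[OF E c(1)])
        fix v assume v: "v \<in> W" "nrm v \<le> 1"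
        have "AE x in m. pn v x \<le> 1"
          using sup_pn_AE[OF subsetD[OF W_V v(1)]] by eventually_elim (use v(2) in simp)
        then have "(\<lambda>x. ennreal \<bar>M v x\<bar>) \<in> {\<lambda>x. ennreal \<bar>M v x\<bar> |v. AE x in m. pn v x \<le> 1}" by blast
        then have "AE x in m. ennreal \<bar>M v x\<bar> \<le> h x" by (rule bspec[OF *])
        from AE_\<nu>[OF this] L_M[OF v(1)] show "AE x in \<nu>. x \<in> ?E \<longrightarrow> \<bar>L x v\<bar> \<le> c"
        proof eventually_elim
          case (elim x)
          show ?case
          proof
            assume "x \<in> ?E"
            then have "ennreal \<bar>M v x\<bar> \<le> ennreal c" using elim(1) by auto
            then show "\<bar>L x v\<bar> \<le> c" using elim(2) c(1) by (simp add: ennreal_le_iff)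
          qed
        qed
      qed
      then have "measure \<nu> ?E = 0"
        using c(2) measure_nonneg[of \<nu> ?E] mult_right_le_one_le[of "measure \<nu> ?E" c] c(1)
        by (cases "measure \<nu> ?E = 0") (auto simp: mult_le_cancel_right1)
      then have "?E \<in> null_sets \<nu>" using E by (auto simp: \<nu>.emeasure_eq_measure)
      from AE_not_in[OF this] show ?thesis by simp
    qed
    have "AE x in \<nu>. \<forall>n::nat. \<not> h x \<le> ennreal (1 - 1 / Suc n)"
      using null by (subst AE_all_countable) auto
    then have "AE x in \<nu>. 1 \<le> h x"
    proof eventually_elim
      case (elim x)
      have "(\<lambda>n. ennreal (1 - 1 / Suc n)) \<longlonglongrightarrow> ennreal (1 - 0)"
        by (intro tendsto_ennrealI tendsto_diff tendsto_const lim_1_over_n[THEN LIMSEQ_Suc])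
      then show ?case using elim
        by (intro LIMSEQ_le_const2[of "\<lambda>n. ennreal (1 - 1 / Suc n)" 1]) (auto simp: not_le intro: less_imp_le)
    qed
    from transfer[OF this] show "AE x in m. indicator P x \<le> h x"
      by eventually_elim (auto simp: indicator_def)
  qed
  moreover have "is_ess_Sup m {\<lambda>x. ennreal \<bar>M v x\<bar> |v. AE x in m. pn v x \<le> 1} (dual_pn m pn M)"
    unfolding dual_pn_def
  proof (rule is_ess_Sup_ess_Sup[OF sigma_finite], rule subsetI)
    fix f assume "f \<in> {\<lambda>x. ennreal \<bar>M v x\<bar> |v. AE x in m. pn v x \<le> 1}"
    then obtain v where "f = (\<lambda>x. ennreal \<bar>M v x\<bar>)" by auto
    then show "f \<in> borel_measurable m"
      using M_meas[of v] measurable_cong_sets[OF sets_m refl] by auto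
  qed
  ultimately have "AE x in m. indicator P x = dual_pn m pn M x" by (rule is_ess_Sup_AE_unique)
  from AE_\<nu>[OF this] P(2) have "AE x in \<nu>. dual_pn m pn M x = 1"
    by eventually_elim (metis indicator_simps(1))
  then have "represents m pn W \<nu> L M" using L_M by (simp add: represents_def)
  moreover have "AE x in m. M (v + w) x = M v x + M w x" for v w
    using transfer[OF g_add[of v w]] by eventually_elim (auto simp: M_def indicator_def)
  moreover have "AE x in m. M (act f v) x = f x * M v x" if "f \<in> Lp_space m \<infinity>" for f v
    using transfer[OF g_act[OF that, of v]] by eventually_elim (auto simp: M_def indicator_def)
  ultimately show thesis using M_meas M_le by (intro that[of M]) (auto simp: M_def[abs_def])
qed

end

section \<open>Elements of the local dual and strongly local measures\<close>

context Lp_normed_module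
begin

text \<open>As \<open>\<bar>M v x\<bar> \<le> pn v x\<close> a.e., continuity into L^1 follows once
  the integral of \<open>pn u\<close> over \<open>E\<close> is bounded by a multiple of
  \<open>norm u\<close>. Both sources of such a bound, finite measure of \<open>E\<close> and
  \<open>p = 1\<close>, feed into this.\<close>

lemma module_dual_cutoff:
  assumes E: "E \<in> sets borel"
    and int: "\<And>u. integrable m (\<lambda>x. indicator E x * pn u x)"
    and C: "\<And>u. (\<integral>x. indicator E x * pn u x \<partial>m) \<le> C * norm u"
    and meas: "\<And>v. M v \<in> borel_measurable borel"
    and le: "\<And>v. AE x in m. \<bar>M v x\<bar> \<le> pn v x"
    and add: "\<And>v w. AE x in m. M (v + w) x = M v x + M w x"
    and act: "\<And>f v. f \<in> Lp_space m \<infinity> \<Longrightarrow> AE x in m. M (act f v) x = f x * M v x"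
  shows "(\<lambda>v x. indicator E x * M v x) \<in> module_dual m act"
proof -
  have M_meas: "(\<lambda>x. indicator E x * M v x) \<in> borel_measurable m" for v
    using meas[of v] E
    by (subst measurable_cong_sets[OF sets_m refl]) (intro borel_measurable_times borel_measurable_indicator)
  have M_int: "integrable m (\<lambda>x. indicator E x * M v x)" for v
  proof (rule Bochner_Integration.integrable_bound[OF int[of v] M_meas])
    show "AE x in m. norm (indicator E x * M v x) \<le> norm (indicator E x * pn v x)"
      using le[of v] by eventually_elim (auto simp: indicator_def)
  qed
  have lim: "(\<lambda>n. \<integral>x. \<bar>indicator E x * M (u n) x - indicator E x * M v x\<bar> \<partial>m) \<longlonglongrightarrow> 0"
    if u: "u \<longlonglongrightarrow> v" for u :: "nat \<Rightarrow> 'm" and v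
  proof (rule tendsto_sandwich[where f = "\<lambda>_. 0" and h = "\<lambda>n. C * norm (u n - v)"])
    have "(\<integral>x. \<bar>indicator E x * M (u n) x - indicator E x * M v x\<bar> \<partial>m) \<le> C * norm (u n - v)" for n
    proof -
      have "(\<integral>x. \<bar>indicator E x * M (u n) x - indicator E x * M v x\<bar> \<partial>m)
          \<le> (\<integral>x. indicator E x * pn (u n - v) x \<partial>m)"
      proof (rule integral_mono_AE)
        show "AE x in m. \<bar>indicator E x * M (u n) x - indicator E x * M v x\<bar> \<le> indicator E x * pn (u n - v) x"
          using add[of "u n - v" v] le[of "u n - v"] by eventually_elim (auto simp: indicator_def)
      qed (intro integrable_abs Bochner_Integration.integrable_diff M_int int)+
      also note C
      finally show ?thesis .
    qed
    then show "\<forall>\<^sub>F n in sequentially. (\<integral>x. \<bar>indicator E x * M (u n) x - indicator E x * M v x\<bar> \<partial>m) \<le> C * norm (u n - v)"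
      by simp
    show "(\<lambda>n. C * norm (u n - v)) \<longlonglongrightarrow> 0" using u by (auto intro!: tendsto_eq_intros)
  qed auto
  have "AE x in m. indicator E x * M (v + w) x = indicator E x * M v x + indicator E x * M w x" for v w
    using add[of v w] by eventually_elim (simp add: algebra_simps)
  moreover have "AE x in m. indicator E x * M (act f v) x = f x * (indicator E x * M v x)"
    if "f \<in> Lp_space m \<infinity>" for f v
    using act[OF that, of v] by eventually_elim simp
  ultimately show ?thesis unfolding module_dual_def using M_int lim by auto
qed

text \<open>Membership in the local dual concerns cut-offs to bounded sets. Countably many balls
  cover the space, so measurability passes to the pointwise limit, and identities known a.e. on each
  ball hold a.e.\<close>

lemma
  assumes M: "M \<in> local_module_dual m act"
  shows local_dual_meas: "M v \<in> borel_measurable borel"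
    and local_dual_add: "AE x in m. M (v + w) x = M v x + M w x"
    and local_dual_act: "f \<in> Lp_space m \<infinity> \<Longrightarrow> AE x in m. M (act f v) x = f x * M v x"
proof -
  let ?B = "\<lambda>n::nat. ball (undefined::'a) (real n)"
  have D: "(\<lambda>v x. indicator (?B n) x * M v x) \<in> module_dual m act" for n
    using M by (auto simp: local_module_dual_def)
  have in_ball: "\<exists>n. x \<in> ?B n" for x using UN_balls[of undefined] by blast
  show "M v \<in> borel_measurable borel"
  proof (rule borel_measurable_LIMSEQ_real)
    show "(\<lambda>x. indicator (?B n) x * M v x) \<in> borel_measurable borel" for n
      using D[of n] measurable_cong_sets[OF sets_m refl] by (auto simp: module_dual_def)
    fix x
    obtain N where N: "x \<in> ?B N" using in_ball by blast
    have "\<forall>\<^sub>F n in sequentially. indicator (?B n) x * M v x = M v x"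
      using eventually_ge_at_top[of N]
    proof eventually_elim
      case (elim n)
      then have "x \<in> ?B n" using N by auto
      then show ?case by simp
    qed
    then show "(\<lambda>n. indicator (?B n) x * M v x) \<longlonglongrightarrow> M v x" by (rule tendsto_eventually)
  qed
  have "AE x in m. \<forall>n. indicator (?B n) x * M (v + w) x = indicator (?B n) x * M v x + indicator (?B n) x * M w x"
    using D unfolding AE_all_countable module_dual_def by blast
  then show "AE x in m. M (v + w) x = M v x + M w x"
  proof eventually_elim
    case (elim x)
    obtain n where "x \<in> ?B n" using in_ball by blast
    then show ?case using elim[rule_format, of n] by simp
  qed
  assume f: "f \<in> Lp_space m \<infinity>"
  have "AE x in m. \<forall>n. indicator (?B n) x * M (act f v) x = f x * (indicator (?B n) x * M v x)"
    using D f unfolding AE_all_countable module_dual_def by blast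
  then show "AE x in m. M (act f v) x = f x * M v x"
  proof eventually_elim
    case (elim x)
    obtain n where "x \<in> ?B n" using in_ball by blast
    then show ?case using elim[rule_format, of n] by simp
  qed
qed

text \<open>\<open>dual_pn\<close> tests only elements of pointwise norm at most \<open>1\<close>. A
  general \<open>v\<close> is cut off to \<open>{x. pn v x \<le> c}\<close> and divided by the
  constant \<open>c\<close>; running through rational \<open>c\<close> avoids dividing by
  \<open>pn v\<close>, which may vanish.\<close>

lemma local_dual_le_pn:
  assumes M: "M \<in> local_module_dual m act"
    and ac: "absolutely_continuous m \<mu>" "sets \<mu> = sets borel"
    and one: "AE x in \<mu>. dual_pn m pn M x = 1"
  shows "AE x in \<mu>. \<bar>M v x\<bar> \<le> pn v x"
proof -
  have AE_\<mu>: "AE x in m. P x \<Longrightarrow> AE x in \<mu>. P x" for P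
    using absolutely_continuous_AE[OF _ ac(1)] ac(2) by simp
  have ess: "is_ess_Sup m {\<lambda>x. ennreal \<bar>M v x\<bar> |v. AE x in m. pn v x \<le> 1} (dual_pn m pn M)"
    unfolding dual_pn_def
  proof (rule is_ess_Sup_ess_Sup[OF sigma_finite], rule subsetI)
    fix f assume "f \<in> {\<lambda>x. ennreal \<bar>M v x\<bar> |v. AE x in m. pn v x \<le> 1}"
    then obtain v where "f = (\<lambda>x. ennreal \<bar>M v x\<bar>)" by auto
    then show "f \<in> borel_measurable m"
      using local_dual_meas[OF M, of v] measurable_cong_sets[OF sets_m refl] by auto
  qed
  have unit: "AE x in \<mu>. \<bar>M u x\<bar> \<le> 1" if "AE x in m. pn u x \<le> 1" for u
  proof -
    have "(\<lambda>x. ennreal \<bar>M u x\<bar>) \<in> {\<lambda>x. ennreal \<bar>M v x\<bar> |v. AE x in m. pn v x \<le> 1}"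
      using that by blast
    moreover have "\<forall>f\<in>{\<lambda>x. ennreal \<bar>M v x\<bar> |v. AE x in m. pn v x \<le> 1}. AE x in m. f x \<le> dual_pn m pn M x"
      by (rule conjunct1[OF conjunct2[OF ess[unfolded is_ess_Sup_def]]])
    ultimately have "AE x in m. ennreal \<bar>M u x\<bar> \<le> dual_pn m pn M x" by (rule bspec[rotated])
    from AE_\<mu>[OF this] one show ?thesis
      by eventually_elim (simp flip: ennreal_1)
  qed
  have level: "AE x in \<mu>. pn v x \<le> c \<longrightarrow> \<bar>M v x\<bar> \<le> c" if c: "0 < c" for c
  proof -
    define S where "S = {x. pn v x \<le> c}"
    have "{x \<in> space m. pn v x \<le> c} \<in> sets m" by measurable
    then have S: "S \<in> sets borel" by (simp add: S_def)
    define f where "f x = 1 / c * indicat_real S x" for x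
    have f: "f \<in> Lp_space m \<infinity>"
      unfolding f_def[abs_def] by (intro Linf_mult const_Linf indicator_Linf S)
    have "AE x in m. pn (act f v) x \<le> 1"
      using pn_act[OF f, of v] by eventually_elim (use c in \<open>auto simp: f_def S_def indicator_def\<close>)
    from unit[OF this] AE_\<mu>[OF local_dual_act[OF M f, of v]] show ?thesis
      by eventually_elim (use c in \<open>auto simp: f_def S_def abs_mult\<close>)
  qed
  have "AE x in \<mu>. \<forall>c\<in>{c \<in> \<rat>. 0 < c}. pn v x \<le> c \<longrightarrow> \<bar>M v x\<bar> \<le> c"
    using level by (subst AE_ball_countable[OF countable_Collect[OF countable_rat]]) auto
  with AE_\<mu>[OF pn_nonneg[of v]] show ?thesis
  proof eventually_elim
    case (elim x)
    show ?case
    proof (rule ccontr)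
      assume "\<not> \<bar>M v x\<bar> \<le> pn v x"
      then obtain c where "c \<in> \<rat>" "pn v x < c" "c < \<bar>M v x\<bar>"
        using Rats_dense_in_real[of "pn v x" "\<bar>M v x\<bar>"] by auto
      then show False using elim(1) elim(2)[rule_format, of c] by auto
    qed
  qed
qed

text \<open>A zero seminorm means \<open>act f v = 0\<close> for all admissible \<open>f\<close>,
  hence \<open>pn v = 0\<close> a.e. where \<open>f\<close> is nonzero; countably many such sets
  cover \<open>A\<close>.\<close>

lemma local_seminorm_zero_imp:
  assumes A: "open A" and v: "v \<in> V" and zero: "local_seminorm bcontfun nrm act A v = 0"
  shows "AE x in m. x \<in> A \<longrightarrow> pn v x = 0"
proof -
  have zb: "(\<lambda>x::'a. 0::real) \<in> bcontfun" by (auto simp: bcontfun_def)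
  have f0: "AE x in m. f x \<noteq> 0 \<longrightarrow> pn v x = 0"
    if f: "f \<in> bcontfun" "supp f \<subseteq> A" "\<And>x. \<bar>f x\<bar> \<le> 1" for f
  proof -
    have L: "f \<in> Lp_space m \<infinity>" by (rule bcontfun_Linf[OF f(1)])
    have "nrm (act f v) \<le> 0"
      using local_seminorm_upper[OF order_refl zb v f(1,2) sup_norm_le[OF f(3)]] zero by simp
    then have z: "act f v = 0" by (rule sup_pn_eq_0[OF V_act[OF L v]])
    show ?thesis using pn_act[OF L, of v] pn_zero by eventually_elim (use z in auto)
  qed
  show ?thesis
  proof (cases "A = UNIV")
    \<comment> \<open>Treated apart because the distance to the empty set is \<open>0\<close> by
      convention.\<close>
    case True
    show ?thesis using f0[of "\<lambda>x. 1"] True by (simp add: bcontfun_def)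
  next
    case False
    \<comment> \<open>Subtracting \<open>1\<close> keeps the support in the closed set
      \<open>{x. 1 \<le> real k * infdist x (- A)}\<close> and so inside \<open>A\<close>.\<close>
    define f where "f k x = min 1 (max 0 (real k * infdist x (- A) - 1))" for k x
    have "f k \<in> bcontfun" for k
      unfolding bcontfun_def f_def[abs_def]
      by (auto intro!: continuous_intros boundedI[of _ 1])
    moreover have "supp (f k) \<subseteq> A" for k
    proof -
      have "closed {x. 1 \<le> real k * infdist x (- A)}"
        by (intro closed_Collect_le continuous_intros)
      moreover have "{x. f k x \<noteq> 0} \<subseteq> {x. 1 \<le> real k * infdist x (- A)}"
        by (auto simp: f_def)
      ultimately have "supp (f k) \<subseteq> {x. 1 \<le> real k * infdist x (- A)}"
        unfolding supp_def by (rule closure_minimal[rotated])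
      also have "\<dots> \<subseteq> A"
      proof
        fix x assume x: "x \<in> {x. 1 \<le> real k * infdist x (- A)}"
        show "x \<in> A"
        proof (rule ccontr)
          assume "x \<notin> A"
          then have "infdist x (- A) = 0" by (intro infdist_zero) simp
          then show False using x by simp
        qed
      qed
      finally show ?thesis .
    qed
    moreover have "\<bar>f k x\<bar> \<le> 1" for k x by (auto simp: f_def)
    ultimately have "AE x in m. f k x \<noteq> 0 \<longrightarrow> pn v x = 0" for k by (rule f0)
    then have "AE x in m. \<forall>k. f k x \<noteq> 0 \<longrightarrow> pn v x = 0" by (subst AE_all_countable) (rule allI)
    then show ?thesis
    proof eventually_elim
      case (elim x)
      show ?case
      proof
        assume x: "x \<in> A"
        then have pos: "0 < infdist x (- A)"
          using A False by (intro infdist_pos_not_in_closed) (auto simp: closed_Compl)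
        obtain k :: nat where "1 / infdist x (- A) < real k" using reals_Archimedean2 by blast
        then have "1 < real k * infdist x (- A)" using pos by (simp add: field_simps)
        then have "f k x \<noteq> 0" by (simp add: f_def)
        then show "pn v x = 0" using elim by blast
      qed
    qed
  qed
qed

lemma act_sum_right: "f \<in> Lp_space m \<infinity> \<Longrightarrow> act f (\<Sum>i\<in>I. v i) = (\<Sum>i\<in>I. act f (v i))"
  by (induction I rule: infinite_finite_induct) (auto simp: act_zero_right act_add_right)

text \<open>Disjointness makes the bound \<epsilon> independent of the number \<open>n\<close> of
  pieces, and multiplication by the indicator of \<open>E k\<close> isolates the piece
  \<open>u k\<close>.\<close>

lemma glued_sum:
  fixes E :: "nat \<Rightarrow> 'a set" and n :: nat
  assumes E: "\<And>i. E i \<in> sets borel" "disjoint_family E" and e: "0 \<le> \<epsilon>"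
    and u: "\<And>i. AE x in m. x \<in> E i \<longrightarrow> pn (u i) x \<le> \<epsilon>"
  defines "w \<equiv> \<Sum>i<n. act (indicat_real (E i)) (u i)"
  shows "AE x in m. pn w x \<le> \<epsilon>"
    and "k < n \<Longrightarrow> AE x in m. x \<in> E k \<longrightarrow> pn (w - u k) x = 0"
proof -
  have "AE x in m. \<forall>i. pn (act (indicat_real (E i)) (u i)) x = indicat_real (E i) x * pn (u i) x"
    unfolding AE_all_countable using pn_act[OF indicator_Linf[OF E(1)]] by simp
  moreover have "AE x in m. \<forall>i. x \<in> E i \<longrightarrow> pn (u i) x \<le> \<epsilon>"
    unfolding AE_all_countable using u by blast
  moreover have "AE x in m. pn w x \<le> (\<Sum>i<n. pn (act (indicat_real (E i)) (u i)) x)"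
    unfolding w_def by (intro pn_sum_le) simp
  ultimately show "AE x in m. pn w x \<le> \<epsilon>"
  proof eventually_elim
    case (elim x)
    have le: "pn w x \<le> (\<Sum>i<n. indicat_real (E i) x * pn (u i) x)" using elim(1,3) by simp
    show ?case
    proof (cases "\<exists>k<n. x \<in> E k")
      case True
      then obtain k where k: "k < n" "x \<in> E k" by blast
      have "indicat_real (E i) x * pn (u i) x = (if i = k then pn (u k) x else 0)" for i
        using k(2) E(2) by (auto simp: disjoint_family_on_def indicator_def)
      then have "(\<Sum>i<n. indicat_real (E i) x * pn (u i) x) = pn (u k) x" using k(1) by simp
      then show ?thesis using le elim(2) k(2) by fastforce
    next
      case False
      then have "(\<Sum>i<n. indicat_real (E i) x * pn (u i) x) = 0" by (intro sum.neutral) auto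
      then show ?thesis using le e by simp
    qed
  qed
  assume k: "k < n"
  let ?e = "\<lambda>i. indicat_real (E i)"
  have "act (?e k) w = (\<Sum>i<n. act (\<lambda>x. ?e k x * ?e i x) (u i))"
    unfolding w_def
    by (simp add: act_sum_right[OF indicator_Linf[OF E(1)]] act_act[OF indicator_Linf[OF E(1)] indicator_Linf[OF E(1)]])
  also have "\<dots> = (\<Sum>i<n. if i = k then act (?e k) (u k) else 0)"
  proof (rule sum.cong[OF refl])
    fix i
    have "(\<lambda>x. ?e k x * ?e i x) = (if i = k then ?e k else (\<lambda>x. 0))"
      using E(2) by (auto simp: disjoint_family_on_def indicator_def fun_eq_iff)
    then show "act (\<lambda>x. ?e k x * ?e i x) (u i) = (if i = k then act (?e k) (u k) else 0)"
      by (simp add: act_const)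
  qed
  also have "\<dots> = act (?e k) (u k)" using k by simp
  finally have z: "act (?e k) (w - u k) = 0" by (simp add: act_diff_right[OF indicator_Linf[OF E(1)]])
  show "AE x in m. x \<in> E k \<longrightarrow> pn (w - u k) x = 0"
    using pn_act[OF indicator_Linf[OF E(1)], of k "w - u k"] pn_zero by eventually_elim (use z in auto)
qed

text \<open>Two strongly local measures agreeing on \<open>W\<close> agree on \<open>V\<close>: on each piece of a countable
  partition of \<open>B\<close>, \<open>v\<close> differs from an element of \<open>W\<close> by at most \<open>\<epsilon>\<close>, and gluing these differences
  bounds the difference of the two measures at \<open>(B, v)\<close> by \<open>\<epsilon>\<close> times its dual norm at \<open>B\<close>.\<close>

lemma strongly_local_unique:
  assumes gen: "generates m act W" and W: "subspace W" "W \<subseteq> V"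
    and K1: "local_vector_measure R1 V nrm act K1" "strongly_local m pn V K1"
    and K2: "local_vector_measure R2 V nrm act K2" "strongly_local m pn V K2"
    and eq: "\<And>B v. B \<in> sets borel \<Longrightarrow> v \<in> W \<Longrightarrow> K1 B v = K2 B v"
    and B: "B \<in> sets borel" and v: "v \<in> V"
  shows "K1 B v = K2 B v"
proof -
  let ?dn = "dual_norm V nrm"
  define D where "D B v = K1 B v - K2 B v" for B v
  have K_dual: "K1 A \<in> dual_space V nrm" "K2 A \<in> dual_space V nrm" if "A \<in> sets borel" for A
    using that K1(1) K2(1) by (auto simp: local_vector_measure_def)
  have D_dual: "D A \<in> dual_space V nrm" if "A \<in> sets borel" for A
    unfolding D_def[abs_def] using K_dual[OF that] by (rule dual_space_diff)
  have D_diff: "D A (u - w) = D A u - D A w" if "A \<in> sets borel" "u \<in> V" "w \<in> V" for A u w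
  proof -
    have "\<forall>v\<in>V. \<forall>w\<in>V. D A (v + w) = D A v + D A w"
      using D_dual[OF that(1)] by (simp add: dual_space_def)
    then have "D A ((u - w) + w) = D A (u - w) + D A w"
      using subspace_diff[OF subspace_V that(2,3)] that(3) by blast
    then show ?thesis by simp
  qed
  have D_local: "D A u = 0" if "A \<in> sets borel" "u \<in> V" "AE x in m. x \<in> A \<longrightarrow> pn u x = 0" for A u
    using K1(2) K2(2) that by (auto simp: strongly_local_def D_def)
  have D_W: "D A u = 0" if "A \<in> sets borel" "u \<in> W" for A u using eq[OF that] by (simp add: D_def)
  have D_sigma: "(\<lambda>n. ?dn (\<lambda>v. D (\<Union>i. A i) v - (\<Sum>i<n. D (A i) v))) \<longlonglongrightarrow> 0"
    and D_sum_dual: "(\<lambda>v. \<Sum>i<n. D (A i) v) \<in> dual_space V nrm"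
    if A: "range A \<subseteq> sets borel" "disjoint_family A" for A :: "nat \<Rightarrow> 'a set" and n
  proof -
    have Ai: "A i \<in> sets borel" "(\<Union>i. A i) \<in> sets borel" for i using A(1) by auto
    have sum_dual: "(\<lambda>v. \<Sum>i<n. K (A i) v) \<in> dual_space V nrm"
      if "\<And>A. A \<in> sets borel \<Longrightarrow> K A \<in> dual_space V nrm" for K and n :: nat
      using that Ai(1) sup_pn_nonneg by (intro dual_space_sum) auto
    show "(\<lambda>v. \<Sum>i<n. D (A i) v) \<in> dual_space V nrm" by (rule sum_dual[OF D_dual])
    let ?r = "\<lambda>K n v. K (\<Union>i. A i) v - (\<Sum>i<n. K (A i) v)"
    have r_dual: "?r K n \<in> dual_space V nrm"
      if "\<And>A. A \<in> sets borel \<Longrightarrow> K A \<in> dual_space V nrm" for K and n :: nat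
      using that[OF Ai(2)] sum_dual[OF that] by (rule dual_space_diff)
    have lim: "(\<lambda>n. ?dn (?r K1 n)) \<longlonglongrightarrow> 0" "(\<lambda>n. ?dn (?r K2 n)) \<longlonglongrightarrow> 0"
      using K1(1) K2(1) A unfolding local_vector_measure_def by auto
    have "?r D n = (\<lambda>v. ?r K1 n v - ?r K2 n v)" for n
      by (auto simp: D_def sum_subtractf fun_eq_iff)
    then have le: "?dn (?r D n) \<le> ?dn (?r K1 n) + ?dn (?r K2 n)" for n
      using dual_norm_diff_le[OF r_dual[OF K_dual(1)] r_dual[OF K_dual(2)] normed_space_V] by simp
    show "(\<lambda>n. ?dn (?r D n)) \<longlonglongrightarrow> 0"
    proof (rule tendsto_sandwich[where f = "\<lambda>_. 0" and h = "\<lambda>n. ?dn (?r K1 n) + ?dn (?r K2 n)"])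
      show "\<forall>\<^sub>F n in sequentially. 0 \<le> ?dn (?r D n)"
        by (intro always_eventually allI dual_norm_nonneg[OF _ normed_space_V] r_dual D_dual)
    qed (use le tendsto_add[OF lim] in auto)
  qed
  obtain C where C: "countable C" "C \<subseteq> W" "AE x in m. \<forall>\<epsilon>>0. \<exists>w\<in>C. pn (v - w) x < \<epsilon>"
    by (rule generates_imp_pn_dense[OF gen W(1)])
  \<comment> \<open>\<open>from_nat_into\<close> enumerates only nonempty countable sets.\<close>
  have "C \<noteq> {}"
  proof (rule AE_imp_pos[OF _ C(3)])
    fix x assume "\<forall>\<epsilon>>0. \<exists>w\<in>C. pn (v - w) x < \<epsilon>"
    then show "C \<noteq> {}" using zero_less_one by blast
  qed
  then have range_C: "range (from_nat_into C) = C" using C(1) by (rule range_from_nat_into)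
  define c where "c = from_nat_into C"
  have cW: "c j \<in> W" for j using range_C C(2) by (auto simp: c_def)
  have est: "\<bar>D B v\<bar> \<le> ?dn (D B) * \<epsilon>" if e: "0 < \<epsilon>" for \<epsilon>
  proof -
    define A where "A j = B \<inter> {x. pn (v - c j) x < \<epsilon>}" for j
    have "{x \<in> space m. pn (v - c j) x < \<epsilon>} \<in> sets m" for j by measurable
    then have A: "A j \<in> sets borel" for j using B by (auto simp: A_def)
    \<comment> \<open>Piece \<open>0\<close> holds the points of \<open>B\<close> where no
      \<open>c j\<close> is close to \<open>v\<close>. It is null by density, so the default
      \<open>u 0 = 0\<close> is harmless.\<close>
    define E where "E i = (case i of 0 \<Rightarrow> B - (\<Union>j. A j) | Suc j \<Rightarrow> disjointed A j)" for i
    define u where "u i = (case i of 0 \<Rightarrow> 0 | Suc j \<Rightarrow> v - c j)" for i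
    have dA: "disjointed A j \<in> sets borel" "disjointed A j \<subseteq> A j" for j
      using A sets.range_disjointed_sets'[of A borel] by (auto intro!: disjointed_subset)
    have E: "E i \<in> sets borel" for i
      using A B dA(1) by (auto simp: E_def split: nat.split)
    have E_disj: "disjoint_family E"
      unfolding disjoint_family_on_def
    proof (intro ballI impI)
      fix i j :: nat assume "i \<noteq> j"
      then show "E i \<inter> E j = {}"
        using disjoint_family_disjointed[of A]
        by (auto simp: E_def disjoint_family_on_def split: nat.splits dest: subsetD[OF dA(2)])
    qed
    have E_UN: "(\<Union>i. E i) = B"
    proof -
      have "(\<Union>i. E i) = (\<Union>i\<in>insert 0 (range Suc). E i)" by (simp only: UNIV_nat_eq[symmetric])
      also have "\<dots> = E 0 \<union> (\<Union>j. E (Suc j))" by auto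
      also have "\<dots> = (B - (\<Union>j. A j)) \<union> (\<Union>j. A j)" by (simp add: E_def UN_disjointed_eq)
      also have "\<dots> = B" by (auto simp: A_def)
      finally show ?thesis .
    qed
    have uV: "u i \<in> V" for i
      using V_0 v cW W(2) by (auto simp: u_def split: nat.split intro!: subspace_diff[OF subspace_V])
    have E0: "AE x in m. x \<notin> E 0"
      using C(3)
    proof eventually_elim
      case (elim x)
      then obtain w where "w \<in> C" "pn (v - w) x < \<epsilon>" using e by blast
      then obtain j where "pn (v - c j) x < \<epsilon>" using range_C unfolding c_def by (metis imageE)
      then show ?case by (auto simp: E_def A_def)
    qed
    have u_le: "AE x in m. x \<in> E i \<longrightarrow> pn (u i) x \<le> \<epsilon>" for i
    proof (cases i)
      case 0
      then show ?thesis using E0 by auto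
    next
      case (Suc j)
      then show ?thesis using dA(2)[of j] by (intro AE_I2) (auto simp: E_def u_def A_def)
    qed
    have D_u: "D (E i) v = D (E i) (u i)" for i
    proof (cases i)
      case 0
      have "AE x in m. x \<in> E 0 \<longrightarrow> pn w x = 0" for w using E0 by eventually_elim auto
      then show ?thesis using D_local[OF E] v uV 0 by simp
    next
      case (Suc j)
      have "D (E i) (v - c j) = D (E i) v - D (E i) (c j)"
        using cW W(2) by (intro D_diff E v) auto
      then show ?thesis using D_W[OF E cW, of i j] Suc by (simp add: u_def)
    qed
    have range_E: "range E \<subseteq> sets borel" using E by auto
    let ?S = "\<lambda>n v. \<Sum>i<n. D (E i) v"
    let ?\<delta> = "\<lambda>n. ?dn (\<lambda>v. D B v - ?S n v)"
    note S_dual = D_sum_dual[OF range_E E_disj]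
    \<comment> \<open>A single \<open>w\<close> of norm at most \<epsilon> replaces all residuals
      \<open>u i\<close>, so the partial sum is one functional evaluated at \<open>w\<close>;
      bounding it term by term would bring in the total variation of \<open>D\<close>.\<close>
    have le: "\<bar>D B v\<bar> \<le> ?\<delta> n * nrm v + (?dn (D B) + ?\<delta> n) * \<epsilon>" for n
    proof -
      define w where "w = (\<Sum>i<n. act (indicat_real (E i)) (u i))"
      note G = glued_sum[OF E E_disj less_imp_le[OF e] u_le, where n = n, folded w_def]
      have wV: "w \<in> V" and nw: "nrm w \<le> \<epsilon>" using V_I[OF G(1)] sup_pn_le[OF G(1)] by auto
      have "?S n v = ?S n w"
      proof (rule sum.cong[OF refl])
        fix i assume "i \<in> {..<n}"
        then have "D (E i) (w - u i) = 0"
          using G(2)[of i] by (intro D_local E subspace_diff[OF subspace_V wV uV]) auto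
        then show "D (E i) v = D (E i) w" using D_diff[OF E wV uV] D_u[of i] by simp
      qed
      then have "\<bar>?S n v\<bar> \<le> ?dn (?S n) * nrm w"
        using dual_norm_bound[OF S_dual normed_space_V wV] by simp
      also have "\<dots> \<le> ?dn (?S n) * \<epsilon>"
        using nw dual_norm_nonneg[OF S_dual normed_space_V] by (rule mult_left_mono)
      also have "?dn (?S n) \<le> ?dn (D B) + ?\<delta> n"
        using dual_norm_diff_le[OF D_dual[OF B] dual_space_diff[OF D_dual[OF B] S_dual] normed_space_V, of n]
        by simp
      finally have "\<bar>?S n v\<bar> \<le> (?dn (D B) + ?\<delta> n) * \<epsilon>" using e by simp
      moreover have "\<bar>D B v - ?S n v\<bar> \<le> ?\<delta> n * nrm v"
        using dual_norm_bound[OF dual_space_diff[OF D_dual[OF B] S_dual] normed_space_V v] .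
      ultimately show ?thesis by linarith
    qed
    have "?\<delta> \<longlonglongrightarrow> 0" using D_sigma[OF range_E E_disj] E_UN by simp
    then have "(\<lambda>n. ?\<delta> n * nrm v + (?dn (D B) + ?\<delta> n) * \<epsilon>) \<longlonglongrightarrow> 0 * nrm v + (?dn (D B) + 0) * \<epsilon>"
      by (intro tendsto_intros)
    then have "(\<lambda>n. ?\<delta> n * nrm v + (?dn (D B) + ?\<delta> n) * \<epsilon>) \<longlonglongrightarrow> ?dn (D B) * \<epsilon>" by simp
    then show ?thesis using le by (intro LIMSEQ_le_const) auto
  qed
  have nn: "0 \<le> ?dn (D B)" by (rule dual_norm_nonneg[OF D_dual[OF B] normed_space_V])
  have "\<bar>D B v\<bar> \<le> 0 + \<epsilon>" if e: "0 < \<epsilon>" for \<epsilon>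
  proof -
    have "\<bar>D B v\<bar> \<le> ?dn (D B) * (\<epsilon> / (?dn (D B) + 1))" using e nn by (intro est) simp
    also have "\<dots> \<le> \<epsilon>" using e nn by (simp add: field_simps)
    finally show ?thesis by simp
  qed
  then have "\<bar>D B v\<bar> \<le> 0" by (rule field_le_epsilon)
  then show ?thesis by (simp add: D_def)
qed

end

section \<open>The extension\<close>

context polar_local_vector_measure
begin

text \<open>If \<open>h\<close> is a density of \<open>\<nu>\<close> with respect to
  \<open>m\<close>, then \<open>m\<close> and \<open>\<nu>\<close> have the same null sets inside
  \<open>{x. 0 < h x}\<close>.\<close>

lemma carrier_exists:
  obtains P where "P \<in> sets borel" "AE x in \<nu>. x \<in> P"
    "\<And>Q. AE x in \<nu>. Q x \<Longrightarrow> AE x in m. x \<in> P \<longrightarrow> Q x"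
proof -
  interpret sigma_finite_measure m by (rule sigma_finite)
  obtain h where h: "h \<in> borel_measurable m" "density m h = \<nu>"
    using Radon_Nikodym[OF ac] by auto
  have AE_iff: "(AE x in \<nu>. Q x) \<longleftrightarrow> (AE x in m. 0 < h x \<longrightarrow> Q x)" for Q
    using AE_density[OF h(1), of Q] unfolding h(2) .
  have "{x \<in> space m. 0 < h x} \<in> sets m" using h(1) by measurable
  then show thesis by (intro that[of "{x. 0 < h x}"]) (simp_all add: AE_iff)
qed

lemma strongly_local_imp_local_dual:
  assumes sl: "strongly_local \<nu> pn W N"
    and trunc: "\<And>v. v \<in> W \<Longrightarrow> act (\<lambda>x. 1 / max 1 (pn v x)) v \<in> W"
  shows "\<exists>M\<in>local_module_dual m act. represents m pn W \<nu> L M"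
proof -
  obtain P where P: "P \<in> sets borel" "AE x in \<nu>. x \<in> P"
    "\<And>Q. AE x in \<nu>. Q x \<Longrightarrow> AE x in m. x \<in> P \<longrightarrow> Q x" by (rule carrier_exists) blast
  obtain M where M: "\<And>v. M v \<in> borel_measurable borel" "\<And>v. AE x in m. \<bar>M v x\<bar> \<le> pn v x"
    "\<And>v w. AE x in m. M (v + w) x = M v x + M w x"
    "\<And>f v. f \<in> Lp_space m \<infinity> \<Longrightarrow> AE x in m. M (act f v) x = f x * M v x"
    "represents m pn W \<nu> L M"
    by (rule extension_exists[OF strongly_local_imp_L_le_pn[OF sl trunc] P]) blast+
  have "(\<lambda>v x. indicator B x * M v x) \<in> module_dual m act" if "B \<in> sets borel" "bounded B" for B
    using pn_integrable_finite[OF that(1) emeasure_bounded_finite[OF that(2)]] M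
    by (intro module_dual_cutoff[OF that(1)])
  then show ?thesis using M(5) by (auto simp: local_module_dual_def)
qed

text \<open>The last premise provides a set \<open>S\<close> carrying \<open>\<nu>\<close> over
  which the integral of \<open>pn u\<close> is bounded by a multiple of \<open>norm u\<close>: the
  whole space if \<open>p = 1\<close>, a set of finite measure otherwise. \<open>M\<close> is built
  to vanish off \<open>S\<close>, so cutting it off there changes nothing.\<close>

lemma strongly_local_imp_dual:
  assumes sl: "strongly_local \<nu> pn W N"
    and trunc: "\<And>v. v \<in> W \<Longrightarrow> act (\<lambda>x. 1 / max 1 (pn v x)) v \<in> W"
    and fin: "p = 1 \<or> (\<exists>S\<in>sets borel. emeasure m S < \<infinity> \<and> emeasure \<nu> (- S) = 0)"
  shows "\<exists>M\<in>module_dual m act. represents m pn W \<nu> L M"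
proof -
  obtain S C where S: "S \<in> sets borel" "AE x in \<nu>. x \<in> S"
    "\<And>u. integrable m (\<lambda>x. indicator S x * pn u x)"
    "\<And>u. (\<integral>x. indicator S x * pn u x \<partial>m) \<le> C * norm u"
  proof (cases "p = 1")
    case True
    show thesis using pn_integrable_L1[OF _ True, of UNIV] by (intro that[of UNIV 1]) auto
  next
    case False
    then obtain S where S: "S \<in> sets borel" "emeasure m S < \<infinity>" "emeasure \<nu> (- S) = 0" using fin by auto
    have "- S \<in> null_sets \<nu>" using S(1,3) by auto
    from AE_not_in[OF this] show thesis
      using pn_integrable_finite[OF S(1,2)] S(1) by (intro that[of S "measure m S + 1"]) auto
  qed
  obtain P where P: "P \<in> sets borel" "AE x in \<nu>. x \<in> P"
    "\<And>Q. AE x in \<nu>. Q x \<Longrightarrow> AE x in m. x \<in> P \<longrightarrow> Q x" by (rule carrier_exists) blast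
  have PS: "P \<inter> S \<in> sets borel" "AE x in \<nu>. x \<in> P \<inter> S"
    using P(1,2) S(1,2) by auto
  have transfer: "AE x in m. x \<in> P \<inter> S \<longrightarrow> Q x" if "AE x in \<nu>. Q x" for Q
    using P(3)[OF that] by eventually_elim auto
  obtain M where M: "\<And>v. M v \<in> borel_measurable borel" "\<And>v x. x \<notin> P \<inter> S \<Longrightarrow> M v x = 0"
    "\<And>v. AE x in m. \<bar>M v x\<bar> \<le> pn v x"
    "\<And>v w. AE x in m. M (v + w) x = M v x + M w x"
    "\<And>f v. f \<in> Lp_space m \<infinity> \<Longrightarrow> AE x in m. M (act f v) x = f x * M v x"
    "represents m pn W \<nu> L M"
    by (rule extension_exists[OF strongly_local_imp_L_le_pn[OF sl trunc] PS transfer]) blast+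
  have "(\<lambda>v x. indicator S x * M v x) \<in> module_dual m act"
    using S M by (intro module_dual_cutoff[OF S(1)])
  moreover have "(\<lambda>v x. indicator S x * M v x) = M"
    using M(2) by (auto simp: fun_eq_iff indicator_def)
  ultimately show ?thesis using M(6) by auto
qed

section \<open>The measure represented by an element of the local dual\<close>

context
  fixes M
  assumes M: "M \<in> local_module_dual m act" and rep: "represents m pn W \<nu> L M"
begin

lemma M_meas: "M v \<in> borel_measurable \<nu>"
  using local_dual_meas[OF M] measurable_cong_sets[OF sets_\<nu> refl] by blast

lemma M_le: "AE x in \<nu>. \<bar>M v x\<bar> \<le> pn v x"
  using rep by (intro local_dual_le_pn[OF M ac sets_\<nu>]) (simp add: represents_def)

lemma M_eq_L: "w \<in> W \<Longrightarrow> AE x in \<nu>. L x w = M w x"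
  using rep by (simp add: represents_def)

lemma M_integrable: "v \<in> V \<Longrightarrow> integrable \<nu> (M v)"
proof (rule \<nu>.integrable_const_bound[OF _ M_meas])
  assume v: "v \<in> V"
  show "AE x in \<nu>. norm (M v x) \<le> nrm v"
    using M_le[of v] AE_\<nu>[OF sup_pn_AE[OF v]] by eventually_elim simp
qed

lemma M_set_integrable: "v \<in> V \<Longrightarrow> A \<in> sets borel \<Longrightarrow> integrable \<nu> (\<lambda>x. indicator A x * M v x)"
  using integrable_mult_indicator[OF _ M_integrable, of A v] by simp

lemma represented_eq_N:
  assumes "A \<in> sets borel" "w \<in> W" shows "(LINT x:A|\<nu>. M w x) = N A w"
proof -
  have "AE x in \<nu>. indicator A x *\<^sub>R M w x = indicator A x *\<^sub>R L x w"
    using M_eq_L[OF assms(2)] by eventually_elim simp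
  then show ?thesis
    unfolding N_eq[OF assms(2,1)] set_lebesgue_integral_def
    using M_meas assms L_int[OF assms(2)] by (intro integral_cong_AE) auto
qed

lemma set_integral_zero:
  assumes "A \<in> sets borel" "AE x in \<nu>. x \<in> A \<longrightarrow> pn v x = 0"
  shows "(LINT x:A|\<nu>. M v x) = 0"
proof -
  have "AE x in \<nu>. indicator A x *\<^sub>R M v x = 0"
    using M_le[of v] assms(2) by eventually_elim (auto simp: indicator_def)
  then show ?thesis unfolding set_lebesgue_integral_def by (rule integral_eq_zero_AE)
qed

lemma represented_strongly_local: "strongly_local \<nu> pn W N"
  unfolding strongly_local_def
proof (intro ballI impI)
  fix v and B :: "'a set" assume v: "v \<in> W" and B: "B \<in> sets borel" "AE x in \<nu>. x \<in> B \<longrightarrow> pn v x = 0"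
  show "N B v = 0" using represented_eq_N[OF B(1) v] set_integral_zero[OF B] by simp
qed

lemma set_integral_bound:
  assumes A: "A \<in> sets borel" and v: "v \<in> V"
  shows "\<bar>LINT x:A|\<nu>. M v x\<bar> \<le> measure \<nu> A * nrm v"
proof -
  have "\<bar>LINT x:A|\<nu>. M v x\<bar> \<le> (LINT x|\<nu>. \<bar>indicator A x * M v x\<bar>)"
    unfolding set_lebesgue_integral_def using integral_abs_bound[of \<nu> "\<lambda>x. indicator A x * M v x"] by simp
  also have "\<dots> \<le> (LINT x|\<nu>. nrm v * indicator A x)"
  proof (rule integral_mono_AE)
    show "AE x in \<nu>. \<bar>indicator A x * M v x\<bar> \<le> nrm v * indicator A x"
      using M_le[of v] AE_\<nu>[OF sup_pn_AE[OF v]] by eventually_elim (auto simp: indicator_def)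
    show "integrable \<nu> (\<lambda>x. nrm v * indicator A x)"
      using A \<nu>.emeasure_finite[of A]
      by (intro integrable_mult_right integrable_real_indicator) (auto simp: less_top[symmetric] infinity_ennreal_def)
  qed (intro integrable_abs M_set_integrable A v)
  also have "\<dots> = measure \<nu> A * nrm v" using A by simp
  finally show ?thesis .
qed

lemma set_integral_dual:
  assumes A: "A \<in> sets borel"
  shows "(\<lambda>v. LINT x:A|\<nu>. M v x) \<in> dual_space V nrm"
proof -
  have "(LINT x:A|\<nu>. M (v + w) x) = (LINT x:A|\<nu>. M v x) + (LINT x:A|\<nu>. M w x)"
    if "v \<in> V" "w \<in> V" for v w
  proof -
    have "(LINT x:A|\<nu>. M (v + w) x) = (LINT x|\<nu>. indicator A x * M v x + indicator A x * M w x)"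
      unfolding set_lebesgue_integral_def
    proof (rule integral_cong_AE)
      show "AE x in \<nu>. indicator A x *\<^sub>R M (v + w) x = indicator A x * M v x + indicator A x * M w x"
        using AE_\<nu>[OF local_dual_add[OF M, of v w]] by eventually_elim (simp add: algebra_simps)
    qed (use M_meas A in auto)
    then show ?thesis
      using M_set_integrable[OF that(1) A] M_set_integrable[OF that(2) A]
      by (simp add: set_lebesgue_integral_def)
  qed
  moreover have "(LINT x:A|\<nu>. M (c *\<^sub>R v) x) = c * (LINT x:A|\<nu>. M v x)" for c v
  proof -
    have "(LINT x:A|\<nu>. M (c *\<^sub>R v) x) = (LINT x|\<nu>. c * (indicator A x * M v x))"
      unfolding set_lebesgue_integral_def
    proof (rule integral_cong_AE)
      show "AE x in \<nu>. indicator A x *\<^sub>R M (c *\<^sub>R v) x = c * (indicator A x * M v x)"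
        using AE_\<nu>[OF local_dual_act[OF M const_Linf[of c], of v]]
        by eventually_elim (simp add: act_const)
    qed (use M_meas A in auto)
    then show ?thesis by (simp add: set_lebesgue_integral_def)
  qed
  moreover have "\<exists>C. \<forall>v\<in>V. \<bar>LINT x:A|\<nu>. M v x\<bar> \<le> C * nrm v"
    using set_integral_bound[OF A] by blast
  ultimately show ?thesis by (simp add: dual_space_def)
qed

text \<open>The error after \<open>n\<close> terms is integration over the tail \<open>T n\<close>.
  Its dual norm is at most \<open>measure \<nu> (T n)\<close>, which tends to \<open>0\<close>
  because \<open>\<nu>\<close> is finite.\<close>

lemma represented_sigma_additive:
  fixes A :: "nat \<Rightarrow> 'a set"
  assumes A: "range A \<subseteq> sets borel" "disjoint_family A"
  shows "(\<lambda>n. dual_norm V nrm (\<lambda>v. (LINT x:(\<Union>i. A i)|\<nu>. M v x) - (\<Sum>i<n. LINT x:A i|\<nu>. M v x))) \<longlonglongrightarrow> 0"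
proof -
  define T where "T n = (\<Union>i. A i) - (\<Union>i<n. A i)" for n
  have Ai: "A i \<in> sets borel" "(\<Union>i. A i) \<in> sets borel" "T n \<in> sets borel" for i n
    using A(1) by (auto simp: T_def)
  have ind: "indicat_real (\<Union>i. A i) x - (\<Sum>i<n. indicat_real (A i) x) = indicat_real (T n) x" for n x
  proof -
    have "(\<Sum>i<n. indicat_real (A i) x) = indicat_real (\<Union>i<n. A i) x"
      using A(2) by (subst indicator_UN_disjoint) (auto simp: disjoint_family_on_def)
    then show ?thesis by (auto simp: T_def indicator_def)
  qed
  have eq: "(LINT x:(\<Union>i. A i)|\<nu>. M v x) - (\<Sum>i<n. LINT x:A i|\<nu>. M v x) = (LINT x:T n|\<nu>. M v x)"
    if v: "v \<in> V" for v n
  proof -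
    have "(LINT x:(\<Union>i. A i)|\<nu>. M v x) - (\<Sum>i<n. LINT x:A i|\<nu>. M v x) =
        (LINT x|\<nu>. indicator (\<Union>i. A i) x * M v x - (\<Sum>i<n. indicator (A i) x * M v x))"
      unfolding set_lebesgue_integral_def real_scaleR_def
      using M_set_integrable[OF v Ai(1)] M_set_integrable[OF v Ai(2)]
      by (simp only: Bochner_Integration.integral_diff Bochner_Integration.integral_sum
          Bochner_Integration.integrable_sum)
    also have "\<dots> = (LINT x|\<nu>. indicator (T n) x * M v x)"
      by (simp flip: ind add: sum_distrib_right left_diff_distrib)
    finally show ?thesis by (simp add: set_lebesgue_integral_def)
  qed
  have meas_T: "(\<lambda>n. measure \<nu> (T n)) \<longlonglongrightarrow> 0"
  proof -
    have "measure \<nu> (T n) = measure \<nu> (\<Union>i. A i) - (\<Sum>i<n. measure \<nu> (A i))" for n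
    proof -
      have "measure \<nu> (\<Union>i<n. A i) = (\<Sum>i<n. measure \<nu> (A i))"
        using A by (intro \<nu>.finite_measure_finite_Union) (auto simp: disjoint_family_on_def)
      then show ?thesis unfolding T_def using A(1) by (subst \<nu>.finite_measure_Diff) auto
    qed
    moreover have "(\<lambda>n. \<Sum>i<n. measure \<nu> (A i)) \<longlonglongrightarrow> measure \<nu> (\<Union>i. A i)"
      using \<nu>.finite_measure_UNION[OF _ A(2)] A(1) by (simp add: sums_def)
    from tendsto_diff[OF tendsto_const this, of "measure \<nu> (\<Union>i. A i)"]
    have "(\<lambda>n. measure \<nu> (\<Union>i. A i) - (\<Sum>i<n. measure \<nu> (A i))) \<longlonglongrightarrow> 0" by simp
    ultimately show ?thesis by simp
  qed
  show ?thesis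
  proof (rule tendsto_sandwich[OF _ _ tendsto_const meas_T]; intro always_eventually allI)
    fix n
    have "(\<lambda>v. (LINT x:(\<Union>i. A i)|\<nu>. M v x) - (\<Sum>i<n. LINT x:A i|\<nu>. M v x)) \<in> dual_space V nrm"
      using set_integral_dual Ai sup_pn_nonneg by (intro dual_space_diff dual_space_sum) auto
    then show "0 \<le> dual_norm V nrm (\<lambda>v. (LINT x:(\<Union>i. A i)|\<nu>. M v x) - (\<Sum>i<n. LINT x:A i|\<nu>. M v x))"
      by (rule dual_norm_nonneg[OF _ normed_space_V])
    show "dual_norm V nrm (\<lambda>v. (LINT x:(\<Union>i. A i)|\<nu>. M v x) - (\<Sum>i<n. LINT x:A i|\<nu>. M v x)) \<le> measure \<nu> (T n)"
    proof (rule dual_norm_le[OF normed_space_V])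
      fix v assume v: "v \<in> V" "nrm v \<le> 1"
      have "\<bar>LINT x:T n|\<nu>. M v x\<bar> \<le> measure \<nu> (T n) * nrm v" by (rule set_integral_bound[OF Ai(3) v(1)])
      also have "\<dots> \<le> measure \<nu> (T n) * 1" by (intro mult_left_mono v) simp
      finally show "\<bar>(LINT x:(\<Union>i. A i)|\<nu>. M v x) - (\<Sum>i<n. LINT x:A i|\<nu>. M v x)\<bar> \<le> measure \<nu> (T n)"
        unfolding eq[OF v(1)] by simp
    qed
  qed
qed

text \<open>Strong locality of the extension refers to \<open>m\<close>, that of \<open>N\<close> to
  \<open>\<nu>\<close>. Since \<open>m\<close>-null sets are \<open>\<nu>\<close>-null, both follow
  from \<open>\<bar>M v x\<bar> \<le> pn v x\<close> for \<open>\<nu>\<close>-a.e.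
  \<open>x\<close>.\<close>

lemma represented_extension:
  "strongly_local_extension m act pn W N (\<lambda>B v. LINT x:B|\<nu>. M v x)"
  unfolding strongly_local_extension_def local_vector_measure_def strongly_local_def
proof (intro conjI allI impI ballI)
  fix A and v assume A: "open A" and v: "v \<in> V" and "local_seminorm bcontfun nrm act A v = 0"
  from AE_\<nu>[OF local_seminorm_zero_imp[OF this]] show "(LINT x:A|\<nu>. M v x) = 0"
    using A by (intro set_integral_zero) auto
next
  fix v and B :: "'a set" assume B: "B \<in> sets borel" "AE x in m. x \<in> B \<longrightarrow> pn v x = 0"
  from set_integral_zero[OF B(1) AE_\<nu>[OF B(2)]] show "(LINT x:B|\<nu>. M v x) = 0" .
qed (use set_integral_dual represented_sigma_additive represented_eq_N in auto)

lemma represented_extension_unique: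
  assumes K: "strongly_local_extension m act pn W N K" and B: "B \<in> sets borel" and v: "v \<in> V"
  shows "K B v = (LINT x:B|\<nu>. M v x)"
proof (rule strongly_local_unique[OF gen subspace_W W_V _ _ _ _ _ B v])
  show "local_vector_measure bcontfun V nrm act K" "strongly_local m pn V K"
    "local_vector_measure bcontfun V nrm act (\<lambda>B v. LINT x:B|\<nu>. M v x)"
    "strongly_local m pn V (\<lambda>B v. LINT x:B|\<nu>. M v x)"
    using K represented_extension by (auto simp: strongly_local_extension_def)
  show "K A w = (LINT x:A|\<nu>. M w x)" if "A \<in> sets borel" "w \<in> W" for A w
    using K represented_eq_N[OF that] that by (simp add: strongly_local_extension_def)
qed

end

end

text \<open>For \<open>p > 1\<close> the dual norm lies in L^q with \<open>q\<close> finite, so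
  \<open>|M| = 1\<close> forces \<open>\<nu>\<close> to be carried by a set of finite
  \<open>m\<close>-measure. Hence the equivalence is stated with the local dual in general, and with
  the dual if \<open>p = 1\<close> or there is such a set. The extension formula is stated over the
  local dual, which contains the dual.\<close>

theorem proposition1p52:
  fixes m :: "'a::polish_space measure"
    and p :: ennreal
    and act :: "('a \<Rightarrow> real) \<Rightarrow> 'm::banach \<Rightarrow> 'm"
    and pn :: "'m \<Rightarrow> 'a \<Rightarrow> real"
    and R :: "('a \<Rightarrow> real) set"
    and W :: "'m set"
    and N :: "'a set \<Rightarrow> 'm \<Rightarrow> real"
    and L :: "'a \<Rightarrow> 'm \<Rightarrow> real"
  defines "\<nu> \<equiv> tv_measure W (sup_pn m pn) N"
  assumes "Lp_normed_module m p act pn"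
    and "approximating_subring R"
    and "W \<subseteq> bounded_part m pn"
    and "normed_module_over R W (sup_pn m pn) act"
    and "\<And>v. v \<in> W \<Longrightarrow> act (\<lambda>x. 1 / max 1 (pn v x)) v \<in> W"
    and "generates m act W"
    and "local_vector_measure R W (sup_pn m pn) act N"
    and "absolutely_continuous m \<nu>"
    and "polar_decomposition R W (sup_pn m pn) act N L"
  shows "(strongly_local \<nu> pn W N \<longleftrightarrow>
           (\<exists>M\<in>local_module_dual m act. represents m pn W \<nu> L M)) \<and>
         (p = 1 \<or> (\<exists>S\<in>sets borel. emeasure m S < \<infinity> \<and> emeasure \<nu> (- S) = 0) \<longrightarrow>
           (strongly_local \<nu> pn W N \<longleftrightarrow>
             (\<exists>M\<in>module_dual m act. represents m pn W \<nu> L M))) \<and>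
         (\<forall>M\<in>local_module_dual m act. represents m pn W \<nu> L M \<longrightarrow>
           (let Nhat = \<lambda>B v. LINT x:B|\<nu>. M v x in
             (\<forall>v\<in>bounded_part m pn. integrable \<nu> (M v)) \<and>
             strongly_local_extension m act pn W N Nhat \<and>
             (\<forall>K. strongly_local_extension m act pn W N K \<longrightarrow>
               (\<forall>B\<in>sets borel. \<forall>v\<in>bounded_part m pn. K B v = Nhat B v))))"
proof -
  interpret polar_local_vector_measure m p act pn R W N L
    using assms(2-5,7-10) unfolding \<nu>_def
    by (intro polar_local_vector_measure.intro polar_local_vector_measure_axioms.intro)
  have "strongly_local \<nu> pn W N \<longleftrightarrow> (\<exists>M\<in>local_module_dual m act. represents m pn W \<nu> L M)"
    unfolding \<nu>_def
    using strongly_local_imp_local_dual[OF _ assms(6)] represented_strongly_local by blast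
  moreover have "strongly_local \<nu> pn W N \<longleftrightarrow> (\<exists>M\<in>module_dual m act. represents m pn W \<nu> L M)"
    if "p = 1 \<or> (\<exists>S\<in>sets borel. emeasure m S < \<infinity> \<and> emeasure \<nu> (- S) = 0)"
    using strongly_local_imp_dual[OF _ assms(6) that[unfolded \<nu>_def]] represented_strongly_local
      module_dual_subset_local[OF sets_m, of act]
    unfolding \<nu>_def by blast
  moreover have "let Nhat = \<lambda>B v. LINT x:B|\<nu>. M v x in
             (\<forall>v\<in>bounded_part m pn. integrable \<nu> (M v)) \<and>
             strongly_local_extension m act pn W N Nhat \<and>
             (\<forall>K. strongly_local_extension m act pn W N K \<longrightarrow>
               (\<forall>B\<in>sets borel. \<forall>v\<in>bounded_part m pn. K B v = Nhat B v))"
    if "M \<in> local_module_dual m act" "represents m pn W \<nu> L M" for M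
    using M_integrable[OF that[unfolded \<nu>_def]] represented_extension[OF that[unfolded \<nu>_def]]
      represented_extension_unique[OF that[unfolded \<nu>_def]]
    unfolding \<nu>_def Let_def by blast
  ultimately show ?thesis by blast
qed

end
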